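(* Let $n\ge 2$ and let $u$ be a tempered generalized function on $\mathbb{C}$ whose Fourier transform $\widetilde u(c)$ is an ordinary (locally integrable) function with $|\widetilde u(c)|=|c|^{n-1}$ for almost every $c\in\mathbb{C}$. Then the generalized Radon transform $$(\mathcal{R}_u f)(a)=\int_{\mathbb{C}^n} f(x)\,u(x_n-a_1x_1-\dots-a_{n-1}x_{n-1}-a_n)\,d\mu(x),\qquad a=(a_1,\dots,a_n)\in\mathbb{C}^n,$$ is a generalized Fourier transform (GFT). That is, the kernel $U(t)=\int_{\mathbb{C}}[\widetilde u(c)]^{-1}|c|^{2(n-1)}e^{i\operatorname{Re}(ct)}\,d\mu(c)$ satisfies $U(t)=\overline{u(t)}$, so that with $\phi=\mathcal{R}_uf$ one has $$f(x)=\int_{\mathbb{C}^n}\phi(a)\,\overline{u(x_n-a_1x_1-\dots-a_{n-1}x_{n-1}-a_n)}\,d\mu(a),\qquad \int_{\mathbb{C}^n} f\,\overline{g}\,d\mu=\int_{\mathbb{C}^n}\mathcal{R}_uf\;\overline{\mathcal{R}_ug}\,d\mu$$ for all $f,g$ in the Schwartz space $\mathcal{S}(\mathbb{C}^n)$.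
   Context: Normalization: on $\mathbb{C}^m$, $d\mu$ is $(2\pi)^{-m}$ times Lebesgue measure. The Fourier transform on $\mathbb{C}$ is $\widetilde u(c)=\int_{\mathbb{C}}u(t)e^{i\operatorname{Re}(ct)}d\mu(t)$ (in the sense of tempered generalized functions), so $u(t)=\int\widetilde u(c)e^{-i\operatorname{Re}(ct)}d\mu(c)$. Generalized Fourier transform: an integral transform $F:f(x)\mapsto\hat f(y)=\int_X f(x)e(x,y)\,dx$ between functions on spaces $X$, $\hat X$ with fixed measures $dx$, $dy$, where $e(x,y)$ is a generalized function on $X\times\hat X$, is a GFT if the inversion formula $f(x)=\int\hat f(y)\overline{e(x,y)}\,dy$, and hence the Plancherel formula $\int f\overline g\,dx=\int\hat f\,\overline{\hat g}\,dy$, is valid. Here $X=\hat X=\mathbb{C}^n$ and $e(x,a)=u(x_n-a_1x_1-\dots-a_{n-1}x_{n-1}-a_n)$. Meaning of the integrals: write $a=(a',a_n)$, $x=(x',x_n)$ and $a'x'=\sum_{i<n}a_ix_i$. For $f\in\mathcal{S}(\mathbb{C}^n)$ the function $p\mapsto\int f(x',a'x'+p)\,d\mu(x')$ is in $\mathcal{S}(\mathbb{C})$, and $(\mathcal{R}_uf)(a)$ is the pairing over $p\in\mathbb{C}$ of this function with $u(p-a_n)$. Let $\widetilde\phi(a',c)$ be the Fourier transform in $a_n$ of $\phi=\mathcal{R}_uf$. For a kernel $V(t)=\int M(c)e^{i\operatorname{Re}(ct)}d\mu(c)$, the expression $\int\phi(a)V(x_n-a'x'-a_n)d\mu(a)$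 means $\int\int\widetilde\phi(a',-c)M(c)e^{i\operatorname{Re}(c(x_n-a'x'))}d\mu(a')\,d\mu(c)$. *)

theory Defs
  imports "HOL-Analysis.Analysis"
begin

text \<open>
  A function on \<open>\<complex>\<^sup>n\<close> is a function on \<^typ>\<open>(complex ^ 'm) \<times> complex\<close>, where
  \<open>CARD('m) = n - 1\<close>; a point is thus written \<open>(x', x\<^sub>n)\<close>.
\<close>

text \<open>On \<open>\<complex>\<^sup>m\<close> we have \<open>DIM = 2m\<close>, so that the factor below is \<open>(2\<pi>)\<close> to the power \<open>-m\<close>.\<close>

definition mu :: "'a::euclidean_space measure" where
  "mu = density lebesgue (\<lambda>_. ennreal ((2 * pi) powr (- (real DIM('a) / 2))))"


section \<open>Schwartz functions\<close>

fun iter_deriv :: "'a::euclidean_space list \<Rightarrow> ('a \<Rightarrow> complex) \<Rightarrow> 'a \<Rightarrow> complex" where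
  "iter_deriv [] f = f"
| "iter_deriv (b # bs) f = (\<lambda>x. frechet_derivative (iter_deriv bs f) (at x) b)"

text \<open>
  Derivatives are real ones: \<open>Basis\<close> is the standard basis of the underlying real
  Euclidean space, so lists over \<open>Basis\<close> play the role of multi-indices.
\<close>

definition schwartz :: "('a::euclidean_space \<Rightarrow> complex) set" where
  "schwartz = {f. \<forall>bs. set bs \<subseteq> Basis \<longrightarrow>
      (\<forall>x. iter_deriv bs f differentiable (at x)) \<and>
      (\<forall>k::nat. bdd_above (range (\<lambda>x. norm x ^ k * cmod (iter_deriv bs f x))))}"

definition schwartz_seminorm :: "nat \<Rightarrow> 'a::euclidean_space list \<Rightarrow> ('a \<Rightarrow> complex) \<Rightarrow> real" where
  "schwartz_seminorm k bs f = (SUP x. norm x ^ k * cmod (iter_deriv bs f x))"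


section \<open>Tempered generalized functions\<close>

text \<open>
  Generalized functions are functionals \<open>u\<close> on Schwartz functions; the value \<open>u \<phi>\<close> is the
  pairing \<open>\<integral> u \<phi> d\<mu>\<close>, with the normalized measure.  Values outside \<^const>\<open>schwartz\<close>
  carry no meaning, so equality of generalized functions is \<open>dist_eq\<close>.
\<close>

type_synonym 'a gen_fun = "('a \<Rightarrow> complex) \<Rightarrow> complex"

definition tempered_dist :: "'a::euclidean_space gen_fun \<Rightarrow> bool" where
  "tempered_dist u \<longleftrightarrow>
     (\<forall>f\<in>schwartz. \<forall>g\<in>schwartz. u (\<lambda>x. f x + g x) = u f + u g) \<and>
     (\<forall>f\<in>schwartz. \<forall>z. u (\<lambda>x. z * f x) = z * u f) \<and>
     (\<exists>C N. \<forall>f\<in>schwartz. cmod (u f) \<le>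
        C * (\<Sum>k\<le>N. \<Sum>bs | set bs \<subseteq> Basis \<and> length bs \<le> N. schwartz_seminorm k bs f))"

definition dist_eq :: "'a::euclidean_space gen_fun \<Rightarrow> 'a gen_fun \<Rightarrow> bool" where
  "dist_eq u v \<longleftrightarrow> (\<forall>f\<in>schwartz. u f = v f)"

definition conj_dist :: "'a gen_fun \<Rightarrow> 'a gen_fun" where
  "conj_dist u f = cnj (u (\<lambda>x. cnj (f x)))"

definition fun_dist :: "('a::euclidean_space \<Rightarrow> complex) \<Rightarrow> 'a gen_fun" where
  "fun_dist g f = (LINT x|mu. g x * f x)"

definition locally_integrable :: "('a::euclidean_space \<Rightarrow> complex) \<Rightarrow> bool" where
  "locally_integrable g \<longleftrightarrow> (\<forall>K. compact K \<longrightarrow> set_integrable lebesgue K g)"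

text \<open>An ordinary function that is a tempered generalized function.\<close>

definition tempered_function :: "('a::euclidean_space \<Rightarrow> complex) \<Rightarrow> bool" where
  "tempered_function g \<longleftrightarrow> locally_integrable g \<and>
     (\<forall>f\<in>schwartz. integrable mu (\<lambda>x. g x * f x)) \<and> tempered_dist (fun_dist g)"


section \<open>Fourier transform on the complex plane\<close>

definition fourier :: "(complex \<Rightarrow> complex) \<Rightarrow> complex \<Rightarrow> complex" where
  "fourier f c = (LINT t|mu. f t * exp (\<i> * complex_of_real (Re (c * t))))"

text \<open>
  The transform of a generalized function \<open>u\<close>, i.e. \<open>\<integral> u(t) exp(i Re(ct)) d\<mu>(t)\<close>.  In
  particular \<open>fourier_dist (fun_dist M)\<close> is the kernel \<open>V(t) = \<integral> M(c) exp(i Re(ct)) d\<mu>(c)\<close>.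
\<close>

definition fourier_dist :: "complex gen_fun \<Rightarrow> complex gen_fun" where
  "fourier_dist u f = u (fourier f)"


section \<open>Generalized Fourier transforms\<close>

text \<open>
  \<open>F f y\<close> stands for \<open>\<integral> f(x) e(x,y) dx\<close>, and \<open>B \<phi> x z\<close> for the assertion that
  the integral of \<open>\<phi>(y)\<close> times the conjugate of \<open>e(x,y)\<close> over \<open>y\<close> exists in the appropriate
  generalized sense and equals \<open>z\<close>.  Both spaces carry the measure \<^const>\<open>mu\<close>.
\<close>

definition generalized_fourier_transform ::
  "(('x::euclidean_space \<Rightarrow> complex) \<Rightarrow> ('y::euclidean_space \<Rightarrow> complex)) \<Rightarrow>
   (('y \<Rightarrow> complex) \<Rightarrow> 'x \<Rightarrow> complex \<Rightarrow> bool) \<Rightarrow> bool" where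
  "generalized_fourier_transform F B \<longleftrightarrow>
     (\<forall>f\<in>schwartz. \<forall>x. B (F f) x (f x)) \<and>
     (\<forall>f\<in>schwartz. \<forall>g\<in>schwartz.
        integrable mu (\<lambda>x. f x * cnj (g x)) \<and>
        integrable mu (\<lambda>y. F f y * cnj (F g y)) \<and>
        (LINT x|mu. f x * cnj (g x)) = (LINT y|mu. F f y * cnj (F g y)))"


section \<open>The generalized Radon transform\<close>

definition bilin :: "complex ^ 'm::finite \<Rightarrow> complex ^ 'm \<Rightarrow> complex" where
  "bilin a x = (\<Sum>i\<in>UNIV. a $ i * x $ i)"

text \<open>
  The pairing over \<open>p\<close> with the translate \<open>u(p - a\<^sub>n)\<close> is the pairing of \<open>u\<close> with the function
  translated by \<open>a\<^sub>n\<close> in the opposite direction.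
\<close>

definition radon ::
  "complex gen_fun \<Rightarrow> ((complex ^ 'm::finite) \<times> complex \<Rightarrow> complex) \<Rightarrow>
   (complex ^ 'm) \<times> complex \<Rightarrow> complex" where
  "radon u f = (\<lambda>(a', a\<^sub>n). u (\<lambda>p. LINT x'|mu. f (x', bilin a' x' + (p + a\<^sub>n))))"

text \<open>
  \<open>\<Phi>(a',c)\<close> is the Fourier transform of \<open>\<phi>(a',a\<^sub>n)\<close> in \<open>a\<^sub>n\<close>.  For each \<open>a'\<close> it is determined
  only up to a null set of \<open>c\<close>; joint measurability makes integrals over \<open>a'\<close> at fixed \<open>c\<close>
  independent of the choice, for almost every \<open>c\<close>.
\<close>

definition partial_fourier ::
  "((complex ^ 'm::finite) \<times> complex \<Rightarrow> complex) \<Rightarrow>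
   ((complex ^ 'm) \<times> complex \<Rightarrow> complex) \<Rightarrow> bool" where
  "partial_fourier \<phi> \<Phi> \<longleftrightarrow> \<Phi> \<in> borel_measurable lebesgue \<and>
     (\<forall>a'. tempered_function (\<lambda>t. \<phi> (a', t)) \<and> tempered_function (\<lambda>c. \<Phi> (a', c)) \<and>
        dist_eq (fourier_dist (fun_dist (\<lambda>t. \<phi> (a', t)))) (fun_dist (\<lambda>c. \<Phi> (a', c))))"

text \<open>
  The integral of \<open>\<phi>(a) V(x\<^sub>n - a'x' - a\<^sub>n)\<close> over \<open>a\<close> exists and has the value \<open>z\<close>.
  The functions \<open>M\<close> and \<open>\<Phi>\<close> are unique up to null sets, so \<open>z\<close> is unique.
\<close>

definition has_kernel_integral ::
  "complex gen_fun \<Rightarrow> ((complex ^ 'm::finite) \<times> complex \<Rightarrow> complex) \<Rightarrow>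
   (complex ^ 'm) \<times> complex \<Rightarrow> complex \<Rightarrow> bool" where
  "has_kernel_integral V \<phi> = (\<lambda>(x', x\<^sub>n) z. \<exists>M \<Phi>.
     tempered_function M \<and> dist_eq V (fourier_dist (fun_dist M)) \<and> partial_fourier \<phi> \<Phi> \<and>
     integrable mu (\<lambda>(a', c).
       \<Phi> (a', - c) * M c * exp (\<i> * complex_of_real (Re (c * (x\<^sub>n - bilin a' x'))))) \<and>
     z = (LINT c|mu. LINT a'|mu.
       \<Phi> (a', - c) * M c * exp (\<i> * complex_of_real (Re (c * (x\<^sub>n - bilin a' x'))))))"

end

theory Submission
  imports Defs "HOL-Probability.Probability"
begin

text \<open>
  Taking the Fourier transform in the last variable turns the Radon transform into the
  multiplication of \<open>F f (c a', - c)\<close> by the multiplier \<open>u_hat c\<close> (projection slice theorem).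
  The substitution \<open>\<xi> = c a'\<close> in \<open>\<complex>\<^sup>n\<^sup>-\<^sup>1\<close> has real Jacobian \<open>\<bar>c\<bar>\<close> to the power \<open>2 (n - 1)\<close>, which
  is exactly \<open>\<bar>u_hat c\<bar>\<^sup>2\<close>; this reduces both formulas to Fourier inversion and to the Plancherel
  formula.  For fixed \<open>a'\<close> the function \<open>u_hat c * F f (c a', - c)\<close> is merely measurable and rapidly
  decreasing, since \<open>u_hat\<close> has arbitrary phase, so that the Plancherel formula is needed beyond
  Schwartz functions.
\<close>

section \<open>Normalized Lebesgue measure\<close>

text \<open>Two obstacles shape the development. The product of two completed Lebesgue measures is
  not the completed product, so every Fubini argument runs over the Borel measure
  \<open>nborel\<close>, and \<open>u_hat\<close> is replaced by a Borel function whose modulus is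
  \<open>cmod c ^ (n - 1)\<close> everywhere. Moreover, what is known about \<open>u\<close>
  concerns \<open>fourier_dist u\<close>; \<open>u\<close> is therefore evaluated on functions
  exhibited as transforms of Schwartz functions, and the integrals of \<open>f\<close> over complex
  hyperplanes are brought into that form. The constant in the measure makes the Gaussian its own
  transform, so that inversion and Plancherel carry no factors. Both come from inserting a Gaussian
  of width \<open>1 / e\<close>, using Fubini, and letting \<open>e\<close> tend to 0. The unknown
  phase cancels because the multiplier always meets its conjugate: through the kernel in the
  inversion formula, through the second factor in Plancherel. The substitution is made at fixed
  nonzero \<open>c\<close>, where it is a similarity; its Jacobian then follows from translation
  invariance and the volume of balls.\<close>

abbreviation norm_const :: "'a::euclidean_space itself \<Rightarrow> real" where
  "norm_const _ \<equiv> (2 * pi) powr (- (real DIM('a) / 2))"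

text \<open>The Borel counterpart of \<open>mu\<close>, on which product measures behave well.
  Results return to \<open>mu\<close> through \<open>integral_mu\<close> and
  \<open>integrable_mu_iff\<close>, since completion does not change integrals of Borel
  functions.\<close>

definition nborel :: "'a::euclidean_space measure" where
  "nborel = density lborel (\<lambda>_. ennreal (norm_const TYPE('a)))"

lemma sets_nborel [simp, measurable_cong]: "sets nborel = sets borel"
  and space_nborel [simp]: "space nborel = UNIV"
  by (simp_all add: nborel_def)

lemma measurable_nborel1 [simp]: "measurable M nborel = measurable M borel"
  and measurable_nborel2 [simp]: "measurable nborel M = measurable borel M"
  by (simp_all cong: measurable_cong_sets)

lemma nn_integral_nborel:
  fixes f :: "'a::euclidean_space \<Rightarrow> ennreal"
  assumes [measurable]: "f \<in> borel_measurable borel"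
  shows "(\<integral>\<^sup>+x. f x \<partial>nborel) = ennreal (norm_const TYPE('a)) * (\<integral>\<^sup>+x. f x \<partial>lborel)"
  unfolding nborel_def by (simp add: nn_integral_density nn_integral_cmult)

lemma integral_nborel:
  fixes f :: "'a::euclidean_space \<Rightarrow> 'b::{banach,second_countable_topology}"
  assumes [measurable]: "f \<in> borel_measurable borel"
  shows "(LINT x|nborel. f x) = norm_const TYPE('a) *\<^sub>R (LINT x|lborel. f x)"
  unfolding nborel_def by (simp add: integral_density)

lemma integrable_nborel_iff:
  fixes f :: "'a::euclidean_space \<Rightarrow> 'b::{banach,second_countable_topology}"
  assumes [measurable]: "f \<in> borel_measurable borel"
  shows "integrable nborel f \<longleftrightarrow> integrable lborel f"
proof -
  have "integrable lborel f" if "integrable lborel (\<lambda>x. norm_const TYPE('a) *\<^sub>R f x)"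
    using integrable_scaleR_right[OF that, of "inverse (norm_const TYPE('a))"] by simp
  then show ?thesis
    unfolding nborel_def by (subst integrable_density) auto
qed

lemma AE_nborel_iff: "(AE x in nborel. P x) \<longleftrightarrow> (AE x in lborel. P x)"
  unfolding nborel_def by (subst AE_density) auto

lemma AE_mu_iff: "(AE x in mu. P x) \<longleftrightarrow> (AE x in lebesgue. P x)"
  unfolding mu_def by (subst AE_density) auto

lemma sets_mu [simp, measurable_cong]: "sets mu = sets lebesgue"
  and space_mu [simp]: "space mu = UNIV"
  by (simp_all add: mu_def)

lemma measurable_mu1 [simp]: "measurable M mu = measurable M lebesgue"
  and measurable_mu2 [simp]: "measurable mu M = measurable lebesgue M"
  by (simp_all cong: measurable_cong_sets)

lemma integral_mu:
  fixes f :: "'a::euclidean_space \<Rightarrow> 'b::{banach,second_countable_topology}"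
  assumes f [measurable]: "f \<in> borel_measurable borel"
  shows "(LINT x|mu. f x) = (LINT x|nborel. f x)"
proof -
  have [measurable]: "f \<in> borel_measurable lebesgue"
    by (rule measurable_completion) simp
  show ?thesis
    unfolding mu_def nborel_def
    by (simp add: integral_density integral_completion)
qed

lemma integrable_mu_iff:
  fixes f :: "'a::euclidean_space \<Rightarrow> 'b::{banach,second_countable_topology}"
  assumes f [measurable]: "f \<in> borel_measurable borel"
  shows "integrable mu f \<longleftrightarrow> integrable nborel f"
proof -
  have [measurable]: "f \<in> borel_measurable lebesgue"
    by (rule measurable_completion) simp
  show ?thesis
    unfolding mu_def nborel_def
    by (simp add: integrable_density integrable_completion)
qed

lemma sigma_finite_nborel: "sigma_finite_measure (nborel :: 'a::euclidean_space measure)"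
  unfolding nborel_def
  by (subst sigma_finite_measure.sigma_finite_iff_density_finite'[OF sigma_finite_lborel]) auto

interpretation nborel: sigma_finite_measure nborel
  by (rule sigma_finite_nborel)

interpretation nborel_pair: pair_sigma_finite nborel nborel ..

text \<open>The normalizing exponents add under products, so Fubini holds between the normalized
  measures without any correction factor.\<close>

lemma nborel_prod:
  "nborel \<Otimes>\<^sub>M nborel = (nborel :: ('a::euclidean_space \<times> 'b::euclidean_space) measure)"
proof -
  have "nborel \<Otimes>\<^sub>M nborel = density (lborel \<Otimes>\<^sub>M lborel)
      (\<lambda>(x::'a, y::'b). ennreal (norm_const TYPE('a)) * ennreal (norm_const TYPE('b)))"
    unfolding nborel_def
    by (rule pair_measure_density)
      (auto intro: sigma_finite_nborel sigma_finite_lborel simp: nborel_def[symmetric])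
  also have "\<dots> = nborel"
    unfolding nborel_def lborel_prod
    by (simp add: case_prod_beta' ennreal_mult'[symmetric] powr_add[symmetric] add_divide_distrib)
  finally show ?thesis .
qed

text \<open>
  Uniqueness of translation invariant measures, in the form needed here: integrating
  \<open>q (T x) * indicator B y\<close> over all pairs and shifting \<open>y\<close> by \<open>T x\<close> exchanges the roles of the
  Lebesgue measure and of its image under \<open>T\<close>, and both give known values to the balls \<open>B\<close>.
\<close>

lemma nn_integral_conformal:
  fixes T :: "'a::euclidean_space \<Rightarrow> 'a"
  assumes T: "linear T" and nT: "\<And>x. norm (T x) = r * norm x" and r: "r > 0"
    and q [measurable]: "q \<in> borel_measurable borel"
  shows "ennreal (r ^ DIM('a)) * (\<integral>\<^sup>+x. q (T x) \<partial>lborel) = (\<integral>\<^sup>+x. q x \<partial>lborel)"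
proof -
  have [measurable]: "T \<in> borel_measurable borel"
    using T by (simp add: borel_measurable_continuous_onI linear_continuous_on linear_conv_bounded_linear)
  have inj: "inj T"
    unfolding linear_injective_0[OF T] using nT r by (metis mult_eq_0_iff norm_eq_zero less_irrefl)
  obtain S where S: "linear S" "\<And>x. S (T x) = x" "\<And>x. T (S x) = x"
    using linear_injective_isomorphism[OF T inj] by blast
  have nS: "norm (S x) = norm x / r" for x
    using nT[of "S x"] S r by (simp add: field_simps)
  have [measurable]: "S \<in> borel_measurable borel"
    using S(1) by (simp add: borel_measurable_continuous_onI linear_continuous_on linear_conv_bounded_linear)
  let ?B = "ball (0::'a) 1"
  have [measurable]: "ball (0::'a) \<rho> \<in> sets borel" for \<rho>
    by simp
  have trans: "(\<integral>\<^sup>+y. g (y + a) \<partial>lborel) = (\<integral>\<^sup>+y. g y \<partial>lborel)"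
    if [measurable]: "g \<in> borel_measurable borel" for g :: "'a \<Rightarrow> ennreal" and a
    by (subst (2) lborel_distr_plus[symmetric, of a]) (simp add: nn_integral_distr add.commute)
  have "(\<integral>\<^sup>+x. q (T x) \<partial>lborel) * emeasure lborel ?B
      = (\<integral>\<^sup>+x. q (T x) * emeasure lborel ?B \<partial>lborel)"
    by (simp add: nn_integral_multc)
  also have "\<dots> = (\<integral>\<^sup>+x. q (T x) * (\<integral>\<^sup>+y. indicator ?B (y + - T x) \<partial>lborel) \<partial>lborel)"
    by (subst trans) (auto intro!: borel_measurable_indicator)
  also have "\<dots> = (\<integral>\<^sup>+x. (\<integral>\<^sup>+y. q (T x) * indicator ?B (y - T x) \<partial>lborel) \<partial>lborel)"
    by (simp add: nn_integral_cmult)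
  also have "\<dots> = (\<integral>\<^sup>+y. (\<integral>\<^sup>+x. q (T x) * indicator ?B (y - T x) \<partial>lborel) \<partial>lborel)"
    by (rule lborel_pair.Fubini') simp
  \<comment> \<open>Shifting \<open>x\<close> by \<open>S y\<close> turns \<open>T x\<close> into
    \<open>T x + y\<close> and \<open>y - T x\<close> into \<open>- T x\<close>, which lies in the
    unit ball exactly when \<open>norm x < 1 / r\<close>.\<close>
  also have "\<dots> = (\<integral>\<^sup>+y. (\<integral>\<^sup>+x. q (T (x + S y)) * indicator ?B (y - T (x + S y)) \<partial>lborel) \<partial>lborel)"
    by (subst trans[of "\<lambda>x. q (T x) * indicator ?B (y - T x)" for y]) simp_all
  also have "\<dots> = (\<integral>\<^sup>+y. (\<integral>\<^sup>+x. q (y + T x) * indicator (ball 0 (1/r)) x \<partial>lborel) \<partial>lborel)"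
    using S(3) r by (intro nn_integral_cong)
      (auto simp: linear_add[OF T] indicator_def nT field_simps add.commute)
  also have "\<dots> = (\<integral>\<^sup>+x. (\<integral>\<^sup>+y. q (y + T x) * indicator (ball 0 (1/r)) x \<partial>lborel) \<partial>lborel)"
    by (rule lborel_pair.Fubini') simp
  also have "\<dots> = (\<integral>\<^sup>+x. q x \<partial>lborel) * emeasure lborel (ball (0::'a) (1/r))"
    by (simp add: nn_integral_multc trans nn_integral_cmult)
  also have "emeasure lborel (ball (0::'a) (1/r)) = ennreal (1 / r ^ DIM('a)) * emeasure lborel ?B"
    using r by (simp add: emeasure_ball divide_simps ennreal_mult'[symmetric])
  finally have "(\<integral>\<^sup>+x. q (T x) \<partial>lborel) * emeasure lborel ?B
      = ((\<integral>\<^sup>+x. q x \<partial>lborel) * ennreal (1 / r ^ DIM('a))) * emeasure lborel ?B"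
    by (simp add: mult.assoc)
  moreover have "emeasure lborel ?B \<noteq> 0" "emeasure lborel ?B \<noteq> \<infinity>"
    by (simp_all add: emeasure_ball unit_ball_vol_pos less_imp_neq[symmetric])
  ultimately have eq: "(\<integral>\<^sup>+x. q (T x) \<partial>lborel) = (\<integral>\<^sup>+x. q x \<partial>lborel) * ennreal (1 / r ^ DIM('a))"
    using ennreal_mult_cancel_left[of "emeasure lborel ?B"] by (simp add: mult.commute)
  show ?thesis
    using r by (simp add: eq mult.left_commute ennreal_mult'[symmetric])
qed

text \<open>Phrased as an equality of measures, so that vector-valued integrals and integrability
  transfer at once through \<open>density\<close> and \<open>distr\<close>.\<close>

lemma nborel_affine_conformal:
  fixes T :: "'a::euclidean_space \<Rightarrow> 'a"
  assumes T: "linear T" and nT: "\<And>x. norm (T x) = r * norm x" and r: "r > 0"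
  shows "nborel = density (distr nborel borel (\<lambda>x. a + T x)) (\<lambda>_. ennreal (r ^ DIM('a)))"
proof (rule measure_eqI)
  fix A :: "'a set" assume "A \<in> sets nborel"
  then have [measurable]: "A \<in> sets borel" by simp
  have [measurable]: "T \<in> borel_measurable borel"
    using T by (simp add: borel_measurable_continuous_onI linear_continuous_on linear_conv_bounded_linear)
  let ?k = "ennreal (norm_const TYPE('a))"
  have "emeasure (density (distr nborel borel (\<lambda>x. a + T x)) (\<lambda>_. ennreal (r ^ DIM('a)))) A
      = ennreal (r ^ DIM('a)) * (?k * (\<integral>\<^sup>+x. indicator A (a + T x) \<partial>lborel))"
    by (simp add: emeasure_density nn_integral_distr nn_integral_cmult nn_integral_nborel del: nn_integral_indicator)
  also have "\<dots> = ?k * (\<integral>\<^sup>+x. indicator A (a + x) \<partial>lborel)"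
    using nn_integral_conformal[OF T nT r, of "\<lambda>x. indicator A (a + x)"]
    by (simp add: mult.left_commute[of "ennreal (r ^ DIM('a))"])
  also have "(\<integral>\<^sup>+x. indicator A (a + x) \<partial>lborel) = (\<integral>\<^sup>+x. indicator A x \<partial>distr lborel borel ((+) a))"
    by (simp add: nn_integral_distr del: nn_integral_indicator)
  also have "?k * \<dots> = (\<integral>\<^sup>+x. indicator A x \<partial>nborel)"
    by (simp only: lborel_distr_plus nn_integral_nborel[OF borel_measurable_indicator[OF \<open>A \<in> sets borel\<close>]])
  finally show "emeasure nborel A
      = emeasure (density (distr nborel borel (\<lambda>x. a + T x)) (\<lambda>_. ennreal (r ^ DIM('a)))) A"
    by simp
qed simp

lemma
  fixes T :: "'a::euclidean_space \<Rightarrow> 'a" and f :: "'a \<Rightarrow> 'b::{banach,second_countable_topology}"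
  assumes T: "linear T" and nT: "\<And>x. norm (T x) = r * norm x" and r: "r > 0"
    and f [measurable]: "f \<in> borel_measurable borel"
  shows integral_affine_conformal: "(LINT x|nborel. f (a + T x)) = (LINT x|nborel. f x) /\<^sub>R r ^ DIM('a)"
    and integrable_affine_conformal: "integrable nborel (\<lambda>x. f (a + T x)) \<longleftrightarrow> integrable nborel f"
proof -
  have [measurable]: "T \<in> borel_measurable borel"
    using T by (simp add: borel_measurable_continuous_onI linear_continuous_on linear_conv_bounded_linear)
  have "(LINT x|nborel. f x) = r ^ DIM('a) *\<^sub>R (LINT x|nborel. f (a + T x))"
    using r by (subst nborel_affine_conformal[OF T nT r, where a=a])
      (simp add: integral_density integral_distr)
  then show "(LINT x|nborel. f (a + T x)) = (LINT x|nborel. f x) /\<^sub>R r ^ DIM('a)"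
    using r by simp
  have *: "integrable nborel (\<lambda>x. r ^ DIM('a) *\<^sub>R f (a + T x)) \<longleftrightarrow> integrable nborel (\<lambda>x. f (a + T x))"
    using integrable_scaleR_right[of "inverse (r ^ DIM('a))" nborel "\<lambda>x. r ^ DIM('a) *\<^sub>R f (a + T x)"] r
    by auto
  show "integrable nborel (\<lambda>x. f (a + T x)) \<longleftrightarrow> integrable nborel f"
    using r by (subst (2) nborel_affine_conformal[OF T nT r, where a=a])
      (simp add: integrable_density integrable_distr_eq *)
qed

lemma
  fixes f :: "'a::euclidean_space \<Rightarrow> 'b::{banach,second_countable_topology}"
  assumes "f \<in> borel_measurable borel"
  shows integral_translate: "(LINT x|nborel. f (a + x)) = (LINT x|nborel. f x)"
    and integrable_translate: "integrable nborel (\<lambda>x. f (a + x)) \<longleftrightarrow> integrable nborel f"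
  using integral_affine_conformal[of id 1 f a] integrable_affine_conformal[of id 1 f a] assms
  by (simp_all add: linear_id)

section \<open>Gaussian regularization\<close>

text \<open>\<open>lborel\<close> is the image of a finite product of real Lebesgue measures under
  the coordinate map, so products of one-variable functions factor. This serves both the integrable
  majorant \<open>weight\<close> and the Gaussian.\<close>

lemma
  fixes g :: "'a::euclidean_space \<Rightarrow> real \<Rightarrow> 'b::{real_normed_field,banach,second_countable_topology}"
  assumes g: "\<And>b. b \<in> Basis \<Longrightarrow> integrable lborel (g b)"
  shows integrable_lborel_prod_Basis: "integrable lborel (\<lambda>x::'a. \<Prod>b\<in>Basis. g b (x \<bullet> b))"
    and integral_lborel_prod_Basis:
      "(LINT x|(lborel::'a measure). (\<Prod>b\<in>Basis. g b (x \<bullet> b))) = (\<Prod>b\<in>Basis. LINT t|lborel. g b t)"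
proof -
  interpret product_sigma_finite "\<lambda>b::'a. lborel :: real measure" ..
  have [measurable]: "b \<in> Basis \<Longrightarrow> g b \<in> borel_measurable borel" for b
    using borel_measurable_integrable[OF g, of b] by simp
  have inner: "(\<Prod>b\<in>Basis. g b ((\<Sum>b'\<in>Basis. f b' *\<^sub>R b') \<bullet> b)) = (\<Prod>b\<in>Basis. g b (f b))"
    for f :: "'a \<Rightarrow> real"
    by (intro prod.cong) (simp_all add: inner_sum_left_Basis)
  show "integrable lborel (\<lambda>x::'a. \<Prod>b\<in>Basis. g b (x \<bullet> b))"
    by (subst lborel_eq, subst integrable_distr_eq)
      (auto simp: inner intro!: product_integrable_prod g)
  show "(LINT x|(lborel::'a measure). (\<Prod>b\<in>Basis. g b (x \<bullet> b))) = (\<Prod>b\<in>Basis. LINT t|lborel. g b t)"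
    by (subst lborel_eq, subst integral_distr)
      (auto simp: inner intro!: product_integral_prod g)
qed

text \<open>The common majorant for dominated convergence. With exponent \<open>DIM('a)\<close>
  there is one factor per coordinate, and each is at most
  \<open>1 / (1 + (x \<bullet> b)\<^sup>2)\<close> because a coordinate never exceeds the norm;
  integrability reduces to the real line.\<close>

definition weight :: "'a::euclidean_space \<Rightarrow> real" where
  "weight x = 1 / (1 + (norm x)\<^sup>2) ^ DIM('a)"

lemma weight_pos [simp]: "weight x > 0"
  by (simp add: weight_def add_pos_nonneg)

lemma weight_nonneg [simp]: "weight x \<ge> 0"
  using weight_pos[of x] by linarith

lemma continuous_on_weight [continuous_intros]: "continuous_on S weight"
  unfolding weight_def by (intro continuous_intros) (auto simp: add_nonneg_eq_0_iff)

lemma borel_measurable_weight [measurable]: "weight \<in> borel_measurable borel"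
  by (intro borel_measurable_continuous_onI continuous_on_weight)

lemma integrable_weight: "integrable nborel (weight :: 'a::euclidean_space \<Rightarrow> real)"
proof -
  have "integrable lborel (\<lambda>x::real. inverse (1 + x\<^sup>2))"
    using integrable_inverse_1_plus_square by (simp add: set_integrable_def)
  then have "integrable lborel (\<lambda>x::'a. \<Prod>b\<in>Basis. inverse (1 + (x \<bullet> b)\<^sup>2))"
    by (intro integrable_lborel_prod_Basis) simp
  moreover have "weight x \<le> (\<Prod>b\<in>Basis. inverse (1 + (x \<bullet> b)\<^sup>2))" for x :: 'a
  proof -
    have "weight x = (\<Prod>b\<in>(Basis::'a set). inverse (1 + (norm x)\<^sup>2))"
      by (simp add: weight_def divide_inverse power_inverse)
    also have "\<dots> \<le> (\<Prod>b\<in>Basis. inverse (1 + (x \<bullet> b)\<^sup>2))"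
      using Basis_le_norm[of _ x]
      by (intro prod_mono) (auto intro!: le_imp_inverse_le add_pos_nonneg simp: abs_le_square_iff[symmetric])
    finally show ?thesis .
  qed
  ultimately have "integrable lborel (weight :: 'a \<Rightarrow> real)"
    by (elim Bochner_Integration.integrable_bound) (auto simp: abs_le_iff prod_nonneg intro!: order_trans[OF _ abs_ge_self])
  then show ?thesis
    by (simp add: integrable_nborel_iff)
qed

definition gauss :: "'a::euclidean_space \<Rightarrow> real" where
  "gauss x = exp (- (norm x)\<^sup>2 / 2)"

lemma continuous_on_gauss [continuous_intros]: "continuous_on S f \<Longrightarrow> continuous_on S (\<lambda>x. gauss (f x))"
  unfolding gauss_def by (intro continuous_intros) auto

lemma borel_measurable_gauss [measurable]: "gauss \<in> borel_measurable borel"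
  by (intro borel_measurable_continuous_onI continuous_intros)

lemma gauss_pos [simp]: "gauss x > 0"
  and gauss_le_1 [simp]: "gauss x \<le> 1"
  and gauss_0 [simp]: "gauss 0 = 1"
  by (simp_all add: gauss_def)

lemma gauss_nonneg [simp]: "gauss x \<ge> 0"
  using gauss_pos[of x] by linarith

text \<open>Up to the factor \<open>sqrt (2 * pi)\<close> this is the characteristic function of the
  standard normal distribution.\<close>

lemma
  shows integrable_gauss_iexp_real: "integrable lborel (\<lambda>x::real. of_real (gauss x) * iexp (x * t))"
    and integral_gauss_iexp_real:
      "(LINT x|lborel. of_real (gauss x) * iexp (x * t)) = of_real (sqrt (2 * pi) * exp (- t\<^sup>2 / 2))"
proof -
  have gd: "gauss x = sqrt (2 * pi) * std_normal_density x" for x :: real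
    by (simp add: gauss_def std_normal_density_def)
  have "integrable lborel std_normal_density"
    using integrable_std_normal_moment[of 0] by simp
  then have i: "integrable lborel (\<lambda>x. std_normal_density x *\<^sub>R iexp (t * x))"
    by (rule Bochner_Integration.integrable_bound) auto
  then have "integrable lborel (\<lambda>x. sqrt (2 * pi) *\<^sub>R (std_normal_density x *\<^sub>R iexp (t * x)))"
    by (rule integrable_scaleR_right)
  then show "integrable lborel (\<lambda>x::real. of_real (gauss x) * iexp (x * t))"
    by (simp add: gd scaleR_conv_of_real mult_ac)
  have "of_real (exp (- t\<^sup>2 / 2)) = (LINT x|lborel. std_normal_density x *\<^sub>R iexp (t * x))"
    using fun_cong[OF char_std_normal_distribution, of t]
    by (simp add: char_def integral_density)
  moreover have "(LINT x|lborel. of_real (gauss x) * iexp (x * t))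
      = sqrt (2 * pi) *\<^sub>R (LINT x|lborel. std_normal_density x *\<^sub>R iexp (t * x))"
    unfolding integral_scaleR_right[symmetric]
    by (intro Bochner_Integration.integral_cong) (simp_all add: gd scaleR_conv_of_real mult.commute mult.assoc)
  ultimately show "(LINT x|lborel. of_real (gauss x) * iexp (x * t)) = of_real (sqrt (2 * pi) * exp (- t\<^sup>2 / 2))"
    by (simp add: scaleR_conv_of_real)
qed

text \<open>Self-duality of the Gaussian: each coordinate contributes \<open>sqrt (2 * pi)\<close>,
  and the normalizing constant of \<open>nborel\<close> cancels the product of these factors
  exactly.\<close>

lemma
  fixes y :: "'a::euclidean_space"
  shows integrable_gauss_iexp: "integrable nborel (\<lambda>x. of_real (gauss x) * iexp (x \<bullet> y))"
    and integral_gauss_iexp: "(LINT x|nborel. of_real (gauss x) * iexp (x \<bullet> y)) = of_real (gauss y)"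
proof -
  have split_gauss: "gauss x = (\<Prod>b\<in>Basis. gauss (x \<bullet> b))" for x :: 'a
    unfolding gauss_def
    by (subst exp_sum[symmetric])
      (simp_all add: norm_eq_sqrt_inner euclidean_inner[of x x] power2_eq_square sum_divide_distrib
        sum_nonneg inner_commute flip: sum_negf)
  have split: "of_real (gauss x) * iexp (x \<bullet> y)
      = (\<Prod>b\<in>Basis. of_real (gauss (x \<bullet> b)) * iexp ((x \<bullet> b) * (y \<bullet> b)))" for x :: 'a
    by (subst split_gauss, subst euclidean_inner[of x y])
      (simp add: prod.distrib exp_sum sum_distrib_left)
  have [measurable]: "(\<lambda>x::'a. of_real (gauss x) * iexp (x \<bullet> y)) \<in> borel_measurable borel"
    by measurable
  have "integrable lborel (\<lambda>x. of_real (gauss x) * iexp (x \<bullet> y))"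
    unfolding split
    by (rule integrable_lborel_prod_Basis[of "\<lambda>b t. of_real (gauss t) * iexp (t * (y \<bullet> b))"])
      (rule integrable_gauss_iexp_real)
  then show "integrable nborel (\<lambda>x. of_real (gauss x) * iexp (x \<bullet> y))"
    by (simp add: integrable_nborel_iff)
  have "(LINT x|nborel. of_real (gauss x) * iexp (x \<bullet> y))
      = norm_const TYPE('a) *\<^sub>R (LINT x|(lborel::'a measure). of_real (gauss x) * iexp (x \<bullet> y))"
    by (simp add: integral_nborel)
  also have "(LINT x|(lborel::'a measure). of_real (gauss x) * iexp (x \<bullet> y))
      = (\<Prod>b\<in>Basis. of_real (sqrt (2 * pi) * exp (- (y \<bullet> b)\<^sup>2 / 2)))"
    unfolding split
    by (subst integral_lborel_prod_Basis[of "\<lambda>b t. of_real (gauss t) * iexp (t * (y \<bullet> b))"])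
      (simp_all only: integrable_gauss_iexp_real integral_gauss_iexp_real)
  also have "\<dots> = of_real (sqrt (2 * pi) ^ DIM('a) * gauss y)"
    by (subst split_gauss) (simp add: gauss_def prod.distrib of_real_prod)
  also have "sqrt (2 * pi) ^ DIM('a) = (2 * pi) powr (real DIM('a) / 2)"
    by (simp add: powr_half_sqrt[symmetric] powr_realpow[symmetric] powr_powr)
  finally show "(LINT x|nborel. of_real (gauss x) * iexp (x \<bullet> y)) = of_real (gauss y)"
    by (simp add: scaleR_conv_of_real powr_minus)
qed

lemma integrable_gauss: "integrable nborel (gauss :: 'a::euclidean_space \<Rightarrow> real)"
  and integral_gauss: "(LINT x|(nborel::'a measure). gauss x) = 1"
proof -
  show i: "integrable nborel (gauss :: 'a \<Rightarrow> real)"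
    using integrable_norm[OF integrable_gauss_iexp[of "0::'a"]] by simp
  show "(LINT x|(nborel::'a measure). gauss x) = 1"
    using integral_gauss_iexp[of "0::'a"] by simp
qed

text \<open>The transform of a flattened Gaussian is a concentrated one of total mass 1, that is, an
  approximate identity as \<open>e\<close> tends to 0.\<close>

lemma
  fixes z :: "'a::euclidean_space"
  assumes e: "e > 0"
  shows integrable_gauss_scaled: "integrable nborel (\<lambda>y::'a. gauss (e *\<^sub>R y))"
    and integral_gauss_iexp_scaled:
      "(LINT y|nborel. of_real (gauss (e *\<^sub>R y)) * iexp (z \<bullet> y)) = of_real (gauss (z /\<^sub>R e) / e ^ DIM('a))"
proof -
  have lin: "linear ((*\<^sub>R) e :: 'a \<Rightarrow> 'a)"
    by (simp add: linear_scaleR)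
  show "integrable nborel (\<lambda>y::'a. gauss (e *\<^sub>R y))"
    using integrable_affine_conformal[OF lin, of e gauss 0] e integrable_gauss by simp
  show "(LINT y|nborel. of_real (gauss (e *\<^sub>R y)) * iexp (z \<bullet> y)) = of_real (gauss (z /\<^sub>R e) / e ^ DIM('a))"
  proof -
    let ?q = "\<lambda>y. of_real (gauss y) * iexp (y \<bullet> (z /\<^sub>R e))"
    have "(LINT y|nborel. of_real (gauss (e *\<^sub>R y)) * iexp (z \<bullet> y)) = (LINT y|nborel. ?q (0 + e *\<^sub>R y))"
      using e by (simp add: inner_commute mult.assoc[symmetric])
    also have "\<dots> = (LINT y|nborel. ?q y) /\<^sub>R e ^ DIM('a)"
      using e by (intro integral_affine_conformal lin) auto
    finally show ?thesis
      by (simp only: integral_gauss_iexp) (simp add: scaleR_conv_of_real divide_inverse mult.commute)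
  qed
qed

text \<open>Built on the real inner product of an arbitrary Euclidean space, so that the plane and
  the full space are treated together. The complex pairing \<open>Re (c * t)\<close> is recovered by
  conjugating the frequency.\<close>

definition FT :: "('a::euclidean_space \<Rightarrow> complex) \<Rightarrow> 'a \<Rightarrow> complex" where
  "FT f y = (LINT x|nborel. f x * iexp (x \<bullet> y))"

lemma integrable_mult_bounded:
  fixes f :: "'a \<Rightarrow> complex"
  assumes "integrable M f" "g \<in> borel_measurable M" "\<And>x. cmod (g x) \<le> B"
  shows "integrable M (\<lambda>x. f x * g x)"
proof (rule Bochner_Integration.integrable_bound)
  show "integrable M (\<lambda>x. of_real B * f x)"
    using assms(1) by simp
  have B: "B \<ge> 0"
    using assms(3)[of undefined] norm_ge_zero order_trans by blast
  show "AE x in M. cmod (f x * g x) \<le> cmod (of_real B * f x)"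
    using assms(3) B by (intro AE_I2) (simp add: norm_mult mult_right_mono mult.commute[of "cmod (f _)"])
qed (use assms(1,2) in measurable)

lemma borel_measurable_FT [measurable]:
  assumes [measurable]: "f \<in> borel_measurable borel"
  shows "FT f \<in> borel_measurable borel"
  unfolding FT_def[abs_def] by measurable

lemma cmod_FT_le: "integrable nborel f \<Longrightarrow> cmod (FT f y) \<le> (LINT x|nborel. cmod (f x))"
  unfolding FT_def by (rule order_trans[OF integral_norm_bound]) (simp add: norm_mult)

text \<open>The Gaussian makes the double integral absolutely convergent even where
  \<open>FT f\<close> is not integrable. Fubini then produces a convolution of \<open>f\<close> with
  an approximate identity, and substituting \<open>x + e *\<^sub>R s\<close> moves the parameter
  \<open>e\<close> into the argument of \<open>f\<close>.\<close>

lemma FT_gauss_regularization: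
  fixes f :: "'a::euclidean_space \<Rightarrow> complex"
  assumes f: "integrable nborel f" and e: "e > 0"
  shows "(LINT y|nborel. FT f y * iexp (- (x \<bullet> y)) * of_real (gauss (e *\<^sub>R y)))
      = (LINT s|nborel. f (x + e *\<^sub>R s) * of_real (gauss s))"
proof -
  have [measurable]: "f \<in> borel_measurable borel"
    using f by auto
  let ?h = "\<lambda>z y. f z * iexp (z \<bullet> y) * iexp (- (x \<bullet> y)) * of_real (gauss (e *\<^sub>R y))"
  have int: "integrable (nborel \<Otimes>\<^sub>M nborel) (\<lambda>(z, y). ?h z y)"
  proof (rule nborel_pair.Fubini_integrable)
    have "integrable nborel (\<lambda>z. cmod (f z) * (LINT y|(nborel::'a measure). gauss (e *\<^sub>R y)))"
      using f by simp
    then show "integrable nborel (\<lambda>z. LINT y|nborel. norm (case (z, y) of (z, y) \<Rightarrow> ?h z y))"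
      by (simp add: norm_mult)
    show "AE z in nborel. integrable nborel (\<lambda>y. case (z, y) of (z, y) \<Rightarrow> ?h z y)"
    proof (rule AE_I2)
      fix z
      have "integrable nborel (\<lambda>y::'a. complex_of_real (gauss (e *\<^sub>R y)) * (f z * iexp (z \<bullet> y) * iexp (- (x \<bullet> y))))"
        using integrable_gauss_scaled[OF e]
        by (intro integrable_mult_bounded[where B="cmod (f z)"]) (auto simp: norm_mult)
      then show "integrable nborel (\<lambda>y. case (z, y) of (z, y) \<Rightarrow> ?h z y)"
        by (simp add: mult_ac)
    qed
  qed measurable
  have "(LINT y|nborel. FT f y * iexp (- (x \<bullet> y)) * of_real (gauss (e *\<^sub>R y)))
      = (LINT y|nborel. LINT z|nborel. ?h z y)"
    unfolding FT_def by (simp only: integral_mult_left_zero)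
  also have "\<dots> = (LINT z|nborel. LINT y|nborel. ?h z y)"
    by (rule nborel_pair.Fubini_integral[OF int])
  also have "\<dots> = (LINT z|nborel. f z * of_real (gauss ((z - x) /\<^sub>R e) / e ^ DIM('a)))"
  proof (rule Bochner_Integration.integral_cong[OF refl])
    fix z
    have "(LINT y|nborel. ?h z y) = (LINT y|nborel. f z * (of_real (gauss (e *\<^sub>R y)) * iexp ((z - x) \<bullet> y)))"
      by (intro Bochner_Integration.integral_cong refl)
        (simp add: inner_diff_left right_diff_distrib exp_diff exp_minus field_simps)
    then show "(LINT y|nborel. ?h z y) = f z * of_real (gauss ((z - x) /\<^sub>R e) / e ^ DIM('a))"
      by (simp only: integral_mult_right_zero integral_gauss_iexp_scaled[OF e])
  qed
  also have "\<dots> = (LINT s|nborel. f (x + e *\<^sub>R s) * of_real (gauss s))"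
    using integral_affine_conformal[of "(*\<^sub>R) e" e "\<lambda>z. f z * of_real (gauss ((z - x) /\<^sub>R e))" x] e
    by (simp add: linear_scaleR scaleR_conv_of_real divide_inverse mult.assoc[symmetric])
  finally show ?thesis .
qed

section \<open>Fourier inversion and the Plancherel formula\<close>

lemma borel_measurable_cnj [measurable]: "cnj \<in> borel_measurable borel"
  by (intro borel_measurable_continuous_onI continuous_intros)

lemma inverse_Suc_tendsto_0: "(\<lambda>n. 1 / real (Suc n)) \<longlonglongrightarrow> 0"
  using LIMSEQ_inverse_real_of_nat by (simp add: inverse_eq_divide)

lemma gauss_seq_tendsto: "(\<lambda>n. gauss ((1 / real (Suc n)) *\<^sub>R x)) \<longlonglongrightarrow> 1"
proof -
  have "(\<lambda>n. gauss ((1 / real (Suc n)) *\<^sub>R x)) \<longlonglongrightarrow> gauss (0 *\<^sub>R x)"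
    unfolding gauss_def
    by (intro tendsto_intros inverse_Suc_tendsto_0) auto
  then show ?thesis by simp
qed

text \<open>In the regularized identity \<open>e\<close> runs through \<open>1 / Suc n\<close>. The
  left side is dominated by \<open>cmod (FT f y)\<close>, the right side by
  \<open>B * gauss s\<close>; continuity of \<open>f\<close> makes the limit equal to
  \<open>f x\<close> at every point rather than almost everywhere.\<close>

theorem FT_inversion:
  fixes f :: "'a::euclidean_space \<Rightarrow> complex"
  assumes f: "integrable nborel f" and cont: "continuous_on UNIV f"
    and B: "\<And>x. cmod (f x) \<le> B" and Ff: "integrable nborel (FT f)"
  shows "(LINT y|nborel. FT f y * iexp (- (x \<bullet> y))) = f x"
proof -
  have [measurable]: "f \<in> borel_measurable borel" "FT f \<in> borel_measurable borel"
    using f Ff by auto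
  let ?e = "\<lambda>n. 1 / real (Suc n)"
  have L: "(\<lambda>n. LINT y|nborel. FT f y * iexp (- (x \<bullet> y)) * of_real (gauss (?e n *\<^sub>R y)))
      \<longlonglongrightarrow> (LINT y|nborel. FT f y * iexp (- (x \<bullet> y)) * of_real 1)"
  proof (rule integral_dominated_convergence[where w="\<lambda>y. cmod (FT f y)"])
    show "AE y in nborel. (\<lambda>n. FT f y * iexp (- (x \<bullet> y)) * of_real (gauss (?e n *\<^sub>R y)))
        \<longlonglongrightarrow> FT f y * iexp (- (x \<bullet> y)) * of_real 1"
      by (intro AE_I2 tendsto_intros gauss_seq_tendsto)
  qed (use Ff in \<open>auto simp: norm_mult mult_left_le\<close>)
  have R: "(\<lambda>n. LINT s|nborel. f (x + ?e n *\<^sub>R s) * of_real (gauss s))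
      \<longlonglongrightarrow> (LINT s|nborel. f (x + 0 *\<^sub>R s) * of_real (gauss s))"
  proof (rule integral_dominated_convergence[where w="\<lambda>s. B * gauss s"])
    show "AE s in nborel. (\<lambda>n. f (x + ?e n *\<^sub>R s) * of_real (gauss s)) \<longlonglongrightarrow> f (x + 0 *\<^sub>R s) * of_real (gauss s)"
      by (intro AE_I2 tendsto_intros continuous_on_tendsto_compose[OF cont]
          inverse_Suc_tendsto_0) auto
    show "AE s in nborel. norm (f (x + ?e n *\<^sub>R s) * of_real (gauss s)) \<le> B * gauss s" for n
      using B by (auto simp: norm_mult intro!: mult_right_mono)
  qed (use integrable_gauss in auto)
  have "(LINT y|nborel. FT f y * iexp (- (x \<bullet> y)) * of_real (gauss (?e n *\<^sub>R y)))
      = (LINT s|nborel. f (x + ?e n *\<^sub>R s) * of_real (gauss s))" for n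
    by (rule FT_gauss_regularization[OF f]) simp
  with L R have "(LINT y|nborel. FT f y * iexp (- (x \<bullet> y)) * of_real 1)
      = (LINT s|nborel. f (x + 0 *\<^sub>R s) * of_real (gauss s))"
    by (simp only: LIMSEQ_unique)
  then show ?thesis
    by (simp add: integral_gauss)
qed

lemma gauss_scale_antimono: "0 \<le> a \<Longrightarrow> a \<le> b \<Longrightarrow> gauss (b *\<^sub>R x) \<le> gauss (a *\<^sub>R x)"
  by (simp add: gauss_def power_mult_distrib mult_right_mono power_mono)

section \<open>Weighted bounds and continuity of translation in L1\<close>

lemma integrable_weight_bound:
  fixes k :: "'a::euclidean_space \<Rightarrow> complex"
  assumes "k \<in> borel_measurable borel" "\<And>x. cmod (k x) \<le> C * weight x"
  shows "integrable nborel k"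
  by (rule Bochner_Integration.integrable_bound[where f="\<lambda>x. C * weight x"])
    (use assms integrable_weight in \<open>auto intro: order_trans[OF _ abs_ge_self]\<close>)

lemma weight_le_1: "weight x \<le> 1"
  by (simp add: weight_def add_pos_nonneg one_le_power)

lemma weight_bound_nonneg:
  fixes k :: "'a::euclidean_space \<Rightarrow> complex"
  assumes "\<And>x. cmod (k x) \<le> C * weight x"
  shows "C \<ge> 0"
proof -
  have "0 \<le> C * weight (0::'a)"
    by (rule order_trans[OF norm_ge_zero assms])
  then show ?thesis
    using weight_pos[of "0::'a"] by (simp add: zero_le_mult_iff del: weight_pos)
qed

text \<open>Lets one integrable majorant serve all shifts of length at most 1. The 3 comes from
  \<open>1 + (t + 1)\<^sup>2 \<le> 3 * (1 + t\<^sup>2)\<close>, where the difference of the two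
  sides is a sum of two squares.\<close>

lemma weight_translate: "norm s \<le> 1 \<Longrightarrow> weight (x + s) \<le> 3 ^ DIM('a) * weight (x :: 'a::euclidean_space)"
proof -
  assume s: "norm s \<le> 1"
  have "norm x \<le> norm (x + s) + 1"
    using norm_triangle_ineq4[of "x + s" s] s by simp
  then have "1 + (norm x)\<^sup>2 \<le> 1 + (norm (x + s) + 1)\<^sup>2"
    by (simp add: power_mono)
  also have "\<dots> \<le> 3 * (1 + (norm (x + s))\<^sup>2)"
  proof -
    have "3 * (1 + t\<^sup>2) - (1 + (t + 1)\<^sup>2) = t\<^sup>2 + (t - 1)\<^sup>2" for t :: real
      by (simp add: power2_eq_square algebra_simps)
    then show ?thesis
      by (metis diff_ge_0_iff_ge sum_power2_ge_zero)
  qed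
  finally have "(1 + (norm x)\<^sup>2) ^ DIM('a) \<le> (3 * (1 + (norm (x + s))\<^sup>2)) ^ DIM('a)"
    by (rule power_mono) simp
  moreover have "1 / b \<le> c * (1 / a)" if "a \<le> c * b" "a > 0" "b > 0" for a b c :: real
    using that by (simp add: field_simps)
  ultimately show ?thesis
    unfolding weight_def power_mult_distrib by (simp add: add_pos_nonneg)
qed

text \<open>A measurable function is almost everywhere a limit of continuous ones, but these come
  without a common majorant. Truncating them at a continuous positive multiple of
  \<open>weight\<close> supplies it and keeps the limit.\<close>

lemma L1_continuous_approximation:
  fixes k :: "'a::euclidean_space \<Rightarrow> complex"
  assumes [measurable]: "k \<in> borel_measurable borel" and k: "\<And>x. cmod (k x) \<le> C * weight x"
    and \<eta>: "\<eta> > 0"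
  obtains g where "continuous_on UNIV g" "\<And>x. cmod (g x) \<le> (C + 1) * weight x"
    "(LINT x|nborel. cmod (k x - g x)) < \<eta>"
proof -
  have "k measurable_on UNIV"
    by (rule lebesgue_measurable_imp_measurable_on) (auto intro: measurable_completion)
  then obtain N g where N: "negligible N" and g: "\<And>n. continuous_on UNIV (g n :: 'a \<Rightarrow> complex)"
    and lim: "\<And>x. x \<notin> N \<Longrightarrow> (\<lambda>n. g n x) \<longlonglongrightarrow> k x"
    unfolding measurable_on_def by auto
  have C: "C \<ge> 0"
    by (rule weight_bound_nonneg[OF k])
  \<comment> \<open>\<open>C + 1\<close> in place of \<open>C\<close> keeps \<open>w\<close>
    strictly positive even for \<open>C = 0\<close>, so the quotient in \<open>h\<close> has no
    vanishing denominator.\<close>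
  define w where "w x = (C + 1) * weight x" for x :: 'a
  have w: "w x > 0" for x
    using C by (simp add: w_def)
  have kw: "cmod (k x) \<le> w x" for x
    using k[of x] by (simp add: w_def algebra_simps add_increasing)
  \<comment> \<open>Radial truncation: values of \<open>g n x\<close> outside the disc of radius
    \<open>w x\<close> are pulled back to its boundary. As \<open>k x\<close> lies in that disc, it
    is left fixed in the limit.\<close>
  define h where "h n x = g n x * of_real (w x / max (w x) (cmod (g n x)))" for n x
  have mx: "max (w x) (cmod (g n x)) \<noteq> 0" for x n
    using w[of x] by (auto simp: max_def)
  have conth: "continuous_on UNIV (h n)" for n
    using mx[of _ n] unfolding h_def w_def by (intro continuous_intros g) auto
  have [measurable]: "h n \<in> borel_measurable borel" for n
    by (rule borel_measurable_continuous_onI[OF conth])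
  have hw: "cmod (h n x) \<le> w x" for n x
    using w[of x] by (auto simp: h_def norm_mult norm_divide max_def field_simps)
  have [measurable]: "w \<in> borel_measurable borel"
    unfolding w_def by simp
  have "(\<lambda>n. LINT x|nborel. cmod (k x - h n x)) \<longlonglongrightarrow> (LINT x|(nborel :: 'a measure). 0)"
  proof (rule integral_dominated_convergence[where w="\<lambda>x. 2 * w x"])
    have "AE x in lebesgue. x \<notin> N"
      using N by (auto simp: negligible_iff_null_sets intro: AE_not_in)
    then have "AE x in nborel. x \<notin> N"
      by (simp add: AE_nborel_iff AE_completion_iff)
    then show "AE x in nborel. (\<lambda>n. cmod (k x - h n x)) \<longlonglongrightarrow> 0"
    proof eventually_elim
      fix x assume x: "x \<notin> N"
      have "(\<lambda>n. h n x) \<longlonglongrightarrow> k x * of_real (w x / max (w x) (cmod (k x)))"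
        unfolding h_def using w[of x] by (intro tendsto_intros lim x) (auto simp: max_def)
      then have "(\<lambda>n. h n x) \<longlonglongrightarrow> k x"
        using kw[of x] w[of x] by (simp add: max_absorb1)
      then have "(\<lambda>n. cmod (k x - h n x)) \<longlonglongrightarrow> cmod (k x - k x)"
        by (intro tendsto_intros)
      then show "(\<lambda>n. cmod (k x - h n x)) \<longlonglongrightarrow> 0"
        by simp
    qed
    show "integrable nborel (\<lambda>x. 2 * w x)"
      unfolding w_def by (intro integrable_mult_right integrable_weight)
    show "AE x in nborel. norm (cmod (k x - h n x)) \<le> 2 * w x" for n
      using norm_triangle_ineq4[of "k _" "h n _"] kw hw[of n]
      by (intro AE_I2) (smt (verit) norm_ge_zero real_norm_def abs_of_nonneg)
  qed auto
  then have "eventually (\<lambda>n. (LINT x|nborel. cmod (k x - h n x)) < \<eta>) sequentially"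
    using \<eta> by (intro order_tendstoD(2)) auto
  then obtain n where "(LINT x|nborel. cmod (k x - h n x)) < \<eta>"
    using eventually_happens'[OF sequentially_bot] by blast
  then show ?thesis
    using that[of "h n"] conth hw by (simp add: w_def)
qed

text \<open>The usual three-term estimate: the two approximation errors agree by translation
  invariance, and the middle term, for continuous \<open>g\<close>, tends to 0 by dominated
  convergence.\<close>

lemma L1_translation_continuous:
  fixes k :: "'a::euclidean_space \<Rightarrow> complex"
  assumes k [measurable]: "k \<in> borel_measurable borel" and kC: "\<And>x. cmod (k x) \<le> C * weight x"
    and s: "s \<longlonglongrightarrow> 0"
  shows "(\<lambda>n. LINT x|nborel. cmod (k (x + s n) - k x)) \<longlonglongrightarrow> 0"
proof (rule LIMSEQ_I)
  fix \<eta> :: real assume "\<eta> > 0"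
  then obtain g where g: "continuous_on UNIV g" "\<And>x. cmod (g x) \<le> (C + 1) * weight x"
    "(LINT x|nborel. cmod (k x - g x)) < \<eta> / 3"
    using L1_continuous_approximation[OF k kC, of "\<eta> / 3"] by auto
  have [measurable]: "g \<in> borel_measurable borel"
    by (rule borel_measurable_continuous_onI[OF g(1)])
  have ik: "integrable nborel k" and ig: "integrable nborel g"
    using integrable_weight_bound[OF k kC] integrable_weight_bound[OF _ g(2)] by auto
  have C: "C + 1 \<ge> 0"
    by (rule weight_bound_nonneg[OF g(2)])
  obtain n0 where n0: "\<And>n. n \<ge> n0 \<Longrightarrow> norm (s n) < 1"
    using LIMSEQ_D[OF s, of 1] by auto
  \<comment> \<open>The index is shifted by \<open>n0\<close> because
    \<open>weight_translate\<close> gives the majorant only for shifts of norm at most 1.\<close>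
  have "(\<lambda>n. LINT x|nborel. cmod (g (x + s (n + n0)) - g x)) \<longlonglongrightarrow> (LINT x|(nborel :: 'a measure). 0)"
  proof (rule integral_dominated_convergence[where w="\<lambda>x. ((C + 1) * (3 ^ DIM('a) + 1)) * weight x"])
    show "AE x in nborel. (\<lambda>n. cmod (g (x + s (n + n0)) - g x)) \<longlonglongrightarrow> 0"
    proof (rule AE_I2)
      fix x
      have "(\<lambda>n. cmod (g (x + s (n + n0)) - g x)) \<longlonglongrightarrow> cmod (g (x + 0) - g x)"
        by (intro tendsto_intros continuous_on_tendsto_compose[OF g(1)] LIMSEQ_ignore_initial_segment s) auto
      then show "(\<lambda>n. cmod (g (x + s (n + n0)) - g x)) \<longlonglongrightarrow> 0" by simp
    qed
    show "AE x in nborel. norm (cmod (g (x + s (n + n0)) - g x)) \<le> ((C + 1) * (3 ^ DIM('a) + 1)) * weight x" for n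
    proof (rule AE_I2)
      fix x :: 'a
      have "cmod (g (x + s (n + n0)) - g x) \<le> cmod (g (x + s (n + n0))) + cmod (g x)"
        by (rule norm_triangle_ineq4)
      also have "\<dots> \<le> (C + 1) * weight (x + s (n + n0)) + (C + 1) * weight x"
        by (intro add_mono g)
      also have "\<dots> \<le> (C + 1) * (3 ^ DIM('a) * weight x) + (C + 1) * weight x"
        using n0[of "n + n0"] by (intro add_mono mult_left_mono C weight_translate) auto
      finally show "norm (cmod (g (x + s (n + n0)) - g x)) \<le> ((C + 1) * (3 ^ DIM('a) + 1)) * weight x"
        by (simp add: algebra_simps)
    qed
  qed (use integrable_weight in auto)
  then have "\<forall>\<^sub>F n in sequentially. (LINT x|nborel. cmod (g (x + s (n + n0)) - g x)) < \<eta> / 3"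
    using \<open>\<eta> > 0\<close> by (intro order_tendstoD(2)) auto
  then obtain n1 where n1: "\<And>n. n \<ge> n1 \<Longrightarrow> (LINT x|nborel. cmod (g (x + s (n + n0)) - g x)) < \<eta> / 3"
    by (auto simp: eventually_sequentially)
  show "\<exists>no. \<forall>n\<ge>no. norm ((LINT x|nborel. cmod (k (x + s n) - k x)) - 0) < \<eta>"
  proof (intro exI allI impI)
    fix n assume n: "n \<ge> n1 + n0"
    have tr: "integrable nborel (\<lambda>x. k (x + s n))" "integrable nborel (\<lambda>x. g (x + s n))"
      using integrable_translate[of k "s n"] integrable_translate[of g "s n"] ik ig by (simp_all add: add.commute)
    have "(LINT x|nborel. cmod (k (x + s n) - k x))
        \<le> (LINT x|nborel. cmod (k (x + s n) - g (x + s n)) + cmod (g (x + s n) - g x) + cmod (k x - g x))"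
    proof (rule integral_mono)
      show "cmod (k (x + s n) - k x) \<le> cmod (k (x + s n) - g (x + s n)) + cmod (g (x + s n) - g x) + cmod (k x - g x)" for x
        using norm_triangle_ineq[of "k (x + s n) - g (x + s n)" "(g (x + s n) - g x) + (g x - k x)"]
          norm_triangle_ineq[of "g (x + s n) - g x" "g x - k x"] by (simp add: norm_minus_commute)
    qed (use tr ik ig in auto)
    also have "\<dots> = (LINT x|nborel. cmod (k (x + s n) - g (x + s n)))
        + (LINT x|nborel. cmod (g (x + s n) - g x)) + (LINT x|nborel. cmod (k x - g x))"
      using tr ik ig by simp
    also have "(LINT x|nborel. cmod (k (x + s n) - g (x + s n))) = (LINT x|nborel. cmod (k x - g x))"
      using integral_translate[of "\<lambda>x. cmod (k x - g x)" "s n"] by (simp add: add.commute)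
    finally have "(LINT x|nborel. cmod (k (x + s n) - k x)) < \<eta> / 3 + \<eta> / 3 + \<eta> / 3"
      using g(3) n1[of "n - n0"] n by (simp add: le_diff_conv2)
    then show "norm ((LINT x|nborel. cmod (k (x + s n) - k x)) - 0) < \<eta>"
      by simp
  qed
qed

text \<open>Writing \<open>cnj (FT k2 t)\<close> as an integral over \<open>c\<close> and exchanging
  integrals leaves the regularized inversion integral of \<open>k1\<close> at the point
  \<open>c\<close>. The Gaussian and the bound \<open>B\<close> secure absolute convergence for the
  second exchange.\<close>

lemma FT_correlation_regularization:
  fixes k1 k2 :: "'a::euclidean_space \<Rightarrow> complex"
  assumes k1: "integrable nborel k1" and k2: "integrable nborel k2"
    and B: "\<And>x. cmod (k1 x) \<le> B" and e: "e > 0"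
  shows "(LINT t|nborel. FT k1 t * cnj (FT k2 t) * of_real (gauss (e *\<^sub>R t)))
    = (LINT s|nborel. (LINT c|nborel. cnj (k2 c) * k1 (c + e *\<^sub>R s)) * of_real (gauss s))"
proof -
  have [measurable]: "k1 \<in> borel_measurable borel" "k2 \<in> borel_measurable borel"
    using k1 k2 by auto
  let ?F = "\<lambda>c t. cnj (k2 c) * (FT k1 t * iexp (- (c \<bullet> t)) * of_real (gauss (e *\<^sub>R t)))"
  let ?G = "\<lambda>c s. cnj (k2 c) * (k1 (c + e *\<^sub>R s) * of_real (gauss s))"
  have prod: "integrable (nborel \<Otimes>\<^sub>M nborel) (\<lambda>(c, s). cnj (k2 c) * of_real (g s) :: complex)"
    if g: "integrable nborel g" for g :: "'a \<Rightarrow> real"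
  proof (rule nborel_pair.Fubini_integrable)
    have [measurable]: "g \<in> borel_measurable borel" using g by auto
    show "(\<lambda>(c, s). cnj (k2 c) * of_real (g s) :: complex) \<in> borel_measurable (nborel \<Otimes>\<^sub>M nborel)"
      by measurable
  qed (use g k2 in \<open>auto simp: norm_mult\<close>)
  have iF: "integrable (nborel \<Otimes>\<^sub>M nborel) (\<lambda>(c, t). ?F c t)"
  proof (rule Bochner_Integration.integrable_bound[OF integrable_mult_right[OF prod[OF integrable_gauss_scaled[OF e]]]])
    let ?K = "complex_of_real (LINT x|nborel. cmod (k1 x))"
    show "AE x in nborel \<Otimes>\<^sub>M nborel. cmod (case x of (c, t) \<Rightarrow> ?F c t)
        \<le> cmod (?K * (case x of (c, s) \<Rightarrow> cnj (k2 c) * of_real (gauss (e *\<^sub>R s))))"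
      using cmod_FT_le[OF k1] by (intro AE_I2) (auto simp: norm_mult mult_ac intro!: mult_left_mono mult_right_mono)
  qed measurable
  have iG: "integrable (nborel \<Otimes>\<^sub>M nborel) (\<lambda>(c, s). ?G c s)"
  proof (rule Bochner_Integration.integrable_bound[OF integrable_mult_right[OF prod[OF integrable_gauss]]])
    show "AE x in nborel \<Otimes>\<^sub>M nborel. cmod (case x of (c, s) \<Rightarrow> ?G c s)
        \<le> cmod (of_real B * (case x of (c, s) \<Rightarrow> cnj (k2 c) * of_real (gauss s)))"
      using order_trans[OF B abs_ge_self] by (intro AE_I2) (auto simp: norm_mult mult.commute[of "cmod (k2 _)"] intro!: mult_right_mono)
  qed measurable
  have cnjF: "cnj (FT k2 t) = (LINT c|nborel. cnj (k2 c) * iexp (- (c \<bullet> t)))" for t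
    unfolding FT_def Bochner_Integration.integral_cnj[symmetric] by (simp add: exp_cnj)
  have "(LINT t|nborel. FT k1 t * cnj (FT k2 t) * of_real (gauss (e *\<^sub>R t)))
      = (LINT t|nborel. LINT c|nborel. ?F c t)"
  proof (rule Bochner_Integration.integral_cong[OF refl])
    fix t
    have "(LINT c|nborel. ?F c t) = (LINT c|nborel. (FT k1 t * of_real (gauss (e *\<^sub>R t))) * (cnj (k2 c) * iexp (- (c \<bullet> t))))"
      by (intro Bochner_Integration.integral_cong refl) (simp add: mult_ac)
    then show "FT k1 t * cnj (FT k2 t) * of_real (gauss (e *\<^sub>R t)) = (LINT c|nborel. ?F c t)"
      by (simp only: integral_mult_right_zero cnjF) (simp add: mult_ac)
  qed
  also have "\<dots> = (LINT c|nborel. LINT t|nborel. ?F c t)"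
    by (rule nborel_pair.Fubini_integral[OF iF])
  also have "\<dots> = (LINT c|nborel. LINT s|nborel. ?G c s)"
    by (simp only: integral_mult_right_zero FT_gauss_regularization[OF k1 e])
  also have "\<dots> = (LINT s|nborel. LINT c|nborel. ?G c s)"
    by (rule nborel_pair.Fubini_integral[OF iG, symmetric])
  also have "\<dots> = (LINT s|nborel. (LINT c|nborel. cnj (k2 c) * k1 (c + e *\<^sub>R s)) * of_real (gauss s))"
    by (simp only: integral_mult_left_zero mult.assoc[symmetric])
  finally show ?thesis .
qed

text \<open>The limit rests on continuity at 0 of the cross-correlation \<open>A\<close>. This holds
  for merely measurable \<open>k1\<close>, because translation is continuous in L1 and
  \<open>k2\<close> is bounded.\<close>

lemma FT_correlation_limit:
  fixes k1 k2 :: "'a::euclidean_space \<Rightarrow> complex"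
  assumes k1 [measurable]: "k1 \<in> borel_measurable borel" and b1: "\<And>x. cmod (k1 x) \<le> C1 * weight x"
    and k2 [measurable]: "k2 \<in> borel_measurable borel" and b2: "\<And>x. cmod (k2 x) \<le> C2 * weight x"
  shows "(\<lambda>n. LINT t|nborel. FT k1 t * cnj (FT k2 t) * of_real (gauss ((1 / real (Suc n)) *\<^sub>R t)))
    \<longlonglongrightarrow> (LINT c|nborel. k1 c * cnj (k2 c))"
proof -
  have C1: "C1 \<ge> 0" and C2: "C2 \<ge> 0"
    using weight_bound_nonneg[OF b1] weight_bound_nonneg[OF b2] .
  have B1: "cmod (k1 x) \<le> C1" and B2: "cmod (k2 x) \<le> C2" for x
    using b1[of x] b2[of x] mult_left_mono[OF weight_le_1 C1] mult_left_mono[OF weight_le_1 C2]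
    by (auto intro: order_trans)
  have i1: "integrable nborel k1" and i2: "integrable nborel k2"
    using integrable_weight_bound[OF k1 b1] integrable_weight_bound[OF k2 b2] .
  define A where "A s = (LINT c|nborel. cnj (k2 c) * k1 (c + s))" for s
  have [measurable]: "A \<in> borel_measurable borel"
    unfolding A_def by measurable
  have tr: "integrable nborel (\<lambda>c. k1 (c + s))" for s
    using integrable_translate[of k1 s] i1 by (simp add: add.commute)
  have iA: "integrable nborel (\<lambda>c. cnj (k2 c) * k1 (c + s))" for s
    using tr[of s] B2 by (subst mult.commute, intro integrable_mult_bounded[where B=C2]) auto
  have Abound: "cmod (A s) \<le> C2 * (LINT c|nborel. cmod (k1 c))" for s
  proof -
    have "cmod (A s) \<le> (LINT c|nborel. C2 * cmod (k1 (c + s)))"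
      unfolding A_def using tr[of s] B2 integrable_norm[OF iA[of s]]
      by (intro order_trans[OF integral_norm_bound] integral_mono)
        (auto simp: norm_mult intro!: mult_right_mono)
    also have "\<dots> = C2 * (LINT c|nborel. cmod (k1 c))"
      using integral_translate[of "\<lambda>c. cmod (k1 c)" s] by (simp add: add.commute)
    finally show ?thesis .
  qed
  have Acont: "(\<lambda>n. A (s n)) \<longlonglongrightarrow> A 0" if s: "s \<longlonglongrightarrow> 0" for s
  proof (rule LIMSEQ_I)
    fix r :: real assume "r > 0"
    have "(\<lambda>n. C2 * (LINT x|nborel. cmod (k1 (x + s n) - k1 x))) \<longlonglongrightarrow> C2 * 0"
      by (intro tendsto_intros L1_translation_continuous[OF k1 b1 s])
    then have "\<forall>\<^sub>F n in sequentially. C2 * (LINT x|nborel. cmod (k1 (x + s n) - k1 x)) < r"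
      using \<open>r > 0\<close> by (intro order_tendstoD(2)) auto
    then obtain N where N: "\<And>n. n \<ge> N \<Longrightarrow> C2 * (LINT x|nborel. cmod (k1 (x + s n) - k1 x)) < r"
      by (auto simp: eventually_sequentially)
    have "cmod (A (s n) - A 0) \<le> C2 * (LINT x|nborel. cmod (k1 (x + s n) - k1 x))" for n
    proof -
      have iD: "integrable nborel (\<lambda>c. cnj (k2 c) * (k1 (c + s n) - k1 c))"
        using iA[of "s n"] iA[of 0] by (simp add: right_diff_distrib)
      have "A (s n) - A 0 = (LINT c|nborel. cnj (k2 c) * (k1 (c + s n) - k1 c))"
        unfolding A_def using iA[of "s n"] iA[of 0]
        by (simp add: right_diff_distrib)
      also have "cmod \<dots> \<le> (LINT c|nborel. C2 * cmod (k1 (c + s n) - k1 c))"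
        using tr[of "s n"] i1 B2 integrable_norm[OF iD]
        by (intro order_trans[OF integral_norm_bound] integral_mono) (auto simp: norm_mult intro!: mult_right_mono)
      finally show ?thesis by simp
    qed
    then show "\<exists>no. \<forall>n\<ge>no. norm (A (s n) - A 0) < r"
      using N by (meson le_less_trans)
  qed
  have "(\<lambda>n. LINT s|nborel. A ((1 / real (Suc n)) *\<^sub>R s) * of_real (gauss s))
      \<longlonglongrightarrow> (LINT s|(nborel :: 'a measure). A 0 * of_real (gauss s))"
  proof (rule integral_dominated_convergence[where w="\<lambda>s. (C2 * (LINT c|nborel. cmod (k1 c))) * gauss s"])
    show "AE s in nborel. (\<lambda>n. A ((1 / real (Suc n)) *\<^sub>R s) * of_real (gauss s)) \<longlonglongrightarrow> A 0 * of_real (gauss s)"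
    proof (intro AE_I2 tendsto_intros Acont)
      fix s :: 'a
      have "(\<lambda>n. (1 / real (Suc n)) *\<^sub>R s) \<longlonglongrightarrow> 0 *\<^sub>R s"
        by (intro tendsto_intros inverse_Suc_tendsto_0)
      then show "(\<lambda>n. (1 / real (Suc n)) *\<^sub>R s) \<longlonglongrightarrow> 0" by simp
    qed
  qed (use integrable_gauss Abound in \<open>auto simp: norm_mult intro!: mult_right_mono\<close>)
  also have "(LINT s|(nborel :: 'a measure). A 0 * of_real (gauss s)) = (LINT c|nborel. k1 c * cnj (k2 c))"
    by (simp add: integral_gauss A_def mult.commute)
  finally show ?thesis
    using FT_correlation_regularization[OF i1 i2 B1] by (simp add: A_def)
qed

text \<open>On the diagonal the regularized integrals increase with \<open>n\<close> and converge,
  so monotone convergence shows that each transform is square integrable. The mixed product is then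
  dominated by the sum of two squares, which removes the Gaussian in the general case.\<close>

theorem
  fixes k1 k2 :: "'a::euclidean_space \<Rightarrow> complex"
  assumes k1 [measurable]: "k1 \<in> borel_measurable borel" and b1: "\<And>x. cmod (k1 x) \<le> C1 * weight x"
    and k2 [measurable]: "k2 \<in> borel_measurable borel" and b2: "\<And>x. cmod (k2 x) \<le> C2 * weight x"
  shows integrable_FT_mult_cnj: "integrable nborel (\<lambda>t. FT k1 t * cnj (FT k2 t))"
    and Plancherel: "(LINT t|nborel. FT k1 t * cnj (FT k2 t)) = (LINT c|nborel. k1 c * cnj (k2 c))"
proof -
  have L2: "integrable nborel (\<lambda>t. (cmod (FT k t))\<^sup>2)"
    if k [measurable]: "k \<in> borel_measurable borel" and b: "\<And>x. cmod (k x) \<le> C * weight x"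
    for k :: "'a \<Rightarrow> complex" and C
  proof (rule integrable_monotone_convergence)
    let ?f = "\<lambda>n t. (cmod (FT k t))\<^sup>2 * gauss ((1 / real (Suc n)) *\<^sub>R t)"
    have ik: "integrable nborel k"
      by (rule integrable_weight_bound[OF k b])
    show "integrable nborel (?f n)" for n
    proof (rule Bochner_Integration.integrable_bound)
      let ?K = "LINT x|nborel. cmod (k x)"
      show "integrable nborel (\<lambda>t::'a. ?K\<^sup>2 * gauss ((1 / real (Suc n)) *\<^sub>R t))"
        using integrable_gauss_scaled[of "1 / real (Suc n)"] by (intro integrable_mult_right) simp
      show "AE t in nborel. norm (?f n t) \<le> norm (?K\<^sup>2 * gauss ((1 / real (Suc n)) *\<^sub>R t))"
        using cmod_FT_le[OF ik] by (intro AE_I2) (auto simp: abs_mult intro!: mult_right_mono power_mono)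
    qed measurable
    show "AE t in nborel. mono (\<lambda>n. ?f n t)"
      by (intro AE_I2 monoI mult_left_mono gauss_scale_antimono) (auto intro!: divide_left_mono)
    show "AE t in nborel. (\<lambda>n. ?f n t) \<longlonglongrightarrow> (cmod (FT k t))\<^sup>2"
      using tendsto_mult[OF tendsto_const gauss_seq_tendsto] by (intro AE_I2) fastforce
    have "(\<lambda>n. Re (LINT t|nborel. FT k t * cnj (FT k t) * of_real (gauss ((1 / real (Suc n)) *\<^sub>R t))))
        \<longlonglongrightarrow> Re (LINT c|nborel. k c * cnj (k c))"
      by (intro tendsto_intros FT_correlation_limit[OF k b k b])
    also have "(\<lambda>n. Re (LINT t|nborel. FT k t * cnj (FT k t) * of_real (gauss ((1 / real (Suc n)) *\<^sub>R t))))
        = (\<lambda>n. LINT t|nborel. ?f n t)"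
      by (simp only: complex_norm_square[symmetric] of_real_power[symmetric] of_real_mult[symmetric]
          integral_complex_of_real Re_complex_of_real)
    finally show "(\<lambda>n. LINT t|nborel. ?f n t) \<longlonglongrightarrow> Re (LINT c|nborel. k c * cnj (k c))" .
  qed measurable
  have i: "integrable nborel (\<lambda>t. (cmod (FT k1 t))\<^sup>2 + (cmod (FT k2 t))\<^sup>2)"
    using L2[OF k1 b1] L2[OF k2 b2] by simp
  have le: "cmod (FT k1 t * cnj (FT k2 t)) \<le> (cmod (FT k1 t))\<^sup>2 + (cmod (FT k2 t))\<^sup>2" for t
    using sum_squares_bound[of "cmod (FT k1 t)" "cmod (FT k2 t)"]
      mult_nonneg_nonneg[OF norm_ge_zero norm_ge_zero, of "FT k1 t" "FT k2 t"]
    unfolding norm_mult complex_mod_cnj by linarith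
  show int: "integrable nborel (\<lambda>t. FT k1 t * cnj (FT k2 t))"
    by (rule Bochner_Integration.integrable_bound[OF i]) (auto intro!: order_trans[OF le])
  have "(\<lambda>n. LINT t|nborel. FT k1 t * cnj (FT k2 t) * of_real (gauss ((1 / real (Suc n)) *\<^sub>R t)))
      \<longlonglongrightarrow> (LINT t|nborel. FT k1 t * cnj (FT k2 t) * of_real 1)"
  proof (rule integral_dominated_convergence[where w="\<lambda>t. cmod (FT k1 t * cnj (FT k2 t))"])
    show "AE t in nborel. (\<lambda>n. FT k1 t * cnj (FT k2 t) * of_real (gauss ((1 / real (Suc n)) *\<^sub>R t)))
        \<longlonglongrightarrow> FT k1 t * cnj (FT k2 t) * of_real 1"
      by (intro AE_I2 tendsto_intros gauss_seq_tendsto)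
  qed (use integrable_norm[OF int] in \<open>auto simp: norm_mult intro!: mult_left_le\<close>)
  with FT_correlation_limit[OF k1 b1 k2 b2]
  show "(LINT t|nborel. FT k1 t * cnj (FT k2 t)) = (LINT c|nborel. k1 c * cnj (k2 c))"
    by (simp add: LIMSEQ_unique)
qed

section \<open>Schwartz functions\<close>

abbreviation dir_deriv :: "'a::euclidean_space \<Rightarrow> ('a \<Rightarrow> complex) \<Rightarrow> 'a \<Rightarrow> complex" where
  "dir_deriv b f \<equiv> (\<lambda>x. frechet_derivative f (at x) b)"

text \<open>Membership is proved by exhibiting a family closed under the basis derivatives whose
  members are differentiable and rapidly decreasing. This replaces Leibniz and chain rules for
  iterated derivatives by a single first-order computation.\<close>

lemma schwartz_coinduct [consumes 1, case_names differentiable bounded derivative]: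
  assumes "f \<in> P"
    and diff: "\<And>f x. f \<in> P \<Longrightarrow> f differentiable (at x)"
    and bdd: "\<And>f k. f \<in> P \<Longrightarrow> \<exists>C. \<forall>x. norm x ^ k * cmod (f x) \<le> C"
    and deriv: "\<And>f b. f \<in> P \<Longrightarrow> b \<in> Basis \<Longrightarrow> dir_deriv b f \<in> P"
  shows "f \<in> schwartz"
proof -
  have "iter_deriv bs f \<in> P" if "set bs \<subseteq> Basis" for bs
    using that by (induction bs) (auto intro: deriv \<open>f \<in> P\<close>)
  then show ?thesis
    unfolding schwartz_def using diff bdd by (force simp: bdd_above_def)
qed

lemma schwartz_differentiable: "(f :: 'a::euclidean_space \<Rightarrow> complex) \<in> schwartz \<Longrightarrow> f differentiable (at x)"
proof -
  assume "f \<in> schwartz"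
  then have "set ([] :: 'a list) \<subseteq> Basis \<longrightarrow> iter_deriv [] f differentiable (at x)"
    unfolding schwartz_def by blast
  then show ?thesis by simp
qed

lemma schwartz_bounded:
  fixes f :: "'a::euclidean_space \<Rightarrow> complex"
  assumes "f \<in> schwartz"
  shows "\<exists>C. \<forall>x. norm x ^ k * cmod (f x) \<le> C"
proof -
  have "bdd_above (range (\<lambda>x. norm x ^ k * cmod (iter_deriv [] f x)))"
    using assms[unfolded schwartz_def mem_Collect_eq, THEN spec[of _ "[]"]] by simp
  then show ?thesis
    by (auto simp: bdd_above_def)
qed

lemma schwartz_dir_deriv:
  assumes "f \<in> schwartz" "b \<in> Basis"
  shows "dir_deriv b f \<in> schwartz"
proof -
  \<comment> \<open>The head of the list is the derivative taken last, so differentiating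
    \<open>f\<close> beforehand appends \<open>b\<close> at the end.\<close>
  have "iter_deriv bs (dir_deriv b f) = iter_deriv (bs @ [b]) f" for bs
    by (induction bs) auto
  then show ?thesis
    using assms unfolding schwartz_def by simp
qed

lemma schwartz_has_derivative: "f \<in> schwartz \<Longrightarrow> (f has_derivative frechet_derivative f (at x)) (at x)"
  using schwartz_differentiable frechet_derivative_works by blast

lemma schwartz_continuous_on: "f \<in> schwartz \<Longrightarrow> continuous_on S f"
  by (intro continuous_at_imp_continuous_on ballI differentiable_imp_continuous_within schwartz_differentiable)

lemma schwartz_measurable: "f \<in> schwartz \<Longrightarrow> f \<in> borel_measurable borel"
  by (intro borel_measurable_continuous_onI schwartz_continuous_on)

lemma frechet_derivative_Basis_expansion:
  assumes "f \<in> schwartz"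
  shows "frechet_derivative f (at x) v = (\<Sum>b\<in>Basis. of_real (v \<bullet> b) * dir_deriv b f x)"
proof -
  interpret linear "frechet_derivative f (at x)"
    by (rule has_derivative_linear[OF schwartz_has_derivative[OF assms]])
  have "frechet_derivative f (at x) (\<Sum>b\<in>Basis. (v \<bullet> b) *\<^sub>R b) = (\<Sum>b\<in>Basis. (v \<bullet> b) *\<^sub>R dir_deriv b f x)"
    unfolding sum scale ..
  then show ?thesis
    by (simp add: euclidean_representation scaleR_conv_of_real)
qed

lemma dir_deriv_eq:
  assumes "\<And>x. (f has_derivative f' x) (at x)"
  shows "dir_deriv b f = (\<lambda>x. f' x b)"
  by (simp only: frechet_derivative_at[OF assms])

section \<open>Closure properties of the Schwartz space\<close>

lemma schwartz_zero: "(\<lambda>_. 0) \<in> schwartz"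
proof (rule schwartz_coinduct[where P="{\<lambda>_. 0}"])
  show "dir_deriv b f \<in> {\<lambda>_. 0}" if "f \<in> {\<lambda>_. 0}" for f and b :: 'a
    using that dir_deriv_eq[of "\<lambda>_. 0" "\<lambda>_ _. 0"] by auto
qed auto

lemma schwartz_add:
  assumes "f \<in> schwartz" "g \<in> schwartz"
  shows "(\<lambda>x. f x + g x) \<in> schwartz"
proof (rule schwartz_coinduct[where P="{\<lambda>x. f x + g x | f g. f \<in> schwartz \<and> g \<in> schwartz}"])
  fix h :: "'a \<Rightarrow> complex" assume "h \<in> {\<lambda>x. f x + g x | f g. f \<in> schwartz \<and> g \<in> schwartz}"
  then obtain f g where h: "h = (\<lambda>x. f x + g x)" and f: "f \<in> schwartz" and g: "g \<in> schwartz"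
    by blast
  show "h differentiable (at x)" for x
    unfolding h by (intro derivative_intros schwartz_differentiable f g)
  show "\<exists>C. \<forall>x. norm x ^ k * cmod (h x) \<le> C" for k
  proof -
    obtain C D where CD: "\<forall>x. norm x ^ k * cmod (f x) \<le> C" "\<forall>x. norm x ^ k * cmod (g x) \<le> D"
      using schwartz_bounded[OF f, of k] schwartz_bounded[OF g, of k] by metis
    have "norm x ^ k * cmod (h x) \<le> C + D" for x
    proof -
      have "norm x ^ k * cmod (h x) \<le> norm x ^ k * (cmod (f x) + cmod (g x))"
        unfolding h by (intro mult_left_mono norm_triangle_ineq) simp
      also have "\<dots> = norm x ^ k * cmod (f x) + norm x ^ k * cmod (g x)"
        by (rule distrib_left)
      also have "\<dots> \<le> C + D"
        using CD by (intro add_mono) auto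
      finally show ?thesis .
    qed
    then show ?thesis by blast
  qed
  show "dir_deriv b h \<in> {\<lambda>x. f x + g x | f g. f \<in> schwartz \<and> g \<in> schwartz}" if "b \<in> Basis" for b
  proof -
    have "dir_deriv b h = (\<lambda>x. dir_deriv b f x + dir_deriv b g x)"
      unfolding h by (rule dir_deriv_eq) (intro derivative_intros schwartz_has_derivative f g)
    then show ?thesis
      using schwartz_dir_deriv[OF f that] schwartz_dir_deriv[OF g that]
      by (intro CollectI exI[of _ "dir_deriv b f"] exI[of _ "dir_deriv b g"] conjI)
  qed
qed (use assms in blast)

lemma schwartz_mult_left:
  assumes "f \<in> schwartz"
  shows "(\<lambda>x. z * f x) \<in> schwartz"
proof (rule schwartz_coinduct[where P="{\<lambda>x. z * f x | f. f \<in> schwartz}"])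
  fix h :: "'a \<Rightarrow> complex" assume "h \<in> {\<lambda>x. z * f x | f. f \<in> schwartz}"
  then obtain f where h: "h = (\<lambda>x. z * f x)" and f: "f \<in> schwartz"
    by blast
  show "h differentiable (at x)" for x
    unfolding h by (intro derivative_intros schwartz_differentiable f)
  show "\<exists>C. \<forall>x. norm x ^ k * cmod (h x) \<le> C" for k
  proof -
    obtain C where C: "\<forall>x. norm x ^ k * cmod (f x) \<le> C"
      using schwartz_bounded[OF f, of k] by metis
    have "norm x ^ k * cmod (h x) \<le> cmod z * C" for x
      using mult_left_mono[OF C[THEN spec, of x], of "cmod z"] by (simp add: h norm_mult mult_ac)
    then show ?thesis by blast
  qed
  show "dir_deriv b h \<in> {\<lambda>x. z * f x | f. f \<in> schwartz}" if "b \<in> Basis" for b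
  proof -
    have "dir_deriv b h = (\<lambda>x. z * dir_deriv b f x)"
      unfolding h by (rule dir_deriv_eq) (intro derivative_intros schwartz_has_derivative f)
    then show ?thesis
      using schwartz_dir_deriv[OF f that] by (intro CollectI exI[of _ "dir_deriv b f"] conjI)
  qed
qed (use assms in blast)

lemma schwartz_sum:
  assumes "finite A" "\<And>a. a \<in> A \<Longrightarrow> f a \<in> schwartz"
  shows "(\<lambda>x. \<Sum>a\<in>A. f a x) \<in> schwartz"
  using assms by (induction A rule: finite_induct) (auto intro: schwartz_zero schwartz_add)

lemma schwartz_cnj:
  assumes "f \<in> schwartz"
  shows "(\<lambda>x. cnj (f x)) \<in> schwartz"
proof (rule schwartz_coinduct[where P="{\<lambda>x. cnj (f x) | f. f \<in> schwartz}"])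
  fix h :: "'a \<Rightarrow> complex" assume "h \<in> {\<lambda>x. cnj (f x) | f. f \<in> schwartz}"
  then obtain f where h: "h = (\<lambda>x. cnj (f x))" and f: "f \<in> schwartz"
    by blast
  have D: "(h has_derivative (\<lambda>v. cnj (frechet_derivative f (at x) v))) (at x)" for x
    unfolding h by (intro bounded_linear.has_derivative[OF bounded_linear_cnj] schwartz_has_derivative f)
  show "h differentiable (at x)" for x
    using D differentiable_def by blast
  show "\<exists>C. \<forall>x. norm x ^ k * cmod (h x) \<le> C" for k
    using schwartz_bounded[OF f] by (simp add: h)
  show "dir_deriv b h \<in> {\<lambda>x. cnj (f x) | f. f \<in> schwartz}" if "b \<in> Basis" for b
    using dir_deriv_eq[of h, OF D, of b] schwartz_dir_deriv[OF f that]
    by (intro CollectI exI[of _ "dir_deriv b f"] conjI)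
qed (use assms in blast)

text \<open>The family is enlarged by a summand \<open>g\<close>: the product rule yields a
  coordinate multiple of a derivative of \<open>f\<close>, plus terms that are Schwartz already and
  are collected in the new \<open>g\<close>.\<close>

lemma schwartz_mult_coordinate:
  assumes "f \<in> schwartz"
  shows "(\<lambda>x. of_real (x \<bullet> a) * f x) \<in> schwartz"
proof (rule schwartz_coinduct[where P="{\<lambda>x. of_real (x \<bullet> a) * f x + g x | f g. f \<in> schwartz \<and> g \<in> schwartz}"])
  fix h :: "'a \<Rightarrow> complex" assume "h \<in> {\<lambda>x. of_real (x \<bullet> a) * f x + g x | f g. f \<in> schwartz \<and> g \<in> schwartz}"
  then obtain f g where h: "h = (\<lambda>x. of_real (x \<bullet> a) * f x + g x)" and f: "f \<in> schwartz" and g: "g \<in> schwartz"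
    by blast
  have D: "(h has_derivative (\<lambda>v. of_real (x \<bullet> a) * frechet_derivative f (at x) v
      + of_real (v \<bullet> a) * f x + frechet_derivative g (at x) v)) (at x)" for x
    unfolding h by (intro derivative_intros schwartz_has_derivative f g)
  show "h differentiable (at x)" for x
    using D differentiable_def by blast
  show "\<exists>C. \<forall>x. norm x ^ k * cmod (h x) \<le> C" for k
  proof -
    obtain C D where CD: "\<forall>x. norm x ^ Suc k * cmod (f x) \<le> C" "\<forall>x. norm x ^ k * cmod (g x) \<le> D"
      using schwartz_bounded[OF f, of "Suc k"] schwartz_bounded[OF g, of k] by metis
    have "norm x ^ k * cmod (h x) \<le> norm a * C + D" for x
    proof -
      have "cmod (h x) \<le> norm x * norm a * cmod (f x) + cmod (g x)"
        unfolding h by (rule order_trans[OF norm_triangle_ineq])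
          (simp add: norm_mult mult_right_mono Cauchy_Schwarz_ineq2)
      then have "norm x ^ k * cmod (h x) \<le> norm x ^ k * (norm x * norm a * cmod (f x) + cmod (g x))"
        by (rule mult_left_mono) simp
      also have "\<dots> = norm a * (norm x ^ Suc k * cmod (f x)) + norm x ^ k * cmod (g x)"
        by (simp add: algebra_simps)
      also have "\<dots> \<le> norm a * C + D"
        using CD by (intro add_mono mult_left_mono) auto
      finally show ?thesis .
    qed
    then show ?thesis by blast
  qed
  show "dir_deriv b h \<in> {\<lambda>x. of_real (x \<bullet> a) * f x + g x | f g. f \<in> schwartz \<and> g \<in> schwartz}"
    if "b \<in> Basis" for b
  proof -
    have "dir_deriv b h = (\<lambda>x. of_real (x \<bullet> a) * dir_deriv b f x + (of_real (b \<bullet> a) * f x + dir_deriv b g x))"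
      using dir_deriv_eq[of h, OF D] by (simp add: add.assoc)
    moreover have "(\<lambda>x. of_real (b \<bullet> a) * f x + dir_deriv b g x) \<in> schwartz"
      by (intro schwartz_add schwartz_mult_left schwartz_dir_deriv f g that)
    ultimately show ?thesis
      using schwartz_dir_deriv[OF f that] by (intro CollectI exI conjI)
  qed
next
  show "(\<lambda>x. of_real (x \<bullet> a) * f x) \<in> {\<lambda>x. of_real (x \<bullet> a) * f x + g x | f g. f \<in> schwartz \<and> g \<in> schwartz}"
    using assms schwartz_zero by (intro CollectI exI[of _ f] exI[of _ "\<lambda>_. 0"]) simp
qed

lemma has_derivative_iexp_inner:
  "((\<lambda>y. iexp (y \<bullet> w)) has_derivative (\<lambda>v. \<i> * of_real (v \<bullet> w) * iexp (y \<bullet> w))) (at y)"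
proof -
  have "(exp has_derivative (*) (exp (\<i> * of_real (y \<bullet> w)))) (at (\<i> * of_real (y \<bullet> w)))"
    using DERIV_exp[of "\<i> * complex_of_real (y \<bullet> w)"] by (simp add: has_field_derivative_def)
  moreover have "((\<lambda>y. \<i> * of_real (y \<bullet> w)) has_derivative (\<lambda>v. \<i> * of_real (v \<bullet> w))) (at y)"
    by (intro derivative_intros)
  ultimately show ?thesis
    by (auto dest: has_derivative_compose simp: mult.commute)
qed

text \<open>The lower bound on \<open>L\<close> prevents decay from being lost along a kernel.
  Modulations, reflection, conjugation of the variable and restriction to a complex line are all
  instances.\<close>

lemma schwartz_modulate_compose_linear:
  fixes L :: "'b::euclidean_space \<Rightarrow> 'a::euclidean_space"
  assumes f: "f \<in> schwartz" and L: "linear L" and K: "\<And>y. norm y \<le> K * norm (L y)"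
  shows "(\<lambda>y. iexp (y \<bullet> w) * f (L y)) \<in> schwartz"
proof (rule schwartz_coinduct[where P="{\<lambda>y. iexp (y \<bullet> w) * f (L y) | f. f \<in> schwartz}"])
  fix h assume "h \<in> {\<lambda>y. iexp (y \<bullet> w) * f (L y) | f. f \<in> schwartz}"
  then obtain f where h: "h = (\<lambda>y. iexp (y \<bullet> w) * f (L y))" and f: "f \<in> schwartz"
    by blast
  have L': "(L has_derivative L) (at y)" for y
    using L by (simp add: linear_imp_has_derivative)
  have D: "(h has_derivative (\<lambda>v. iexp (y \<bullet> w) * frechet_derivative f (at (L y)) (L v)
      + \<i> * of_real (v \<bullet> w) * iexp (y \<bullet> w) * f (L y))) (at y)" for y
    unfolding h
    by (intro has_derivative_mult has_derivative_iexp_inner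
        has_derivative_compose[OF L' schwartz_has_derivative[OF f]])
  show "h differentiable (at x)" for x
    using D differentiable_def by blast
  show "\<exists>C. \<forall>x. norm x ^ k * cmod (h x) \<le> C" for k
  proof -
    obtain C where C: "\<forall>x. norm x ^ k * cmod (f x) \<le> C"
      using schwartz_bounded[OF f, of k] by metis
    have "norm y ^ k * cmod (h y) \<le> \<bar>K\<bar> ^ k * C" for y
    proof -
      have "norm y \<le> \<bar>K\<bar> * norm (L y)"
        using K[of y] by (rule order_trans) (simp add: mult_right_mono)
      then have "norm y ^ k * cmod (h y) \<le> (\<bar>K\<bar> * norm (L y)) ^ k * cmod (f (L y))"
        unfolding h by (simp add: norm_mult mult_right_mono power_mono)
      also have "\<dots> = \<bar>K\<bar> ^ k * (norm (L y) ^ k * cmod (f (L y)))"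
        by (simp add: power_mult_distrib)
      also have "\<dots> \<le> \<bar>K\<bar> ^ k * C"
        using C by (intro mult_left_mono) auto
      finally show ?thesis .
    qed
    then show ?thesis by blast
  qed
  show "dir_deriv b h \<in> {\<lambda>y. iexp (y \<bullet> w) * f (L y) | f. f \<in> schwartz}" if "b \<in> Basis" for b
  proof -
    \<comment> \<open>Expanding \<open>L b\<close> in \<open>Basis\<close> turns the chain rule into
      a derivative of \<open>f\<close> along basis vectors, so the result is again the modulated
      pull-back of a single Schwartz function.\<close>
    let ?g = "\<lambda>x. (\<Sum>c\<in>Basis. of_real (L b \<bullet> c) * dir_deriv c f x) + \<i> * of_real (b \<bullet> w) * f x"
    have "dir_deriv b h = (\<lambda>y. iexp (y \<bullet> w) * ?g (L y))"
      unfolding dir_deriv_eq[of h, OF D] frechet_derivative_Basis_expansion[OF f, of _ "L b"]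
      by (simp add: algebra_simps)
    moreover have "?g \<in> schwartz"
      by (intro schwartz_add schwartz_sum schwartz_mult_left schwartz_dir_deriv f) auto
    ultimately show ?thesis
      by (intro CollectI exI[of _ ?g]) simp
  qed
qed (use f in blast)

section \<open>Quantitative decay and integration by parts\<close>

lemma schwartz_decay:
  assumes f: "f \<in> schwartz"
  obtains C where "C \<ge> 0" "\<And>x. (1 + (norm x)\<^sup>2) ^ j * cmod (f x) \<le> C"
proof -
  have "\<exists>C. \<forall>x. norm x ^ k * ((1 + (norm x)\<^sup>2) ^ j * cmod (f x)) \<le> C" for k
  proof (induction j arbitrary: k)
    case 0
    then show ?case using schwartz_bounded[OF f] by simp
  next
    case (Suc j)
    obtain C D where CD: "\<forall>x. norm x ^ k * ((1 + (norm x)\<^sup>2) ^ j * cmod (f x)) \<le> C"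
      "\<forall>x. norm x ^ (k + 2) * ((1 + (norm x)\<^sup>2) ^ j * cmod (f x)) \<le> D"
      using Suc by blast
    have "norm x ^ k * ((1 + (norm x)\<^sup>2) ^ Suc j * cmod (f x)) \<le> C + D" for x
    proof -
      have "norm x ^ k * ((1 + (norm x)\<^sup>2) ^ Suc j * cmod (f x))
          = norm x ^ k * ((1 + (norm x)\<^sup>2) ^ j * cmod (f x)) + norm x ^ (k + 2) * ((1 + (norm x)\<^sup>2) ^ j * cmod (f x))"
        by (simp add: power_add power2_eq_square algebra_simps)
      also have "\<dots> \<le> C + D"
        using CD by (intro add_mono) auto
      finally show ?thesis .
    qed
    then show ?case by blast
  qed
  from this[of 0] obtain C where "\<forall>x. (1 + (norm x)\<^sup>2) ^ j * cmod (f x) \<le> C"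
    by auto
  then show ?thesis
    using that[of "\<bar>C\<bar>"] by (force intro: order_trans)
qed

text \<open>\<open>DIM('a)\<close> additional powers of \<open>1 + (norm x)\<^sup>2\<close> are
  traded for the factor \<open>weight x\<close>.\<close>

lemma schwartz_weight_bound:
  fixes f :: "'a::euclidean_space \<Rightarrow> complex"
  assumes "f \<in> schwartz"
  obtains C where "\<And>x. (1 + (norm x)\<^sup>2) ^ j * cmod (f x) \<le> C * weight x"
proof -
  obtain C where C: "\<And>x. (1 + (norm x)\<^sup>2) ^ (j + DIM('a)) * cmod (f x) \<le> C"
    using schwartz_decay[OF assms] by blast
  have "(1 + (norm x)\<^sup>2) ^ j * cmod (f x) \<le> C * weight x" for x
    using C[of x] by (simp add: weight_def power_add pos_le_divide_eq add_pos_nonneg mult_ac)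
  then show ?thesis by (rule that)
qed

lemma schwartz_integrable: "f \<in> schwartz \<Longrightarrow> integrable nborel f"
  by (rule schwartz_weight_bound[of f 0]) (auto intro: integrable_weight_bound schwartz_measurable)

text \<open>The mean value inequality on the segment from \<open>x\<close> to
  \<open>x + t *\<^sub>R b\<close> bounds the increment by a derivative at a point within distance 1
  of \<open>x\<close>. Difference quotients thus have an integrable majorant independent of
  \<open>t\<close>.\<close>

lemma schwartz_increment_bound:
  fixes f :: "'a::euclidean_space \<Rightarrow> complex"
  assumes f: "f \<in> schwartz" and b: "b \<in> Basis"
  obtains C where "\<And>x t. 0 < t \<Longrightarrow> t \<le> 1 \<Longrightarrow> cmod (f (x + t *\<^sub>R b) - f x) \<le> t * (C * weight x)"
proof -
  obtain C where C: "\<And>x. cmod (dir_deriv b f x) \<le> C * weight x"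
    using schwartz_weight_bound[OF schwartz_dir_deriv[OF f b], of 0] by auto
  have C0: "C \<ge> 0"
    by (rule weight_bound_nonneg[OF C])
  have "cmod (f (x + t *\<^sub>R b) - f x) \<le> t * ((C * 3 ^ DIM('a)) * weight x)" if t: "0 < t" "t \<le> 1" for x t
  proof -
    have D: "((\<lambda>s. f (x + s *\<^sub>R b)) has_derivative (\<lambda>r. frechet_derivative f (at (x + s *\<^sub>R b)) (r *\<^sub>R b))) (at s)" for s
      by (rule has_derivative_compose[OF _ schwartz_has_derivative[OF f]]) (auto intro!: derivative_eq_intros)
    have "continuous_on {0..t} (\<lambda>s. f (x + s *\<^sub>R b))"
      by (intro continuous_at_imp_continuous_on ballI has_derivative_continuous[OF D])
    then obtain s where s: "s \<in> {0<..<t}"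
      "cmod (f (x + t *\<^sub>R b) - f (x + 0 *\<^sub>R b)) \<le> cmod (frechet_derivative f (at (x + s *\<^sub>R b)) ((t - 0) *\<^sub>R b))"
      using mvt_general[OF t(1) _ D] by blast
    have "frechet_derivative f (at (x + s *\<^sub>R b)) (t *\<^sub>R b) = t *\<^sub>R dir_deriv b f (x + s *\<^sub>R b)"
      by (rule linear_scale[OF has_derivative_linear[OF schwartz_has_derivative[OF f]]])
    then have "cmod (f (x + t *\<^sub>R b) - f x) \<le> t * cmod (dir_deriv b f (x + s *\<^sub>R b))"
      using s(2) t by simp
    also have "\<dots> \<le> t * (C * weight (x + s *\<^sub>R b))"
      using t by (intro mult_left_mono C) simp
    also have "\<dots> \<le> t * (C * (3 ^ DIM('a) * weight x))"
      using t s(1) b C0 by (intro mult_left_mono weight_translate) auto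
    finally show ?thesis by (simp add: mult_ac)
  qed
  then show ?thesis by (rule that)
qed

text \<open>Every difference quotient has integral 0 by translation invariance, and the quotients
  converge dominatedly to the derivative. This is the boundary-free integration by parts.\<close>

lemma integral_dir_deriv_eq_0:
  fixes f :: "'a::euclidean_space \<Rightarrow> complex"
  assumes f: "f \<in> schwartz" and b: "b \<in> Basis"
  shows "(LINT x|nborel. dir_deriv b f x) = 0"
proof -
  have [measurable]: "f \<in> borel_measurable borel"
    using f by (rule schwartz_measurable)
  have [measurable]: "dir_deriv b f \<in> borel_measurable borel"
    using schwartz_dir_deriv[OF f b] by (rule schwartz_measurable)
  obtain C where C: "\<And>x t. 0 < t \<Longrightarrow> t \<le> 1 \<Longrightarrow> cmod (f (x + t *\<^sub>R b) - f x) \<le> t * (C * weight x)"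
    using schwartz_increment_bound[OF f b] by blast
  define t where "t n = 1 / real (Suc n)" for n
  have t: "0 < t n" "t n \<le> 1" for n
    by (auto simp: t_def)
  have "(\<lambda>n. LINT x|nborel. (f (x + t n *\<^sub>R b) - f x) /\<^sub>R t n) \<longlonglongrightarrow> (LINT x|nborel. dir_deriv b f x)"
  proof (rule integral_dominated_convergence[where w="\<lambda>x. C * weight x"])
    show "AE x in nborel. (\<lambda>n. (f (x + t n *\<^sub>R b) - f x) /\<^sub>R t n) \<longlonglongrightarrow> dir_deriv b f x"
    proof (rule AE_I2)
      fix x
      have "((\<lambda>h. cmod (f (x + h) - f x - frechet_derivative f (at x) h) / norm h) \<longlongrightarrow> 0) (at 0)"
        using schwartz_has_derivative[OF f, of x] by (simp add: has_derivative_at)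
      moreover have "filterlim (\<lambda>n. t n *\<^sub>R b) (at 0) sequentially"
      proof (rule filterlim_atI)
        have "(\<lambda>n. t n *\<^sub>R b) \<longlonglongrightarrow> 0 *\<^sub>R b"
          unfolding t_def by (intro tendsto_intros inverse_Suc_tendsto_0)
        then show "(\<lambda>n. t n *\<^sub>R b) \<longlonglongrightarrow> 0" by simp
        show "\<forall>\<^sub>F n in sequentially. t n *\<^sub>R b \<noteq> 0"
          using t(1) b by (auto simp: less_imp_neq[symmetric])
      qed
      ultimately have "(\<lambda>n. cmod (f (x + t n *\<^sub>R b) - f x - frechet_derivative f (at x) (t n *\<^sub>R b)) / norm (t n *\<^sub>R b)) \<longlonglongrightarrow> 0"
        by (rule filterlim_compose)
      also have "(\<lambda>n. cmod (f (x + t n *\<^sub>R b) - f x - frechet_derivative f (at x) (t n *\<^sub>R b)) / norm (t n *\<^sub>R b))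
          = (\<lambda>n. cmod ((f (x + t n *\<^sub>R b) - f x) /\<^sub>R t n - dir_deriv b f x))"
      proof
        fix n
        have "f (x + t n *\<^sub>R b) - f x - frechet_derivative f (at x) (t n *\<^sub>R b)
            = t n *\<^sub>R ((f (x + t n *\<^sub>R b) - f x) /\<^sub>R t n - dir_deriv b f x)"
          using t(1)[of n] linear_scale[OF has_derivative_linear[OF schwartz_has_derivative[OF f, of x]]]
          by (simp add: scaleR_diff_right)
        then show "cmod (f (x + t n *\<^sub>R b) - f x - frechet_derivative f (at x) (t n *\<^sub>R b)) / norm (t n *\<^sub>R b)
            = cmod ((f (x + t n *\<^sub>R b) - f x) /\<^sub>R t n - dir_deriv b f x)"
          using t(1)[of n] b by (simp only: norm_scaleR norm_Basis) simp
      qed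
      finally show "(\<lambda>n. (f (x + t n *\<^sub>R b) - f x) /\<^sub>R t n) \<longlonglongrightarrow> dir_deriv b f x"
        by (simp add: tendsto_norm_zero_iff LIM_zero_iff)
    qed
    show "integrable nborel (\<lambda>x. C * weight x)"
      by (intro integrable_mult_right integrable_weight)
    show "AE x in nborel. norm ((f (x + t n *\<^sub>R b) - f x) /\<^sub>R t n) \<le> C * weight x" for n
      using C[OF t] t(1)[of n] by (intro AE_I2) (simp add: divide_inverse_commute[symmetric] pos_divide_le_eq mult.commute)
  qed measurable
  moreover have "(LINT x|nborel. (f (x + t n *\<^sub>R b) - f x) /\<^sub>R t n) = 0" for n
  proof -
    have "integrable nborel (\<lambda>x. f (x + t n *\<^sub>R b))" "(LINT x|nborel. f (x + t n *\<^sub>R b)) = (LINT x|nborel. f x)"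
      using integrable_translate[of f "t n *\<^sub>R b"] integral_translate[of f "t n *\<^sub>R b"] schwartz_integrable[OF f]
      by (simp_all add: add.commute)
    then show ?thesis
      using schwartz_integrable[OF f] by simp
  qed
  ultimately show ?thesis
    by (simp only: LIMSEQ_const_iff)
qed

text \<open>The modulated function is again Schwartz, so the integral of its derivative vanishes;
  the product rule splits that integral into the two transforms.\<close>

lemma FT_dir_deriv:
  fixes f :: "'a::euclidean_space \<Rightarrow> complex"
  assumes f: "f \<in> schwartz" and b: "b \<in> Basis"
  shows "of_real (y \<bullet> b) * FT f y = \<i> * FT (dir_deriv b f) y"
proof -
  let ?g = "\<lambda>x. iexp (x \<bullet> y) * f x"
  have g: "?g \<in> schwartz"
    using schwartz_modulate_compose_linear[OF f linear_id, of 1 y] by simp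
  have D: "(?g has_derivative (\<lambda>v. iexp (x \<bullet> y) * frechet_derivative f (at x) v + \<i> * of_real (v \<bullet> y) * iexp (x \<bullet> y) * f x)) (at x)" for x
    by (intro has_derivative_mult has_derivative_iexp_inner schwartz_has_derivative[OF f])
  have i: "integrable nborel (\<lambda>x. f x * iexp (x \<bullet> y))" "integrable nborel (\<lambda>x. dir_deriv b f x * iexp (x \<bullet> y))"
    using schwartz_integrable[OF f] schwartz_integrable[OF schwartz_dir_deriv[OF f b]]
    by (auto intro!: integrable_mult_bounded[where B=1])
  have "0 = (LINT x|nborel. dir_deriv b ?g x)"
    by (rule integral_dir_deriv_eq_0[OF g b, symmetric])
  also have "\<dots> = (LINT x|nborel. dir_deriv b f x * iexp (x \<bullet> y) + (\<i> * of_real (b \<bullet> y)) * (f x * iexp (x \<bullet> y)))"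
    unfolding dir_deriv_eq[of ?g, OF D] by (simp add: mult_ac)
  also have "\<dots> = FT (dir_deriv b f) y + (\<i> * of_real (b \<bullet> y)) * FT f y"
    unfolding FT_def using i by (subst Bochner_Integration.integral_add) auto
  finally have "\<i> * 0 = \<i> * (FT (dir_deriv b f) y + (\<i> * of_real (b \<bullet> y)) * FT f y)"
    by simp
  then show ?thesis
    by (simp add: algebra_simps inner_commute)
qed

text \<open>The second-order remainder of the exponential is at most
  \<open>\<bar>x \<bullet> v\<bar>\<^sup>2 / 2\<close>, so the error is at most
  \<open>(norm v)\<^sup>2\<close> times a second moment of \<open>f\<close>, which is finite by
  decay.\<close>

lemma FT_has_derivative:
  fixes f :: "'a::euclidean_space \<Rightarrow> complex"
  assumes f: "f \<in> schwartz"
  shows "(FT f has_derivative (\<lambda>v. LINT x|nborel. f x * (\<i> * of_real (x \<bullet> v)) * iexp (x \<bullet> y))) (at y)"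
proof -
  have [measurable]: "f \<in> borel_measurable borel"
    using f by (rule schwartz_measurable)
  obtain C where C: "\<And>x. (1 + (norm x)\<^sup>2) ^ 1 * cmod (f x) \<le> C * weight x"
    using schwartz_weight_bound[OF f] by blast
  have m2: "integrable nborel (\<lambda>x. (1 + (norm x)\<^sup>2) * cmod (f x))"
  proof (rule Bochner_Integration.integrable_bound)
    show "integrable nborel (\<lambda>x::'a. C * weight x)"
      by (intro integrable_mult_right integrable_weight)
    show "AE x in nborel. norm ((1 + (norm x)\<^sup>2) * cmod (f x)) \<le> norm (C * weight x)"
      using C by (intro AE_I2) (simp add: order_trans[OF _ abs_ge_self])
  qed measurable
  have n1: "norm x \<le> 1 + (norm x)\<^sup>2" for x :: 'a
    using sum_squares_bound[of 1 "norm x"] norm_ge_zero[of x] unfolding power_one by linarith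
  let ?F = "\<lambda>x v. f x * (\<i> * of_real (x \<bullet> v)) * iexp (x \<bullet> y)"
  have iF: "integrable nborel (\<lambda>x. ?F x v)" for v
  proof (rule Bochner_Integration.integrable_bound[OF integrable_mult_right[OF m2, of "norm v"]])
    show "AE x in nborel. norm (?F x v) \<le> norm (norm v * ((1 + (norm x)\<^sup>2) * cmod (f x)))"
    proof (rule AE_I2)
      fix x
      have "\<bar>x \<bullet> v\<bar> \<le> norm x * norm v"
        by (rule Cauchy_Schwarz_ineq2)
      also have "\<dots> \<le> (1 + (norm x)\<^sup>2) * norm v"
        by (intro mult_right_mono n1) simp
      finally show "norm (?F x v) \<le> norm (norm v * ((1 + (norm x)\<^sup>2) * cmod (f x)))"
        using mult_left_mono[of "\<bar>x \<bullet> v\<bar>" "(1 + (norm x)\<^sup>2) * norm v" "cmod (f x)"]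
        by (simp add: norm_mult abs_mult mult_ac)
    qed
  qed measurable
  have i: "integrable nborel (\<lambda>x. f x * iexp (x \<bullet> z))" for z
    using schwartz_integrable[OF f] by (auto intro!: integrable_mult_bounded[where B=1])
  let ?K = "LINT x|nborel. (1 + (norm x)\<^sup>2) * cmod (f x)"
  have rem: "cmod (FT f (y + v) - FT f y - (LINT x|nborel. ?F x v)) \<le> (norm v)\<^sup>2 * ?K" for v
  proof -
    have "FT f (y + v) - FT f y - (LINT x|nborel. ?F x v)
        = (LINT x|nborel. f x * iexp (x \<bullet> (y + v)) - f x * iexp (x \<bullet> y) - ?F x v)"
      unfolding FT_def using i iF by simp
    also have "cmod \<dots> \<le> (LINT x|nborel. (norm v)\<^sup>2 * ((1 + (norm x)\<^sup>2) * cmod (f x)))"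
    proof (rule order_trans[OF integral_norm_bound integral_mono])
      fix x
      have "cmod (iexp (x \<bullet> v) - (1 + \<i> * of_real (x \<bullet> v))) \<le> \<bar>x \<bullet> v\<bar>\<^sup>2 / 2"
        using iexp_approx1[of "x \<bullet> v" 1] by (simp add: numeral_2_eq_2)
      also have "\<dots> \<le> (norm x * norm v)\<^sup>2"
        using power_mono[OF Cauchy_Schwarz_ineq2[of x v] abs_ge_zero, of 2] zero_le_power2[of "norm x * norm v"]
        by linarith
      also have "\<dots> \<le> (1 + (norm x)\<^sup>2) * (norm v)\<^sup>2"
        by (simp add: power_mult_distrib mult_right_mono)
      finally have K: "cmod (iexp (x \<bullet> v) - (1 + \<i> * of_real (x \<bullet> v))) \<le> (1 + (norm x)\<^sup>2) * (norm v)\<^sup>2" .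
      have "cmod (f x * iexp (x \<bullet> (y + v)) - f x * iexp (x \<bullet> y) - ?F x v)
          = cmod (f x * iexp (x \<bullet> y) * (iexp (x \<bullet> v) - (1 + \<i> * of_real (x \<bullet> v))))"
        by (simp add: inner_add_right exp_add algebra_simps)
      also have "\<dots> = cmod (f x) * cmod (iexp (x \<bullet> v) - (1 + \<i> * of_real (x \<bullet> v)))"
        by (simp add: norm_mult)
      also have "\<dots> \<le> cmod (f x) * ((1 + (norm x)\<^sup>2) * (norm v)\<^sup>2)"
        by (intro mult_left_mono K norm_ge_zero)
      finally show "cmod (f x * iexp (x \<bullet> (y + v)) - f x * iexp (x \<bullet> y) - ?F x v)
          \<le> (norm v)\<^sup>2 * ((1 + (norm x)\<^sup>2) * cmod (f x))"
        by (simp only: mult_ac)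
    next
      show "integrable nborel (\<lambda>x. cmod (f x * iexp (x \<bullet> (y + v)) - f x * iexp (x \<bullet> y) - ?F x v))"
        by (intro integrable_norm Bochner_Integration.integrable_diff i iF)
      show "integrable nborel (\<lambda>x. (norm v)\<^sup>2 * ((1 + (norm x)\<^sup>2) * cmod (f x)))"
        by (intro integrable_mult_right m2)
    qed
    finally show ?thesis by simp
  qed
  have lin: "linear (\<lambda>v. LINT x|nborel. ?F x v)"
  proof (rule linearI)
    show "(LINT x|nborel. ?F x (v + w)) = (LINT x|nborel. ?F x v) + (LINT x|nborel. ?F x w)" for v w
      using iF by (subst Bochner_Integration.integral_add[symmetric]) (auto simp: inner_add_right algebra_simps)
    show "(LINT x|nborel. ?F x (r *\<^sub>R v)) = r *\<^sub>R (LINT x|nborel. ?F x v)" for r v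
      by (subst integral_scaleR_right[symmetric]) (simp add: scaleR_conv_of_real mult_ac)
  qed
  have lim: "((\<lambda>v. norm v * ?K) \<longlongrightarrow> 0) (at 0)"
    by (intro tendsto_mult_left_zero tendsto_norm_zero tendsto_ident_at)
  have "((\<lambda>v. cmod (FT f (y + v) - FT f y - (LINT x|nborel. ?F x v)) / norm v) \<longlongrightarrow> 0) (at 0)"
  proof (rule Lim_null_comparison[OF _ lim])
    show "\<forall>\<^sub>F v in at 0. norm (cmod (FT f (y + v) - FT f y - (LINT x|nborel. ?F x v)) / norm v) \<le> norm v * ?K"
      using rem by (auto simp: eventually_at_filter power2_eq_square field_simps intro!: always_eventually)
  qed
  then show ?thesis
    unfolding has_derivative_at using lin linear_conv_bounded_linear by blast
qed

text \<open>The image of \<open>schwartz\<close> under \<open>FT\<close> serves as the coinductive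
  family: differentiating a transform multiplies \<open>f\<close> by a coordinate. Decay follows by
  induction, each power of \<open>norm y\<close> being absorbed into the derivatives of
  \<open>f\<close> through \<open>norm_le_l1\<close>.\<close>

theorem FT_schwartz:
  fixes f :: "'a::euclidean_space \<Rightarrow> complex"
  assumes "f \<in> schwartz"
  shows "FT f \<in> schwartz"
proof (rule schwartz_coinduct[where P="FT ` schwartz"])
  fix h :: "'a \<Rightarrow> complex" assume "h \<in> FT ` schwartz"
  then obtain f where h: "h = FT f" and f: "f \<in> schwartz"
    by blast
  show "h differentiable (at x)" for x
    unfolding h using FT_has_derivative[OF f] differentiable_def by blast
  show "dir_deriv b h \<in> FT ` schwartz" if "b \<in> Basis" for b
  proof -
    have "dir_deriv b h = FT (\<lambda>x. \<i> * (of_real (x \<bullet> b) * f x))"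
      unfolding h dir_deriv_eq[of "FT f", OF FT_has_derivative[OF f]] FT_def
      by (simp add: mult_ac)
    then show ?thesis
      using schwartz_mult_left[OF schwartz_mult_coordinate[OF f, of b]] by blast
  qed
  have "\<exists>C. \<forall>y. norm y ^ k * cmod (FT f y) \<le> C" for k
    using f
  proof (induction k arbitrary: f)
    case 0
    then show ?case
      using cmod_FT_le[OF schwartz_integrable] by auto
  next
    case (Suc k)
    have "\<forall>b\<in>Basis. \<exists>C. \<forall>y. norm y ^ k * cmod (FT (dir_deriv b f) y) \<le> C"
      using Suc.IH[OF schwartz_dir_deriv[OF Suc.prems]] by blast
    then obtain C where C: "\<And>b y. b \<in> Basis \<Longrightarrow> norm y ^ k * cmod (FT (dir_deriv b f) y) \<le> C b"
      by metis
    have "norm y ^ Suc k * cmod (FT f y) \<le> (\<Sum>b\<in>Basis. C b)" for y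
    proof -
      have "norm y ^ Suc k * cmod (FT f y) = (norm y ^ k * cmod (FT f y)) * norm y"
        by simp
      also have "\<dots> \<le> (norm y ^ k * cmod (FT f y)) * (\<Sum>b\<in>Basis. \<bar>y \<bullet> b\<bar>)"
        by (intro mult_left_mono norm_le_l1) simp
      also have "\<dots> = (\<Sum>b\<in>Basis. norm y ^ k * cmod (of_real (y \<bullet> b) * FT f y))"
        by (simp add: sum_distrib_left norm_mult mult_ac)
      also have "\<dots> = (\<Sum>b\<in>Basis. norm y ^ k * cmod (FT (dir_deriv b f) y))"
        by (intro sum.cong refl) (simp only: FT_dir_deriv[OF Suc.prems] norm_mult norm_ii mult_1)
      also have "\<dots> \<le> (\<Sum>b\<in>Basis. C b)"
        by (intro sum_mono C)
      finally show ?thesis .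
    qed
    then show ?case by blast
  qed
  then show "\<exists>C. \<forall>x. norm x ^ k * cmod (h x) \<le> C" for k
    unfolding h .
qed (use assms in blast)

lemma FT_inversion_schwartz:
  assumes "f \<in> schwartz"
  shows "(LINT y|nborel. FT f y * iexp (- (x \<bullet> y))) = f x"
proof -
  obtain C where "\<And>x. (1 + (norm x)\<^sup>2) ^ 0 * cmod (f x) \<le> C"
    using schwartz_decay[OF assms] by blast
  then show ?thesis
    using schwartz_integrable[OF assms] schwartz_continuous_on[OF assms] schwartz_integrable[OF FT_schwartz[OF assms]]
    by (intro FT_inversion) auto
qed

section \<open>Tempered functions\<close>

lemma schwartz_seminorm_bound:
  assumes "f \<in> schwartz"
  shows "norm x ^ k * cmod (f x) \<le> schwartz_seminorm k [] f"
proof -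
  have "bdd_above (range (\<lambda>x. norm x ^ k * cmod (f x)))"
    using schwartz_bounded[OF assms, of k] by (auto simp: bdd_above_def)
  then show ?thesis
    unfolding schwartz_seminorm_def by (intro cSUP_upper2[where x=x]) auto
qed

lemma schwartz_seminorm_nonneg:
  fixes f :: "'a::euclidean_space \<Rightarrow> complex"
  assumes "f \<in> schwartz" "set bs \<subseteq> Basis"
  shows "0 \<le> schwartz_seminorm k bs f"
proof -
  have "bdd_above (range (\<lambda>x. norm x ^ k * cmod (iter_deriv bs f x)))"
    using assms(1)[unfolded schwartz_def mem_Collect_eq, THEN spec[of _ bs]] assms(2) by simp
  then show ?thesis
    unfolding schwartz_seminorm_def by (intro cSUP_upper2[where x=0]) auto
qed

lemma schwartz_seminorm_le_sum:
  fixes f :: "'a::euclidean_space \<Rightarrow> complex"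
  assumes f: "f \<in> schwartz" and k: "k \<le> N"
  shows "schwartz_seminorm k [] f \<le>
    (\<Sum>k\<le>N. \<Sum>bs | set bs \<subseteq> Basis \<and> length bs \<le> N. schwartz_seminorm k bs f)"
proof -
  have fin: "finite {bs :: 'a list. set bs \<subseteq> Basis \<and> length bs \<le> N}"
    by (rule finite_lists_length_le) simp
  have "schwartz_seminorm k [] f \<le> (\<Sum>bs | set bs \<subseteq> Basis \<and> length bs \<le> N. schwartz_seminorm k bs f)"
    using fin by (intro member_le_sum) (auto intro: schwartz_seminorm_nonneg[OF f])
  also have "\<dots> \<le> (\<Sum>k\<le>N. \<Sum>bs | set bs \<subseteq> Basis \<and> length bs \<le> N. schwartz_seminorm k bs f)"
    using k by (intro member_le_sum[where f="\<lambda>k. \<Sum>bs | set bs \<subseteq> Basis \<and> length bs \<le> N. schwartz_seminorm k bs f"])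
      (auto intro!: sum_nonneg schwartz_seminorm_nonneg[OF f])
  finally show ?thesis .
qed

lemma one_plus_square_power_le: "(1 + r\<^sup>2) ^ j \<le> 2 ^ j * (1 + r ^ (2 * j))" for r :: real
proof (cases "\<bar>r\<bar> \<le> 1")
  case True
  then have "r\<^sup>2 \<le> 1"
    by (simp add: abs_square_le_1)
  then have "(1 + r\<^sup>2) ^ j \<le> 2 ^ j"
    by (intro power_mono) auto
  also have "\<dots> \<le> 2 ^ j * (1 + r ^ (2 * j))"
    by (simp add: power_mult)
  finally show ?thesis .
next
  case False
  then have "1 \<le> r\<^sup>2"
    by (simp add: abs_square_le_1[symmetric] abs_square_less_1 not_le less_imp_le flip: not_less)
  then have "(1 + r\<^sup>2) ^ j \<le> (2 * r\<^sup>2) ^ j"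
    by (intro power_mono) auto
  also have "\<dots> \<le> 2 ^ j * (1 + r ^ (2 * j))"
    by (simp add: power_mult_distrib power_mult)
  finally show ?thesis .
qed

lemma borel_measurable_lebesgue: "f \<in> borel_measurable borel \<Longrightarrow> f \<in> borel_measurable lebesgue"
  by (rule measurable_completion) simp

text \<open>Polynomial growth is paid for by Schwartz decay. The functional is bounded using
  derivative-free seminorms only, each of which is a term of the sum required by
  \<open>tempered_dist\<close>.\<close>

lemma tempered_function_polynomial_growth:
  fixes g :: "'a::euclidean_space \<Rightarrow> complex"
  assumes g [measurable]: "g \<in> borel_measurable lebesgue"
    and bound: "AE x in lebesgue. cmod (g x) \<le> C * (1 + (norm x)\<^sup>2) ^ j" and C: "C \<ge> 0"
  shows "tempered_function g"
proof -
  have loc: "locally_integrable g"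
    unfolding locally_integrable_def set_integrable_def
  proof (intro allI impI)
    fix K :: "'a set" assume K: "compact K"
    then obtain R where R: "\<And>x. x \<in> K \<Longrightarrow> norm x \<le> R"
      using compact_imp_bounded bounded_iff by metis
    have Kl [measurable]: "K \<in> sets lebesgue"
      using K by (simp add: lmeasurable_compact fmeasurableD)
    show "integrable lebesgue (\<lambda>x. indicat_real K x *\<^sub>R g x)"
    proof (rule Bochner_Integration.integrable_bound)
      show "integrable lebesgue (\<lambda>x. (C * (1 + R\<^sup>2) ^ j) * indicat_real K x)"
        using lmeasurable_compact[OF K] by (intro integrable_mult_right) (simp add: fmeasurable_def)
      show "AE x in lebesgue. norm (indicat_real K x *\<^sub>R g x) \<le> norm ((C * (1 + R\<^sup>2) ^ j) * indicat_real K x)"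
        using bound
      proof eventually_elim
        fix x assume x: "cmod (g x) \<le> C * (1 + (norm x)\<^sup>2) ^ j"
        show "norm (indicat_real K x *\<^sub>R g x) \<le> norm ((C * (1 + R\<^sup>2) ^ j) * indicat_real K x)"
        proof (cases "x \<in> K")
          case True
          have "C * (1 + (norm x)\<^sup>2) ^ j \<le> C * (1 + R\<^sup>2) ^ j"
            using R[OF True] C by (intro mult_left_mono power_mono add_left_mono) auto
          with x True C show ?thesis by simp
        qed simp
      qed
    qed measurable
  qed
  have gf: "integrable mu (\<lambda>x. g x * f x) \<and>
      cmod (LINT x|mu. g x * f x) \<le> C * (K * (LINT x|(nborel :: 'a measure). weight x))"
    if f: "f \<in> schwartz" and K: "\<And>x. (1 + (norm x)\<^sup>2) ^ (j + DIM('a)) * cmod (f x) \<le> K" for f K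
  proof -
    have [measurable]: "f \<in> borel_measurable lebesgue"
      by (intro borel_measurable_lebesgue schwartz_measurable f)
    have iw: "integrable mu (\<lambda>x::'a. C * (K * weight x))"
      by (intro integrable_mult_right) (simp add: integrable_mu_iff integrable_weight)
    have le: "AE x in mu. cmod (g x * f x) \<le> C * (K * weight x)"
      using bound unfolding AE_mu_iff
    proof eventually_elim
      fix x assume x: "cmod (g x) \<le> C * (1 + (norm x)\<^sup>2) ^ j"
      have "cmod (g x * f x) \<le> C * (1 + (norm x)\<^sup>2) ^ j * cmod (f x)"
        using x by (simp add: norm_mult mult_right_mono)
      also have "\<dots> = C * ((1 + (norm x)\<^sup>2) ^ (j + DIM('a)) * cmod (f x) * weight x)"
        by (simp add: weight_def power_add add_nonneg_eq_0_iff)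
      also have "\<dots> \<le> C * (K * weight x)"
        using K[of x] C by (intro mult_left_mono mult_right_mono) auto
      finally show "cmod (g x * f x) \<le> C * (K * weight x)" .
    qed
    have i: "integrable mu (\<lambda>x. g x * f x)"
      using le by (intro Bochner_Integration.integrable_bound[OF iw]) (auto elim!: eventually_mono)
    have "cmod (LINT x|mu. g x * f x) \<le> (LINT x|mu. cmod (g x * f x))"
      by (rule integral_norm_bound)
    also have "\<dots> \<le> (LINT x|(mu :: 'a measure). C * (K * weight x))"
      by (rule integral_mono_AE[OF integrable_norm[OF i] iw le])
    also have "\<dots> = C * (K * (LINT x|(nborel :: 'a measure). weight x))"
      by (simp add: integral_mu)
    finally show ?thesis using i by simp
  qed
  have int: "integrable mu (\<lambda>x. g x * f x)" if "f \<in> schwartz" for f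
    using schwartz_decay[OF that, of "j + DIM('a)"] gf[OF that] by metis
  \<comment> \<open>Of these \<open>J\<close> powers, \<open>j\<close> absorb the growth of
    \<open>g\<close> and \<open>DIM('a)\<close> become \<open>weight\<close>. Below,
    \<open>2 ^ J * 2\<close> arises from \<open>one_plus_square_power_le\<close> and the seminorms
    of weight orders 0 and \<open>2 * J\<close>.\<close>
  define J where "J = j + DIM('a)"
  define W where "W = (LINT x|(nborel :: 'a measure). weight x)"
  have W: "W \<ge> 0"
    unfolding W_def by simp
  have "cmod (fun_dist g f) \<le> (C * (2 ^ J * 2 * W)) *
      (\<Sum>k\<le>2 * J. \<Sum>bs | set bs \<subseteq> Basis \<and> length bs \<le> 2 * J. schwartz_seminorm k bs f)"
    (is "_ \<le> _ * ?S") if f: "f \<in> schwartz" for f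
  proof -
    have "(1 + (norm x)\<^sup>2) ^ (j + DIM('a)) * cmod (f x) \<le> 2 ^ J * (2 * ?S)" for x
    proof -
      have "(1 + (norm x)\<^sup>2) ^ J * cmod (f x) \<le> 2 ^ J * (1 + norm x ^ (2 * J)) * cmod (f x)"
        by (intro mult_right_mono one_plus_square_power_le) simp
      also have "\<dots> = 2 ^ J * (norm x ^ 0 * cmod (f x) + norm x ^ (2 * J) * cmod (f x))"
        by (simp add: algebra_simps)
      also have "\<dots> \<le> 2 ^ J * (?S + ?S)"
        by (intro mult_left_mono add_mono order_trans[OF schwartz_seminorm_bound[OF f] schwartz_seminorm_le_sum[OF f]]) auto
      finally show ?thesis by (simp add: J_def)
    qed
    from gf[OF f this] show ?thesis
      by (simp add: fun_dist_def W_def mult_ac)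
  qed
  then have "tempered_dist (fun_dist g)"
    unfolding tempered_dist_def using int
    by (intro conjI ballI allI exI[of _ "C * (2 ^ J * 2 * W)"] exI[of _ "2 * J"])
      (auto simp: fun_dist_def distrib_left mult.left_commute[of _ z for z])
  then show ?thesis
    unfolding tempered_function_def using loc int by blast
qed

text \<open>The function is the pointwise limit of its restrictions to growing balls, each of which
  is integrable.\<close>

lemma locally_integrable_measurable:
  fixes g :: "'a::euclidean_space \<Rightarrow> complex"
  assumes "locally_integrable g"
  shows "g \<in> borel_measurable lebesgue"
proof (rule borel_measurable_LIMSEQ_metric)
  show "(\<lambda>x. indicat_real (cball 0 (real n)) x *\<^sub>R g x) \<in> borel_measurable lebesgue" for n
    using assms compact_cball unfolding locally_integrable_def set_integrable_def
    by (intro borel_measurable_integrable) blast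
  show "(\<lambda>n. indicat_real (cball 0 (real n)) x *\<^sub>R g x) \<longlonglongrightarrow> g x" for x
  proof (rule tendsto_eventually)
    obtain N where "norm x \<le> real N"
      using real_arch_simple by blast
    then show "\<forall>\<^sub>F n in sequentially. indicat_real (cball 0 (real n)) x *\<^sub>R g x = g x"
      by (intro eventually_sequentiallyI[of N]) (auto simp: indicator_def)
  qed
qed

text \<open>Real and imaginary parts are changed separately on null sets; the result is accessible
  to Fubini over \<open>nborel\<close>.\<close>

lemma lebesgue_measurable_borel_representative:
  fixes g :: "'a::euclidean_space \<Rightarrow> complex"
  assumes "g \<in> borel_measurable lebesgue"
  obtains h where "h \<in> borel_measurable borel" "AE x in lebesgue. g x = h x"
proof -
  have "(\<lambda>x. Re (g x)) \<in> borel_measurable lebesgue" "(\<lambda>x. Im (g x)) \<in> borel_measurable lebesgue"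
    using assms by auto
  then obtain a b where a: "a \<in> borel_measurable lborel" "AE x in lborel. Re (g x) = a x"
    and b: "b \<in> borel_measurable lborel" "AE x in lborel. Im (g x) = b x"
    using completion_ex_borel_measurable_real by metis
  have "AE x in lborel. g x = Complex (a x) (b x)"
    using a(2) b(2) by eventually_elim (simp add: complex_eq_iff)
  then have "AE x in lebesgue. g x = Complex (a x) (b x)"
    by (rule AE_completion)
  moreover have "(\<lambda>x. Complex (a x) (b x)) \<in> borel_measurable borel"
    using a(1) b(1) unfolding Complex_eq by simp
  ultimately show ?thesis by (rule that[rotated])
qed

section \<open>The transform on the plane\<close>

lemma Re_mult_eq_inner: "Re (c * t) = t \<bullet> cnj c"
  by (simp add: inner_complex_def)

lemma fourier_eq_FT:
  assumes [measurable]: "f \<in> borel_measurable borel"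
  shows "fourier f = (\<lambda>c. FT f (cnj c))"
  unfolding fourier_def[abs_def] FT_def Re_mult_eq_inner
  by (intro ext integral_mu) measurable

lemma linear_cnj: "linear cnj"
  using bounded_linear_cnj bounded_linear.linear by blast

lemma schwartz_compose_isometry:
  assumes "f \<in> schwartz" "linear L" "\<And>y. norm (L y) = norm y"
  shows "(\<lambda>y. f (L y)) \<in> schwartz"
  using schwartz_modulate_compose_linear[OF assms(1,2), of 1 0] assms(3) by simp

lemma fourier_schwartz: "f \<in> schwartz \<Longrightarrow> fourier f \<in> schwartz"
  using schwartz_compose_isometry[OF FT_schwartz linear_cnj]
  by (simp add: fourier_eq_FT[OF schwartz_measurable])

text \<open>Both applications of \<open>fourier\<close> carry the same sign in the exponent, so the
  composition is a reflection. The substitution by \<open>cnj\<close>, an isometry, reduces it to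
  \<open>FT_inversion\<close> at \<open>- t\<close>.\<close>

lemma fourier_inversion:
  fixes f :: "complex \<Rightarrow> complex"
  assumes f: "integrable nborel f" and cont: "continuous_on UNIV f"
    and B: "\<And>x. cmod (f x) \<le> B" and Ff: "integrable nborel (FT f)"
  shows "fourier (fourier f) t = f (- t)"
proof -
  have [measurable]: "f \<in> borel_measurable borel"
    using f by auto
  have "fourier (fourier f) t = (LINT c|nborel. FT f (cnj c) * iexp (c \<bullet> cnj t))"
    unfolding fourier_eq_FT[OF \<open>f \<in> borel_measurable borel\<close>]
    by (subst fourier_eq_FT) (auto simp: FT_def[of "\<lambda>c. FT f (cnj c)"])
  also have "\<dots> = (LINT c|nborel. FT f (0 + cnj c) * iexp (- ((- t) \<bullet> (0 + cnj c))))"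
    by (simp add: inner_complex_def mult.commute)
  also have "\<dots> = (LINT y|nborel. FT f y * iexp (- ((- t) \<bullet> y))) /\<^sub>R 1 ^ DIM(complex)"
    by (rule integral_affine_conformal[OF linear_cnj]) auto
  also have "\<dots> = f (- t)"
    using FT_inversion[OF f cont B Ff, of "- t"] by simp
  finally show ?thesis .
qed

lemma fourier_inversion_schwartz: "f \<in> schwartz \<Longrightarrow> fourier (fourier f) t = f (- t)"
  using schwartz_decay[of f 0]
  by (metis fourier_inversion schwartz_integrable schwartz_continuous_on FT_schwartz power_0 mult_1)

text \<open>Fubini for a kernel symmetric in \<open>c\<close> and \<open>t\<close>. It later moves
  the transform from a merely integrable symbol onto a test function.\<close>

lemma fourier_multiplication:
  assumes k: "integrable nborel k" and g: "integrable nborel g"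
  shows "(LINT t|nborel. fourier k t * g t) = (LINT c|nborel. k c * fourier g c)"
proof -
  have [measurable]: "k \<in> borel_measurable borel" "g \<in> borel_measurable borel"
    using k g by auto
  let ?h = "\<lambda>c t. k c * iexp (t \<bullet> cnj c) * g t"
  have int: "integrable (nborel \<Otimes>\<^sub>M nborel) (\<lambda>(c, t). ?h c t)"
  proof (rule nborel_pair.Fubini_integrable)
    show "integrable nborel (\<lambda>c. LINT t|nborel. norm (case (c, t) of (c, t) \<Rightarrow> ?h c t))"
      using k by (simp add: norm_mult)
    show "AE c in nborel. integrable nborel (\<lambda>t. case (c, t) of (c, t) \<Rightarrow> ?h c t)"
      using integrable_mult_bounded[OF g, of "\<lambda>t. k c * iexp (t \<bullet> cnj c)" "cmod (k c)" for c]
      by (auto simp: norm_mult mult_ac)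
  qed measurable
  have "(LINT t|nborel. fourier k t * g t) = (LINT t|nborel. LINT c|nborel. ?h c t)"
    by (simp add: fourier_eq_FT FT_def inner_complex_def mult.commute)
  also have "\<dots> = (LINT c|nborel. LINT t|nborel. ?h c t)"
    by (rule nborel_pair.Fubini_integral[OF int])
  also have "\<dots> = (LINT c|nborel. k c * fourier g c)"
    by (simp add: fourier_eq_FT FT_def mult_ac flip: integral_mult_right_zero)
  finally show ?thesis .
qed

lemma fourier_reflect:
  assumes [measurable]: "f \<in> borel_measurable borel"
  shows "fourier (\<lambda>c. f (- c)) t = fourier f (- t)"
proof -
  have "fourier (\<lambda>c. f (- c)) t = (LINT c|nborel. f (0 + - c) * iexp ((0 + - c) \<bullet> cnj (- t)))"
    by (subst fourier_eq_FT) (auto simp: FT_def)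
  also have "\<dots> = (LINT c|nborel. f c * iexp (c \<bullet> cnj (- t))) /\<^sub>R 1 ^ DIM(complex)"
    by (rule integral_affine_conformal[where f="\<lambda>c. f c * iexp (c \<bullet> cnj (- t))"])
      (auto intro: linear_uminus)
  finally show ?thesis
    by (simp add: fourier_eq_FT FT_def)
qed

text \<open>Every Schwartz function is the transform of a Schwartz function; hence knowing
  \<open>fourier_dist u\<close> determines \<open>u\<close> on all test functions.\<close>

lemma schwartz_eq_fourier:
  assumes "f \<in> schwartz"
  shows "(\<lambda>c. fourier f (- c)) \<in> schwartz" and "fourier (\<lambda>c. fourier f (- c)) = f"
proof -
  show "(\<lambda>c. fourier f (- c)) \<in> schwartz"
    by (intro schwartz_compose_isometry[OF fourier_schwartz[OF assms]]) (auto intro: linear_uminus)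
  show "fourier (\<lambda>c. fourier f (- c)) = f"
    using schwartz_measurable[OF fourier_schwartz[OF assms]] fourier_inversion_schwartz[OF assms]
    by (simp add: fourier_reflect fun_eq_iff)
qed

section \<open>The generalized Radon transform\<close>

text \<open>
  With \<open>twist c a' = cnj (c a')\<close> one has \<open>Re (c (a' x')) = x' \<bullet> twist c a'\<close>, so the transform of
  \<open>f\<close> in the sense of \<^const>\<open>FT\<close> at \<open>(twist c a', - cnj c)\<close> is the complex transform of \<open>f\<close>
  at \<open>(c a', - c)\<close>.
\<close>

definition twist :: "complex \<Rightarrow> complex ^ 'm \<Rightarrow> complex ^ 'm::finite" where
  "twist c a = (\<chi> i. cnj (c * a $ i))"

lemma inner_twist: "x \<bullet> twist c a = Re (c * bilin a x)"
  by (simp only: twist_def bilin_def inner_vec_def vec_lambda_beta Re_mult_eq_inner[symmetric]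
      sum_distrib_left Re_sum mult.assoc)

lemma linear_twist: "linear (twist c)"
  by (rule linearI) (simp_all add: twist_def vec_eq_iff algebra_simps)

lemma linear_twist_left: "linear (\<lambda>c. twist c a)"
  by (rule linearI) (simp_all add: twist_def vec_eq_iff algebra_simps)

text \<open>For nonzero \<open>c\<close> the map is a similarity of ratio \<open>cmod c\<close>, so
  \<open>nn_integral_conformal\<close> yields the Jacobian \<open>cmod c ^ (2 * CARD('m))\<close> on
  a space of real dimension \<open>2 * CARD('m)\<close>.\<close>

lemma norm_twist: "norm (twist c a) = cmod c * norm a"
  by (simp add: norm_vec_def L2_set_def twist_def norm_mult power_mult_distrib real_sqrt_mult
      flip: sum_distrib_left)

lemma continuous_on_twist [continuous_intros]:
  "continuous_on S f \<Longrightarrow> continuous_on S g \<Longrightarrow> continuous_on S (\<lambda>x. twist (f x) (g x))"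
  unfolding twist_def by (intro continuous_intros)

lemma borel_measurable_twist [measurable]:
  "(\<lambda>p. twist (snd p) (fst p)) \<in> borel_measurable (borel \<Otimes>\<^sub>M borel)"
  "(\<lambda>p. twist (fst p) (snd p)) \<in> borel_measurable (borel \<Otimes>\<^sub>M borel)"
  unfolding borel_prod by (intro borel_measurable_continuous_onI continuous_intros)+

text \<open>The nonlinear substitution \<open>(a, c)\<close> to \<open>(twist c a, - cnj c)\<close>
  is triangular: an isometry in \<open>c\<close>, and for each nonzero \<open>c\<close> a similarity
  in \<open>a\<close>. Fubini joins the two.\<close>

lemma
  fixes Q :: "(complex ^ 'm::finite) \<times> complex \<Rightarrow> 'b::{banach,second_countable_topology}"
  assumes Q: "integrable nborel Q"
  shows integrable_twist: "integrable nborel (\<lambda>(a, c). cmod c ^ (2 * CARD('m)) *\<^sub>R Q (twist c a, - cnj c))"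
    and integral_twist: "(LINT c|nborel. LINT a|nborel. cmod c ^ (2 * CARD('m)) *\<^sub>R Q (twist c a, - cnj c))
      = (LINT y|nborel. Q y)"
proof -
  have [measurable]: "Q \<in> borel_measurable borel"
    using Q by auto
  then have [measurable]: "Q \<in> borel_measurable (borel \<Otimes>\<^sub>M borel)"
    unfolding borel_prod .
  \<comment> \<open>The sign and the conjugation in the second slot form an isometry and are split
    off, so the remaining substitution changes only \<open>a\<close>.\<close>
  define R :: "(complex ^ 'm) \<times> complex \<Rightarrow> (complex ^ 'm) \<times> complex" where "R = (\<lambda>(a, c). (a, - cnj c))"
  have R: "linear R" "norm (R y) = 1 * norm y" for y
    unfolding R_def by (auto intro!: linearI simp: norm_Pair split: prod.splits)
  define Q' where "Q' y = Q (R y)" for y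
  have iQ': "integrable nborel Q'" and eqQ': "(LINT y|nborel. Q' y) = (LINT y|nborel. Q y)"
    using integrable_affine_conformal[OF R, of Q 0] integral_affine_conformal[OF R, of Q 0] Q
    by (simp_all add: Q'_def[abs_def])
  then have iQ'p: "integrable (nborel \<Otimes>\<^sub>M nborel) Q'"
    by (simp add: nborel_prod)
  have [measurable]: "Q' \<in> borel_measurable (borel \<Otimes>\<^sub>M borel)"
    using iQ'p by (auto cong: measurable_cong_sets)
  let ?H = "\<lambda>c a. cmod c ^ (2 * CARD('m)) *\<^sub>R Q' (twist c a, c)"
  \<comment> \<open>At \<open>c = 0\<close> the map \<open>twist c\<close> collapses to 0; this one
    slice is null.\<close>
  have c0: "AE c in nborel. c \<noteq> (0 :: complex)"
    by (simp add: AE_nborel_iff AE_lborel_singleton)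
  have sub: "integrable nborel (\<lambda>a. g (twist c a)) \<longleftrightarrow> integrable nborel g"
    "cmod c ^ (2 * CARD('m)) *\<^sub>R (LINT a|nborel. g (twist c a)) = (LINT a|nborel. g a)"
    if "c \<noteq> 0" and g: "g \<in> borel_measurable borel"
    for c and g :: "complex ^ 'm \<Rightarrow> 'c::{banach,second_countable_topology}"
    using integrable_affine_conformal[OF linear_twist norm_twist _ g, of c 0]
      integral_affine_conformal[OF linear_twist norm_twist _ g, of c 0] that(1)
    by (simp_all add: mult.commute)
  have sect: "(\<lambda>a. Q' (a, c)) \<in> borel_measurable borel" for c
    by measurable
  \<comment> \<open>\<open>c\<close> becomes the outer variable because the substitution in
    \<open>a\<close> takes place at fixed \<open>c\<close>.\<close>
  have iswap: "integrable (nborel \<Otimes>\<^sub>M nborel) (\<lambda>(c, a). Q' (a, c))"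
    using nborel_pair.integrable_product_swap[OF iQ'p] .
  have swapped: "integrable (nborel \<Otimes>\<^sub>M nborel) (\<lambda>(c, a). ?H c a)"
  proof (rule nborel_pair.Fubini_integrable)
    show "(\<lambda>(c, a). ?H c a) \<in> borel_measurable (nborel \<Otimes>\<^sub>M nborel)"
      by measurable
    have "integrable nborel (\<lambda>c. LINT a|nborel. norm (Q' (a, c)))"
      using nborel_pair.integrable_fst'[OF integrable_norm[OF iswap]] by simp
    then show "integrable nborel (\<lambda>c. LINT a|nborel. norm (case (c, a) of (c, a) \<Rightarrow> ?H c a))"
    proof (rule integrable_cong_AE_imp)
      show "AE c in nborel. (LINT a|nborel. norm (Q' (a, c))) = (LINT a|nborel. norm (case (c, a) of (c, a) \<Rightarrow> ?H c a))"
        using c0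
      proof eventually_elim
        fix c :: complex assume "c \<noteq> 0"
        then show "(LINT a|nborel. norm (Q' (a, c))) = (LINT a|nborel. norm (case (c, a) of (c, a) \<Rightarrow> ?H c a))"
          using sub(2)[of c "\<lambda>a. norm (Q' (a, c))"] sect by simp
      qed
    qed measurable
    show "AE c in nborel. integrable nborel (\<lambda>a. case (c, a) of (c, a) \<Rightarrow> ?H c a)"
      using c0 nborel_pair.AE_integrable_fst'[OF iswap]
    proof eventually_elim
      fix c assume "c \<noteq> 0" and "integrable nborel (\<lambda>a. case (c, a) of (c, a) \<Rightarrow> Q' (a, c))"
      then show "integrable nborel (\<lambda>a. case (c, a) of (c, a) \<Rightarrow> ?H c a)"
        using sub(1)[of c "\<lambda>a. Q' (a, c)"] sect by simp
    qed
  qed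
  have H: "?H c a = cmod c ^ (2 * CARD('m)) *\<^sub>R Q (twist c a, - cnj c)" for c a
    by (simp add: Q'_def R_def)
  show "integrable nborel (\<lambda>(a, c). cmod c ^ (2 * CARD('m)) *\<^sub>R Q (twist c a, - cnj c))"
    using nborel_pair.integrable_product_swap[OF swapped] by (simp add: nborel_prod H)
  have "(LINT c|nborel. LINT a|nborel. ?H c a) = (LINT c|nborel. LINT a|nborel. Q' (a, c))"
  proof (rule integral_cong_AE)
    show "AE c in nborel. (LINT a|nborel. ?H c a) = (LINT a|nborel. Q' (a, c))"
      using c0
    proof eventually_elim
      fix c :: complex assume "c \<noteq> 0"
      then show "(LINT a|nborel. ?H c a) = (LINT a|nborel. Q' (a, c))"
        using sub(2)[of c "\<lambda>a. Q' (a, c)"] sect by simp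
    qed
  qed measurable
  also have "\<dots> = (LINT y|nborel. Q' y)"
    using nborel_pair.integral_snd[of "\<lambda>a c. Q' (a, c)"] iQ'p by (simp add: nborel_prod)
  finally show "(LINT c|nborel. LINT a|nborel. cmod c ^ (2 * CARD('m)) *\<^sub>R Q (twist c a, - cnj c))
      = (LINT y|nborel. Q y)"
    by (simp add: H eqQ')
qed

text \<open>The norm of a pair dominates the norm of each component, so the surplus powers can be
  spent on whichever component is to be integrated, uniformly in the other one.\<close>

lemma schwartz_section_bound:
  fixes f :: "'a::euclidean_space \<times> 'b::euclidean_space \<Rightarrow> complex"
  assumes "f \<in> schwartz"
  obtains C where "C \<ge> 0" "\<And>x z. (1 + (norm (x, z))\<^sup>2) ^ j * cmod (f (x, z)) \<le> C * weight x"
    "\<And>x z. (1 + (norm (x, z))\<^sup>2) ^ j * cmod (f (x, z)) \<le> C * weight z"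
proof -
  let ?J = "j + (DIM('a) + DIM('b))"
  obtain C where C: "C \<ge> 0" "\<And>y. (1 + (norm y)\<^sup>2) ^ ?J * cmod (f y) \<le> C"
    using schwartz_decay[OF assms] by blast
  have *: "(1 + (norm y)\<^sup>2) ^ j * cmod (f y) \<le> C / (1 + r) ^ d"
    if "0 \<le> r" "r \<le> (norm y)\<^sup>2" "d \<le> DIM('a) + DIM('b)" for r y d
  proof -
    have "(1 + r) ^ d \<le> (1 + (norm y)\<^sup>2) ^ d"
      using that by (intro power_mono) auto
    also have "\<dots> \<le> (1 + (norm y)\<^sup>2) ^ (DIM('a) + DIM('b))"
      using that by (intro power_increasing) auto
    finally have "(1 + (norm y)\<^sup>2) ^ j * cmod (f y) * (1 + r) ^ d
        \<le> (1 + (norm y)\<^sup>2) ^ j * cmod (f y) * (1 + (norm y)\<^sup>2) ^ (DIM('a) + DIM('b))"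
      by (intro mult_left_mono) auto
    also have "\<dots> = (1 + (norm y)\<^sup>2) ^ ?J * cmod (f y)"
      by (simp only: power_add mult_ac)
    also note C(2)
    finally show ?thesis
      using that by (simp add: pos_le_divide_eq add_pos_nonneg)
  qed
  show ?thesis
  proof
    show "C \<ge> 0" by fact
    show "(1 + (norm (x, z))\<^sup>2) ^ j * cmod (f (x, z)) \<le> C * weight x" for x z
      using *[of "(norm x)\<^sup>2" "(x, z)" "DIM('a)"] by (simp add: weight_def norm_Pair)
    show "(1 + (norm (x, z))\<^sup>2) ^ j * cmod (f (x, z)) \<le> C * weight z" for x z
      using *[of "(norm z)\<^sup>2" "(x, z)" "DIM('b)"] by (simp add: weight_def norm_Pair)
  qed
qed

text \<open>As \<open>c\<close> varies, this is the restriction of the complex Fourier transform of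
  \<open>f\<close> to the complex line spanned by \<open>(a, - 1)\<close>.\<close>

definition slice_transform ::
  "((complex ^ 'm::finite) \<times> complex \<Rightarrow> complex) \<Rightarrow> complex ^ 'm \<Rightarrow> complex \<Rightarrow> complex" where
  "slice_transform f a c = FT f (twist c a, - cnj c)"

lemma slice_transform_schwartz:
  fixes f :: "(complex ^ 'm::finite) \<times> complex \<Rightarrow> complex"
  assumes f: "f \<in> schwartz"
  shows "(\<lambda>c. slice_transform f a c * iexp (Re (c * t))) \<in> schwartz"
proof -
  let ?L = "\<lambda>c. (twist c a, - cnj c)"
  have "linear ?L"
    by (auto intro!: linearI simp: linear_add[OF linear_twist_left] linear_scale[OF linear_twist_left])
  moreover have "norm c \<le> 1 * norm (?L c)" for c
    using norm_snd_le[of "- cnj c" "twist c a"] by simp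
  ultimately have "(\<lambda>c. iexp (c \<bullet> cnj t) * FT f (?L c)) \<in> schwartz"
    by (rule schwartz_modulate_compose_linear[OF FT_schwartz[OF f]])
  then show ?thesis
    by (simp add: slice_transform_def inner_complex_def mult.commute)
qed

text \<open>
  The projection slice theorem, with the Fourier inversion formula on the plane applied to it.
\<close>

lemma slice_integral_eq_fourier:
  fixes f :: "(complex ^ 'm::finite) \<times> complex \<Rightarrow> complex"
  assumes f: "f \<in> schwartz"
  shows "(\<lambda>p. LINT x|mu. f (x, bilin a x + (p + t))) = fourier (\<lambda>c. slice_transform f a c * iexp (Re (c * t)))"
proof -
  define q where "q c = slice_transform f a c * iexp (Re (c * t))" for c
  have q: "q \<in> schwartz"
    unfolding q_def by (rule slice_transform_schwartz[OF f])
  have cb: "continuous_on S (bilin a)" for S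
    unfolding bilin_def[abs_def] by (intro continuous_intros)
  have [measurable]: "bilin a \<in> borel_measurable borel"
    by (rule borel_measurable_continuous_onI[OF cb])
  have fm [measurable]: "f \<in> borel_measurable (borel \<Otimes>\<^sub>M borel)"
    unfolding borel_prod by (rule schwartz_measurable[OF f])
  have fp: "integrable (nborel \<Otimes>\<^sub>M nborel) f"
    unfolding nborel_prod by (rule schwartz_integrable[OF f])
  obtain C where C: "C \<ge> 0" "\<And>x z. cmod (f (x, z)) \<le> C * weight x" "\<And>x z. cmod (f (x, z)) \<le> C * weight z"
    using schwartz_section_bound[OF f, of 0] by auto
  have fx: "integrable nborel (\<lambda>p. f (x, p))" for x
    using C(3) by (intro integrable_weight_bound[where C=C]) auto
  define g where "g p = (LINT x|nborel. f (x, bilin a x + (p + t)))" for p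
  let ?F = "\<lambda>x p. f (x, bilin a x + (p + t))"
  have tr: "integrable nborel (\<lambda>p. ?F x p)"
    "(LINT p|nborel. h (f (x, bilin a x + (p + t)))) = (LINT p|nborel. h (f (x, p)))"
    if "h \<in> borel_measurable borel" for x and h :: "complex \<Rightarrow> real"
    using integrable_translate[of "\<lambda>p. f (x, p)" "bilin a x + t"] fx[of x]
      integral_translate[of "\<lambda>p. h (f (x, p))" "bilin a x + t"] that
    by (simp_all add: add_ac)
  have iF: "integrable (nborel \<Otimes>\<^sub>M nborel) (\<lambda>(x, p). ?F x p)"
  proof (rule nborel_pair.Fubini_integrable)
    have "integrable nborel (\<lambda>x. LINT p|nborel. norm (f (x, p)))"
      using nborel_pair.integrable_fst'[OF integrable_norm[OF fp]] .
    then show "integrable nborel (\<lambda>x. LINT p|nborel. norm (case (x, p) of (x, p) \<Rightarrow> ?F x p))"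
      by (simp add: tr(2)[of cmod])
    show "AE x in nborel. integrable nborel (\<lambda>p. case (x, p) of (x, p) \<Rightarrow> ?F x p)"
      using tr(1)[of cmod] by simp
  qed measurable
  have ig: "integrable nborel g"
    using nborel_pair.integrable_snd[OF iF] by (simp add: g_def[abs_def])
  \<comment> \<open>The projection slice computation: after Fubini, translating \<open>p\<close> by
    \<open>bilin a x + t\<close> turns the exponent into the inner product of \<open>(x, p)\<close>
    with \<open>(twist c a, - cnj c)\<close>, plus the phase \<open>Re (c * t)\<close>.\<close>
  have gq: "FT g (- cnj c) = q c" for c
  proof -
    let ?y = "- cnj c"
    have iFe: "integrable (nborel \<Otimes>\<^sub>M nborel) (\<lambda>(x, p). ?F x p * iexp (p \<bullet> ?y))"
      using integrable_mult_bounded[OF iF, of "\<lambda>(x, p). iexp (p \<bullet> ?y)" 1] by (simp add: case_prod_beta')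
    have "FT g ?y = (LINT p|nborel. LINT x|nborel. ?F x p * iexp (p \<bullet> ?y))"
      unfolding FT_def g_def by simp
    also have "\<dots> = (LINT x|nborel. LINT p|nborel. ?F x p * iexp (p \<bullet> ?y))"
      by (rule nborel_pair.Fubini_integral[OF iFe])
    also have "\<dots> = (LINT x|nborel. LINT p|nborel. f (x, p) * iexp ((x, p) \<bullet> (twist c a, ?y)) * iexp (Re (c * t)))"
    proof (rule Bochner_Integration.integral_cong[OF refl])
      fix x
      have "(LINT p|nborel. ?F x p * iexp (p \<bullet> ?y))
          = (LINT p|nborel. f (x, (bilin a x + t) + p) * iexp ((((bilin a x + t) + p) - (bilin a x + t)) \<bullet> ?y))"
        by (simp add: add_ac)
      also have "\<dots> = (LINT p|nborel. f (x, p) * iexp ((p - (bilin a x + t)) \<bullet> ?y))"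
        by (rule integral_translate[of "\<lambda>p. f (x, p) * iexp ((p - (bilin a x + t)) \<bullet> ?y)" "bilin a x + t"]) simp
      also have "\<dots> = (LINT p|nborel. f (x, p) * iexp ((x, p) \<bullet> (twist c a, ?y)) * iexp (Re (c * t)))"
      proof (rule Bochner_Integration.integral_cong[OF refl])
        fix p
        have "(p - (bilin a x + t)) \<bullet> ?y = (x, p) \<bullet> (twist c a, ?y) + Re (c * t)"
          by (simp add: inner_twist Re_mult_eq_inner inner_diff_left inner_add_left inner_prod_def
              del: times_complex.sel)
        then show "f (x, p) * iexp ((p - (bilin a x + t)) \<bullet> ?y)
            = f (x, p) * iexp ((x, p) \<bullet> (twist c a, ?y)) * iexp (Re (c * t))"
          by (simp only: of_real_add distrib_left exp_add mult.assoc)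
      qed
      finally show "(LINT p|nborel. ?F x p * iexp (p \<bullet> ?y))
          = (LINT p|nborel. f (x, p) * iexp ((x, p) \<bullet> (twist c a, ?y)) * iexp (Re (c * t)))" .
    qed
    also have "\<dots> = (LINT x|nborel. LINT p|nborel. f (x, p) * iexp ((x, p) \<bullet> (twist c a, ?y))) * iexp (Re (c * t))"
      by (simp only: integral_mult_left_zero)
    also have "(LINT x|nborel. LINT p|nborel. f (x, p) * iexp ((x, p) \<bullet> (twist c a, ?y))) = FT f (twist c a, ?y)"
    proof -
      have "integrable (nborel \<Otimes>\<^sub>M nborel) (\<lambda>z. f z * iexp (z \<bullet> (twist c a, ?y)))"
        unfolding nborel_prod using schwartz_integrable[OF f] by (intro integrable_mult_bounded[where B=1]) auto
      from nborel_pair.integral_fst'[OF this] show ?thesis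
        unfolding FT_def nborel_prod .
    qed
    finally show ?thesis
      by (simp add: q_def slice_transform_def)
  qed
  have FTg: "FT g = (\<lambda>y. q (- cnj y))"
    using gq[of "- cnj y" for y] by (simp add: fun_eq_iff)
  \<comment> \<open>Integrability of the transform comes from \<open>q\<close> being Schwartz.
    Together with the continuity and the bound for \<open>g\<close> below, it permits pointwise
    inversion, which presents \<open>g\<close> as \<open>fourier q\<close>.\<close>
  have iFg: "integrable nborel (FT g)"
    unfolding FTg
    by (intro schwartz_integrable schwartz_compose_isometry[OF q]) (auto intro!: linearI)
  have cg: "continuous_on UNIV g"
  proof (subst continuous_on_sequentially, intro ballI allI impI, elim conjE)
    fix X :: "nat \<Rightarrow> complex" and p assume X: "X \<longlonglongrightarrow> p"
    have "(\<lambda>n. LINT x|nborel. ?F x (X n)) \<longlonglongrightarrow> (LINT x|nborel. ?F x p)"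
    proof (rule integral_dominated_convergence[where w="\<lambda>x. C * weight x"])
      show "AE x in nborel. (\<lambda>n. ?F x (X n)) \<longlonglongrightarrow> ?F x p"
        by (intro AE_I2 continuous_on_tendsto_compose[OF schwartz_continuous_on[OF f, of UNIV]] tendsto_intros X) auto
      show "integrable nborel (\<lambda>x::complex ^ 'm. C * weight x)"
        by (intro integrable_mult_right integrable_weight)
    qed (use C in auto)
    then show "(g \<circ> X) \<longlonglongrightarrow> g p"
      by (simp add: g_def comp_def)
  qed
  have Bg: "cmod (g p) \<le> (LINT x|(nborel :: (complex ^ 'm) measure). C * weight x)" for p
    unfolding g_def
  proof (rule order_trans[OF integral_norm_bound integral_mono])
    show "integrable nborel (\<lambda>x::complex ^ 'm. C * weight x)"
      by (intro integrable_mult_right integrable_weight)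
    show "integrable nborel (\<lambda>x. cmod (f (x, bilin a x + (p + t))))"
      using C(2) by (intro integrable_norm integrable_weight_bound[where C=C]) auto
  qed (use C in auto)
  have qg: "(\<lambda>c. fourier g (- c)) = q"
    using ig by (simp add: fourier_eq_FT gq fun_eq_iff)
  have "fourier (\<lambda>c. fourier g (- c)) p = g p" for p
  proof -
    have "fourier (\<lambda>c. fourier g (- c)) p = fourier (fourier g) (- p)"
      using ig by (intro fourier_reflect) (simp add: fourier_eq_FT)
    then show ?thesis
      using fourier_inversion[OF ig cg Bg iFg, of "- p"] by simp
  qed
  then have "fourier q = g"
    by (simp add: qg fun_eq_iff)
  then show ?thesis
    unfolding q_def g_def fun_eq_iff by (simp add: integral_mu)
qed

text \<open>
  \<open>h\<close> stands for a Borel representative of the Fourier transform of \<open>u\<close>.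
\<close>

locale radon_kernel =
  fixes u :: "complex gen_fun" and h :: "complex \<Rightarrow> complex" and m :: nat
  assumes h_measurable [measurable]: "h \<in> borel_measurable borel"
    and cmod_h: "cmod (h c) = cmod c ^ m"
    and u_fourier: "q \<in> schwartz \<Longrightarrow> u (fourier q) = (LINT c|nborel. h c * q c)"
begin

text \<open>The density whose \<open>fourier\<close> transform is the Radon transform at fixed
  \<open>a\<close>. The partial Fourier transform of the Radon transform is therefore its reflection
  in \<open>c\<close>.\<close>

definition symbol :: "((complex ^ 'm::finite) \<times> complex \<Rightarrow> complex) \<Rightarrow> complex ^ 'm \<Rightarrow> complex \<Rightarrow> complex" where
  "symbol f a c = h c * slice_transform f a c"

lemma cmod_h_le: "cmod (h c) \<le> (1 + (norm c)\<^sup>2) ^ m"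
proof -
  have "cmod c \<le> 1 + (norm c)\<^sup>2"
    using sum_squares_bound[of 1 "norm c"] norm_ge_zero[of c] unfolding power_one by linarith
  then show ?thesis
    by (simp add: cmod_h power_mono)
qed

text \<open>The growth of \<open>h\<close> is absorbed by the decay of \<open>FT f\<close>,
  evaluated at a point of norm at least \<open>cmod c\<close>; for this reason the constant does not
  depend on \<open>a\<close>.\<close>

lemma symbol_bound:
  fixes f :: "(complex ^ 'm::finite) \<times> complex \<Rightarrow> complex"
  assumes f: "f \<in> schwartz"
  obtains C where "C \<ge> 0" "\<And>a c. cmod (symbol f a c) \<le> C * weight c"
proof -
  obtain C where C: "C \<ge> 0"
    "\<And>x z. (1 + (norm (x, z))\<^sup>2) ^ m * cmod (FT f (x, z)) \<le> C * weight z"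
    using schwartz_section_bound[OF FT_schwartz[OF f]] by metis
  have "cmod (symbol f a c) \<le> C * weight c" for a c
  proof -
    have "(1 + (norm c)\<^sup>2) ^ m \<le> (1 + (norm (twist c a, - cnj c))\<^sup>2) ^ m"
      by (intro power_mono) (auto simp: norm_Pair)
    then have "cmod (symbol f a c) \<le> (1 + (norm (twist c a, - cnj c))\<^sup>2) ^ m * cmod (slice_transform f a c)"
      unfolding symbol_def norm_mult using cmod_h_le[of c] by (intro mult_right_mono) auto
    also have "\<dots> \<le> C * weight (- cnj c)"
      unfolding slice_transform_def by (rule C(2))
    finally show ?thesis by (simp add: weight_def)
  qed
  with C(1) show ?thesis by (rule that)
qed

lemma symbol_measurable_pair:
  fixes f :: "(complex ^ 'm::finite) \<times> complex \<Rightarrow> complex"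
  assumes f: "f \<in> schwartz"
  shows "(\<lambda>p. symbol f (fst p) (snd p)) \<in> borel_measurable (borel \<Otimes>\<^sub>M borel)"
proof -
  have [measurable]: "FT f \<in> borel_measurable (borel \<Otimes>\<^sub>M borel)"
    unfolding borel_prod by (rule schwartz_measurable[OF FT_schwartz[OF f]])
  show ?thesis
    unfolding symbol_def slice_transform_def by measurable
qed

lemma symbol_measurable:
  assumes "f \<in> schwartz"
  shows "symbol f a \<in> borel_measurable borel"
  using measurable_compose[OF measurable_Pair1' symbol_measurable_pair[OF assms], of a] by simp

lemma symbol_integrable:
  assumes "f \<in> schwartz"
  shows "integrable nborel (symbol f a)"
  using symbol_bound[OF assms] integrable_weight_bound[OF symbol_measurable[OF assms]] by metis

text \<open>The translation by \<open>t\<close> has become the modulation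
  \<open>iexp (Re (c * t))\<close> on the frequency side. Once \<open>u\<close> is replaced by
  integration against \<open>h\<close>, this modulation is exactly the kernel of
  \<open>fourier\<close>.\<close>

lemma radon_eq_fourier_symbol:
  fixes f :: "(complex ^ 'm::finite) \<times> complex \<Rightarrow> complex"
  assumes f: "f \<in> schwartz"
  shows "radon u f (a, t) = fourier (symbol f a) t"
proof -
  have "radon u f (a, t) = (LINT c|nborel. h c * (slice_transform f a c * iexp (Re (c * t))))"
    unfolding radon_def prod.case slice_integral_eq_fourier[OF f]
    by (rule u_fourier[OF slice_transform_schwartz[OF f]])
  also have "\<dots> = fourier (symbol f a) t"
    by (simp add: fourier_eq_FT[OF symbol_measurable[OF f]] FT_def symbol_def inner_complex_def mult_ac)
  finally show ?thesis .
qed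

lemma radon_eq_FT_symbol:
  fixes f :: "(complex ^ 'm::finite) \<times> complex \<Rightarrow> complex"
  assumes f: "f \<in> schwartz"
  shows "radon u f = (\<lambda>(a, t). FT (symbol f a) (cnj t))"
  by (simp add: fun_eq_iff radon_eq_fourier_symbol[OF f] fourier_eq_FT[OF symbol_measurable[OF f]])

lemma radon_measurable:
  fixes f :: "(complex ^ 'm::finite) \<times> complex \<Rightarrow> complex"
  assumes f: "f \<in> schwartz"
  shows "radon u f \<in> borel_measurable (borel \<Otimes>\<^sub>M borel)"
proof -
  have "(\<lambda>w. (fst (fst w), snd w)) \<in> (borel \<Otimes>\<^sub>M (borel :: complex measure)) \<Otimes>\<^sub>M borel \<rightarrow>\<^sub>M borel \<Otimes>\<^sub>M borel"
    by measurable
  from measurable_compose[OF this symbol_measurable_pair[OF f]]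
  have [measurable]: "(\<lambda>w. symbol f (fst (fst w)) (snd w))
      \<in> borel_measurable ((borel \<Otimes>\<^sub>M (borel :: complex measure)) \<Otimes>\<^sub>M borel)"
    by simp
  show ?thesis
    unfolding radon_eq_FT_symbol[OF f] FT_def by measurable
qed

section \<open>The conjugate kernel and the partial Fourier transform of the Radon transform\<close>

lemma tempered_cnj_h: "tempered_function (\<lambda>c. cnj (h c))"
  using cmod_h_le
  by (intro tempered_function_polynomial_growth[where C=1 and j=m] borel_measurable_lebesgue) auto

text \<open>\<open>schwartz_eq_fourier\<close> writes the conjugated test function as a transform,
  which makes \<open>u\<close> computable on it. Conjugation reverses the frequency, and the
  reflection in that representation restores it.\<close>

lemma conj_dist_eq:
  assumes g: "g \<in> schwartz"
  shows "conj_dist u g = (LINT c|nborel. cnj (h c) * fourier g c)"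
proof -
  have cg: "(\<lambda>t. cnj (g t)) \<in> schwartz"
    by (rule schwartz_cnj[OF g])
  have "fourier (\<lambda>t. cnj (g t)) (- c) = cnj (fourier g c)" for c
    by (simp add: fourier_eq_FT schwartz_measurable[OF g] schwartz_measurable[OF cg] FT_def exp_cnj
        flip: Bochner_Integration.integral_cnj)
  then have "u (\<lambda>t. cnj (g t)) = (LINT c|nborel. h c * cnj (fourier g c))"
    using u_fourier[OF schwartz_eq_fourier(1)[OF cg]] schwartz_eq_fourier(2)[OF cg] by simp
  then show ?thesis
    unfolding conj_dist_def by (simp flip: Bochner_Integration.integral_cnj)
qed

lemma conj_dist_eq_fourier_dist: "dist_eq (conj_dist u) (fourier_dist (fun_dist (\<lambda>c. cnj (h c))))"
  unfolding dist_eq_def fourier_dist_def fun_dist_def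
  using schwartz_measurable[OF fourier_schwartz] by (auto simp: conj_dist_eq integral_mu)

text \<open>By duality the transform is thrown onto the test function, where applying
  \<open>fourier\<close> twice gives a reflection; this is the origin of \<open>- c\<close>. The
  symbol is bounded and integrable, so it and its transform are bounded, hence tempered.\<close>

lemma partial_fourier_radon:
  fixes f :: "(complex ^ 'm::finite) \<times> complex \<Rightarrow> complex"
  assumes f: "f \<in> schwartz"
  shows "partial_fourier (radon u f) (\<lambda>(a, c). symbol f a (- c))"
  unfolding partial_fourier_def
proof (intro conjI allI)
  have "(\<lambda>p. symbol f (fst p) (- snd p)) \<in> borel_measurable (borel \<Otimes>\<^sub>M borel)"
    using measurable_compose[OF _ symbol_measurable_pair[OF f], of "\<lambda>p. (fst p, - snd p)" "borel \<Otimes>\<^sub>M borel"] by simp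
  then show "(\<lambda>(a, c). symbol f a (- c)) \<in> borel_measurable lebesgue"
    by (intro borel_measurable_lebesgue) (simp add: case_prod_beta' borel_prod)
  fix a :: "complex ^ 'm"
  note [measurable] = symbol_measurable[OF f, of a]
  have iS: "integrable nborel (symbol f a)"
    by (rule symbol_integrable[OF f])
  obtain C where C: "C \<ge> 0" "\<And>c. cmod (symbol f a c) \<le> C * weight c"
    using symbol_bound[OF f] by metis
  have rad: "(\<lambda>t. radon u f (a, t)) = fourier (symbol f a)"
    by (simp add: fun_eq_iff radon_eq_fourier_symbol[OF f])
  have fm: "fourier (symbol f a) \<in> borel_measurable borel"
    by (simp add: fourier_eq_FT)
  show "tempered_function (\<lambda>t. radon u f (a, t))"
    unfolding rad using cmod_FT_le[OF iS] fm
    by (intro tempered_function_polynomial_growth[where C="LINT c|nborel. cmod (symbol f a c)" and j=0]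
        borel_measurable_lebesgue) (auto simp: fourier_eq_FT)
  have "cmod (symbol f a (- c)) \<le> C" for c
    using C(2)[of "- c"] mult_left_mono[OF weight_le_1 C(1), of "- c"] by simp
  then show "tempered_function (\<lambda>c. (\<lambda>(a, c). symbol f a (- c)) (a, c))"
    using C(1) by (intro tempered_function_polynomial_growth[where C=C and j=0] borel_measurable_lebesgue) auto
  show "dist_eq (fourier_dist (fun_dist (\<lambda>t. radon u f (a, t)))) (fun_dist (\<lambda>c. (\<lambda>(a, c). symbol f a (- c)) (a, c)))"
    unfolding dist_eq_def fourier_dist_def fun_dist_def rad
  proof
    fix g :: "complex \<Rightarrow> complex" assume g: "g \<in> schwartz"
    note [measurable] = schwartz_measurable[OF g] schwartz_measurable[OF fourier_schwartz[OF g]] fm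
    have "(LINT t|mu. fourier (symbol f a) t * fourier g t) = (LINT t|nborel. fourier (symbol f a) t * fourier g t)"
      by (rule integral_mu) measurable
    also have "\<dots> = (LINT c|nborel. symbol f a c * fourier (fourier g) c)"
      by (rule fourier_multiplication[OF iS schwartz_integrable[OF fourier_schwartz[OF g]]])
    also have "\<dots> = (LINT c|nborel. symbol f a (- (0 + - c)) * g (0 + - c))"
      by (simp add: fourier_inversion_schwartz[OF g])
    also have "\<dots> = (LINT c|nborel. symbol f a (- c) * g c) /\<^sub>R 1 ^ DIM(complex)"
      by (rule integral_affine_conformal[where f="\<lambda>c. symbol f a (- c) * g c"]) (auto intro: linear_uminus)
    finally show "(LINT t|mu. fourier (symbol f a) t * fourier g t)
        = (LINT c|mu. (case (a, c) of (a, c) \<Rightarrow> symbol f a (- c)) * g c)"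
      by (simp add: integral_mu)
  qed
qed

text \<open>Beyond growth bounds, this is where the modulus of \<open>h\<close> enters: its phase
  cancels, leaving precisely the Jacobian of \<open>twist\<close> when
  \<open>m = CARD('m)\<close>.\<close>

lemma symbol_mult_cnj:
  "symbol f a c * cnj (symbol g a c) = cmod c ^ (2 * m) *\<^sub>R (slice_transform f a c * cnj (slice_transform g a c))"
  and symbol_mult_cnj_h: "symbol f a c * cnj (h c) = cmod c ^ (2 * m) *\<^sub>R slice_transform f a c"
proof -
  have h: "h c * cnj (h c) = of_real (cmod c ^ (2 * m))"
    by (simp add: complex_norm_square[symmetric] cmod_h power_mult[symmetric] mult.commute)
  show "symbol f a c * cnj (h c) = cmod c ^ (2 * m) *\<^sub>R slice_transform f a c"
    using h by (simp add: symbol_def scaleR_conv_of_real mult_ac)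
  have "symbol f a c * cnj (symbol g a c) = (h c * cnj (h c)) * (slice_transform f a c * cnj (slice_transform g a c))"
    by (simp add: symbol_def mult_ac)
  then show "symbol f a c * cnj (symbol g a c)
      = cmod c ^ (2 * m) *\<^sub>R (slice_transform f a c * cnj (slice_transform g a c))"
    by (simp only: h scaleR_conv_of_real)
qed

text \<open>The \<open>- c\<close> in \<open>has_kernel_integral\<close> cancels the reflection in
  the partial transform, so the kernel integrand involves \<open>symbol f a c\<close> itself. The
  multiplier \<open>cnj (h c)\<close> completes the Jacobian.\<close>

theorem radon_inversion:
  fixes f :: "(complex ^ 'm::finite) \<times> complex \<Rightarrow> complex"
  assumes f: "f \<in> schwartz" and m: "m = CARD('m)"
  shows "has_kernel_integral (conj_dist u) (radon u f) y (f y)"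
proof -
  obtain x z where y: "y = (x, z)" by (cases y)
  \<comment> \<open>The integrand of Fourier inversion at \<open>y\<close>; its pull-back along
    \<open>(twist c a, - cnj c)\<close>, multiplied by the Jacobian, is the kernel
    integrand.\<close>
  let ?Q = "\<lambda>v. FT f v * iexp (- (y \<bullet> v))"
  have Q: "integrable nborel ?Q"
    using schwartz_integrable[OF FT_schwartz[OF f]] by (intro integrable_mult_bounded[where B=1]) auto
  have eq: "symbol f a c * cnj (h c) * iexp (Re (c * (z - bilin a x)))
      = cmod c ^ (2 * CARD('m)) *\<^sub>R ?Q (twist c a, - cnj c)" for a c
  proof -
    have "Re (c * (z - bilin a x)) = - (y \<bullet> (twist c a, - cnj c))"
      by (simp add: y inner_prod_def inner_twist Re_mult_eq_inner right_diff_distrib del: times_complex.sel)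
    then show ?thesis
      unfolding symbol_mult_cnj_h by (simp add: slice_transform_def m)
  qed
  have int: "integrable nborel (\<lambda>(a, c). symbol f a c * cnj (h c) * iexp (Re (c * (z - bilin a x))))"
    unfolding eq by (rule integrable_twist[OF Q])
  have meas: "(\<lambda>(a, c). symbol f a c * cnj (h c) * iexp (Re (c * (z - bilin a x)))) \<in> borel_measurable borel"
    using int by auto
  then have meas': "(\<lambda>p. symbol f (fst p) (snd p) * cnj (h (snd p)) * iexp (Re (snd p * (z - bilin (fst p) x))))
      \<in> borel_measurable (borel \<Otimes>\<^sub>M borel)"
    unfolding borel_prod by (simp add: case_prod_beta')
  \<comment> \<open>Passing from iterated integrals over \<open>mu\<close> to \<open>nborel\<close>
    goes one variable at a time and requires Borel measurability of the sections and of the inner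
    integral.\<close>
  have "(\<lambda>a. symbol f a c * cnj (h c) * iexp (Re (c * (z - bilin a x)))) \<in> borel_measurable borel" for c
    using measurable_compose[OF measurable_Pair2' meas', of c] by simp
  moreover have "(\<lambda>c. LINT a|nborel. symbol f a c * cnj (h c) * iexp (Re (c * (z - bilin a x)))) \<in> borel_measurable borel"
    using borel_measurable_integrable[OF nborel_pair.integrable_fst'[OF nborel_pair.integrable_product_swap[OF int[folded nborel_prod]]]]
    by (simp only: prod.case measurable_nborel2)
  ultimately have "(LINT c|mu. LINT a|mu. symbol f a c * cnj (h c) * iexp (Re (c * (z - bilin a x))))
      = (LINT c|nborel. LINT a|nborel. symbol f a c * cnj (h c) * iexp (Re (c * (z - bilin a x))))"
    by (simp add: integral_mu)
  also have "\<dots> = f y"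
    unfolding eq integral_twist[OF Q] by (rule FT_inversion_schwartz[OF f])
  finally have val: "f y = (LINT c|mu. LINT a|mu. symbol f a c * cnj (h c) * iexp (Re (c * (z - bilin a x))))" ..
  show ?thesis
    unfolding has_kernel_integral_def y prod.case
    using tempered_cnj_h conj_dist_eq_fourier_dist partial_fourier_radon[OF f] int meas val
    by (intro exI[of _ "\<lambda>c. cnj (h c)"] exI[of _ "\<lambda>(a, c). symbol f a (- c)"])
      (simp add: integrable_mu_iff y)
qed

text \<open>Plancherel is used twice: on the plane in the last variable for each \<open>a\<close>,
  with a symbol that is only measurable in \<open>c\<close>, and on the full space after the
  substitution by \<open>twist\<close>.\<close>

theorem
  fixes f g :: "(complex ^ 'm::finite) \<times> complex \<Rightarrow> complex"
  assumes f: "f \<in> schwartz" and g: "g \<in> schwartz" and m: "m = CARD('m)"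
  shows radon_mult_cnj_integrable: "integrable nborel (\<lambda>y. radon u f y * cnj (radon u g y))"
    and radon_Plancherel: "(LINT y|nborel. radon u f y * cnj (radon u g y)) = (LINT x|nborel. f x * cnj (g x))"
proof -
  have slice: "integrable nborel (\<lambda>t. radon u f (a, t) * cnj (radon u g (a, t)))"
    "(LINT t|nborel. radon u f (a, t) * cnj (radon u g (a, t))) = (LINT c|nborel. symbol f a c * cnj (symbol g a c))"
    if f: "f \<in> schwartz" and g: "g \<in> schwartz" for a and f g :: "(complex ^ 'm) \<times> complex \<Rightarrow> complex"
  proof -
    note [measurable] = symbol_measurable[OF f, of a] symbol_measurable[OF g, of a]
    obtain C D where C: "\<And>c. cmod (symbol f a c) \<le> C * weight c" and D: "\<And>c. cmod (symbol g a c) \<le> D * weight c"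
      using symbol_bound[OF f] symbol_bound[OF g] by metis
    let ?P = "\<lambda>t. FT (symbol f a) t * cnj (FT (symbol g a) t)"
    have P: "integrable nborel ?P" "(LINT t|nborel. ?P t) = (LINT c|nborel. symbol f a c * cnj (symbol g a c))"
      using integrable_FT_mult_cnj[OF _ C _ D] Plancherel[OF _ C _ D] by simp_all
    have "integrable nborel (\<lambda>t. ?P (0 + cnj t))" "(LINT t|nborel. ?P (0 + cnj t)) = (LINT t|nborel. ?P t) /\<^sub>R 1 ^ DIM(complex)"
      using P(1) by (subst integrable_affine_conformal[OF linear_cnj, of 1 ?P] integral_affine_conformal[OF linear_cnj, of 1 ?P]; simp)+
    then show "integrable nborel (\<lambda>t. radon u f (a, t) * cnj (radon u g (a, t)))"
      "(LINT t|nborel. radon u f (a, t) * cnj (radon u g (a, t))) = (LINT c|nborel. symbol f a c * cnj (symbol g a c))"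
      by (simp_all add: radon_eq_FT_symbol f g P(2))
  qed
  have prod: "integrable (nborel \<Otimes>\<^sub>M nborel) (\<lambda>(a, c). symbol f a c * cnj (symbol g a c))"
    "(LINT c|nborel. LINT a|nborel. symbol f a c * cnj (symbol g a c)) = (LINT x|nborel. f x * cnj (g x))"
    if f: "f \<in> schwartz" and g: "g \<in> schwartz" for f g :: "(complex ^ 'm) \<times> complex \<Rightarrow> complex"
  proof -
    obtain C D where C: "\<And>y. cmod (f y) \<le> C * weight y" and D: "\<And>y. cmod (g y) \<le> D * weight y"
      using schwartz_weight_bound[OF f, of 0] schwartz_weight_bound[OF g, of 0]
      unfolding power_0 mult_1 by metis
    note P = integrable_FT_mult_cnj[OF schwartz_measurable[OF f] C schwartz_measurable[OF g] D]
    show "integrable (nborel \<Otimes>\<^sub>M nborel) (\<lambda>(a, c). symbol f a c * cnj (symbol g a c))"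
      using integrable_twist[OF P] by (simp add: nborel_prod symbol_mult_cnj m slice_transform_def)
    show "(LINT c|nborel. LINT a|nborel. symbol f a c * cnj (symbol g a c)) = (LINT x|nborel. f x * cnj (g x))"
      using integral_twist[OF P] Plancherel[OF schwartz_measurable[OF f] C schwartz_measurable[OF g] D]
      by (simp add: symbol_mult_cnj m slice_transform_def)
  qed
  \<comment> \<open>The diagonal comes before the mixed product: Fubini asks for integrals of
    absolute values, and slicewise Plancherel evaluates these for squared moduli.\<close>
  have L2: "integrable (nborel \<Otimes>\<^sub>M nborel) (\<lambda>y. (cmod (radon u f y))\<^sup>2)"
    if f: "f \<in> schwartz" for f :: "(complex ^ 'm) \<times> complex \<Rightarrow> complex"
  proof (rule nborel_pair.Fubini_integrable)
    note [measurable] = radon_measurable[OF f]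
    show "(\<lambda>y. (cmod (radon u f y))\<^sup>2) \<in> borel_measurable (nborel \<Otimes>\<^sub>M nborel)"
      by measurable
    have sq: "(cmod z)\<^sup>2 = Re (z * cnj z)" "norm ((cmod z)\<^sup>2) = Re (z * cnj z)" for z
      by (simp_all flip: complex_norm_square)
    show "AE a in nborel. integrable nborel (\<lambda>t. (cmod (radon u f (a, t)))\<^sup>2)"
      unfolding sq(1) using slice(1)[OF f f] by (intro AE_I2 integrable_Re)
    have "(LINT t|nborel. norm ((cmod (radon u f (a, t)))\<^sup>2)) = Re (LINT c|nborel. symbol f a c * cnj (symbol f a c))" for a
      by (simp only: sq(2) integral_Re[OF slice(1)[OF f f]] slice(2)[OF f f])
    moreover have "integrable nborel (\<lambda>a. Re (LINT c|nborel. symbol f a c * cnj (symbol f a c)))"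
      using nborel_pair.integrable_fst'[OF prod(1)[OF f f]] by (intro integrable_Re) simp
    ultimately show "integrable nborel (\<lambda>a. LINT t|nborel. norm ((cmod (radon u f (a, t)))\<^sup>2))"
      by simp
  qed
  note [measurable] = radon_measurable[OF f] radon_measurable[OF g]
  have int: "integrable (nborel \<Otimes>\<^sub>M nborel) (\<lambda>y. radon u f y * cnj (radon u g y))"
  proof (rule Bochner_Integration.integrable_bound)
    show "integrable (nborel \<Otimes>\<^sub>M nborel) (\<lambda>y. (cmod (radon u f y))\<^sup>2 + (cmod (radon u g y))\<^sup>2)"
      using L2[OF f] L2[OF g] by simp
    have "cmod (v * cnj w) \<le> norm ((cmod v)\<^sup>2 + (cmod w)\<^sup>2)" for v w
      using sum_squares_bound[of "cmod v" "cmod w"] mult_nonneg_nonneg[OF norm_ge_zero norm_ge_zero, of v w]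
        abs_ge_self[of "(cmod v)\<^sup>2 + (cmod w)\<^sup>2"]
      unfolding norm_mult complex_mod_cnj real_norm_def by linarith
    then show "AE y in nborel \<Otimes>\<^sub>M nborel. cmod (radon u f y * cnj (radon u g y))
        \<le> norm ((cmod (radon u f y))\<^sup>2 + (cmod (radon u g y))\<^sup>2)"
      by simp
  qed measurable
  then show "integrable nborel (\<lambda>y. radon u f y * cnj (radon u g y))"
    by (simp add: nborel_prod)
  have "(LINT y|nborel. radon u f y * cnj (radon u g y)) = (LINT a|nborel. LINT t|nborel. radon u f (a, t) * cnj (radon u g (a, t)))"
    using nborel_pair.integral_fst'[OF int] by (simp add: nborel_prod)
  also have "\<dots> = (LINT a|nborel. LINT c|nborel. symbol f a c * cnj (symbol g a c))"
    by (simp only: slice(2)[OF f g])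
  also have "\<dots> = (LINT c|nborel. LINT a|nborel. symbol f a c * cnj (symbol g a c))"
    by (rule nborel_pair.Fubini_integral[OF prod(1)[OF f g], symmetric])
  also have "\<dots> = (LINT x|nborel. f x * cnj (g x))"
    by (rule prod(2)[OF f g])
  finally show "(LINT y|nborel. radon u f y * cnj (radon u g y)) = (LINT x|nborel. f x * cnj (g x))" .
qed

theorem radon_generalized_fourier_transform:
  assumes m: "m = CARD('m::finite)"
  shows "generalized_fourier_transform
    (radon u :: ((complex ^ 'm) \<times> complex \<Rightarrow> complex) \<Rightarrow> (complex ^ 'm) \<times> complex \<Rightarrow> complex)
    (has_kernel_integral (conj_dist u))"
  unfolding generalized_fourier_transform_def
proof (intro conjI ballI allI)
  fix f :: "(complex ^ 'm) \<times> complex \<Rightarrow> complex" assume f: "f \<in> schwartz"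
  show "has_kernel_integral (conj_dist u) (radon u f) y (f y)" for y
    by (rule radon_inversion[OF f m])
  fix g :: "(complex ^ 'm) \<times> complex \<Rightarrow> complex" assume g: "g \<in> schwartz"
  have fm [measurable]: "f \<in> borel_measurable borel" and gm [measurable]: "g \<in> borel_measurable borel"
    using f g schwartz_measurable by auto
  have Rm: "(\<lambda>y. radon u f y * cnj (radon u g y)) \<in> borel_measurable borel"
    using radon_mult_cnj_integrable[OF f g m] by auto
  obtain D where D: "\<And>y. cmod (g y) \<le> D"
    using schwartz_decay[OF g, of 0] unfolding power_0 mult_1 by metis
  have "integrable nborel (\<lambda>x. f x * cnj (g x))"
    using schwartz_integrable[OF f] D by (intro integrable_mult_bounded[where B=D]) auto
  then show "integrable mu (\<lambda>x. f x * cnj (g x))"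
    by (simp add: integrable_mu_iff)
  show "integrable mu (\<lambda>y. radon u f y * cnj (radon u g y))"
    using radon_mult_cnj_integrable[OF f g m] Rm by (simp add: integrable_mu_iff)
  show "(LINT x|mu. f x * cnj (g x)) = (LINT y|mu. radon u f y * cnj (radon u g y))"
    using radon_Plancherel[OF f g m] Rm by (simp add: integral_mu)
qed

end

text \<open>Since \<open>u_hat c\<close> times its conjugate equals
  \<open>cmod c ^ (2 * (n - 1))\<close> almost everywhere, \<open>U_hat\<close> agrees almost
  everywhere with the conjugate of \<open>u_hat\<close>, which is the multiplier of
  \<open>conj_dist u\<close>.\<close>

theorem mainTheorem1:
  fixes n :: nat
    and u :: "complex gen_fun"
    and u_hat :: "complex \<Rightarrow> complex"
    and U_hat :: "complex \<Rightarrow> complex"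
    and U :: "complex gen_fun"
  assumes "n \<ge> 2" and "CARD('m::finite) = n - 1"
    and "tempered_dist u"
    and "locally_integrable u_hat"
    and "dist_eq (fourier_dist u) (fun_dist u_hat)"
    and "AE c in lebesgue. cmod (u_hat c) = cmod c ^ (n - 1)"
  defines "U_hat \<equiv> \<lambda>c. inverse (u_hat c) * complex_of_real (cmod c ^ (2 * (n - 1)))"
    and "U \<equiv> fourier_dist (fun_dist U_hat)"
  shows "tempered_function U_hat \<and> dist_eq U (conj_dist u) \<and>
    generalized_fourier_transform
      (radon u :: ((complex ^ 'm) \<times> complex \<Rightarrow> complex) \<Rightarrow> (complex ^ 'm) \<times> complex \<Rightarrow> complex)
      (has_kernel_integral (conj_dist u))"
proof -
  let ?m = "n - 1"
  have u_meas [measurable]: "u_hat \<in> borel_measurable lebesgue"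
    by (rule locally_integrable_measurable) fact
  obtain h0 where [measurable]: "h0 \<in> borel_measurable borel" and h0: "AE c in lebesgue. u_hat c = h0 c"
    by (rule lebesgue_measurable_borel_representative[OF u_meas])
  \<comment> \<open>The modulus condition on \<open>u_hat\<close> holds only almost everywhere.
    Where it fails for \<open>h0\<close> the value is reset to a real number of the right modulus,
    so that the condition holds at every point and \<open>h\<close> remains Borel.\<close>
  define h where "h c = (if cmod (h0 c) = cmod c ^ ?m then h0 c else of_real (cmod c ^ ?m))" for c
  have h_meas [measurable]: "h \<in> borel_measurable borel"
    unfolding h_def by measurable
  then have [measurable]: "h \<in> borel_measurable lebesgue"
    by (rule borel_measurable_lebesgue)
  have cmod_h: "cmod (h c) = cmod c ^ ?m" for c
    by (simp add: h_def norm_power)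
  have uh: "AE c in lebesgue. u_hat c = h c"
    using h0 assms(6) by eventually_elim (simp add: h_def)
  interpret radon_kernel u h ?m
  proof
    fix q :: "complex \<Rightarrow> complex" assume q: "q \<in> schwartz"
    note [measurable] = schwartz_measurable[OF q] borel_measurable_lebesgue[OF schwartz_measurable[OF q]]
    have "u (fourier q) = (LINT c|mu. u_hat c * q c)"
      using assms(5) q by (simp add: dist_eq_def fourier_dist_def fun_dist_def)
    also have "\<dots> = (LINT c|mu. h c * q c)"
      using uh by (intro integral_cong_AE) (auto simp: AE_mu_iff elim!: eventually_mono)
    finally show "u (fourier q) = (LINT c|nborel. h c * q c)"
      by (simp add: integral_mu)
  qed (use cmod_h in auto)
  \<comment> \<open>The origin is excluded so that \<open>h c\<close> is nonzero and
    \<open>inverse (u_hat c)\<close> is a genuine reciprocal.\<close>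
  have "AE c in lebesgue. c \<noteq> (0 :: complex)"
    by (intro AE_completion AE_lborel_singleton)
  then have Uh: "AE c in lebesgue. U_hat c = cnj (h c)"
    using uh
  proof eventually_elim
    fix c :: complex assume c: "c \<noteq> 0" and eq: "u_hat c = h c"
    have "h c * cnj (h c) = of_real (cmod c ^ (2 * ?m))"
      by (simp add: complex_norm_square[symmetric] cmod_h power_mult[symmetric] mult.commute)
    moreover have "h c \<noteq> 0"
      using cmod_h[of c] c by auto
    ultimately show "U_hat c = cnj (h c)"
      unfolding U_hat_def eq by (simp add: field_simps)
  qed
  have [measurable]: "U_hat \<in> borel_measurable lebesgue"
    unfolding U_hat_def by (intro borel_measurable_times borel_measurable_inverse u_meas borel_measurable_lebesgue) measurable
  have "AE c in lebesgue. cmod (U_hat c) \<le> 1 * (1 + (norm c)\<^sup>2) ^ ?m"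
    using Uh by eventually_elim (simp only: complex_mod_cnj mult_1 cmod_h_le)
  then have "tempered_function U_hat"
    by (intro tempered_function_polynomial_growth[where C=1 and j="n - 1"]) auto
  moreover have "dist_eq U (conj_dist u)"
    unfolding dist_eq_def U_def fourier_dist_def fun_dist_def
  proof
    fix g :: "complex \<Rightarrow> complex" assume g: "g \<in> schwartz"
    note [measurable] = schwartz_measurable[OF fourier_schwartz[OF g]]
      borel_measurable_lebesgue[OF schwartz_measurable[OF fourier_schwartz[OF g]]]
    have "(LINT c|mu. U_hat c * fourier g c) = (LINT c|mu. cnj (h c) * fourier g c)"
      using Uh by (intro integral_cong_AE) (auto simp: AE_mu_iff elim!: eventually_mono)
    then show "(LINT c|mu. U_hat c * fourier g c) = conj_dist u g"
      by (simp add: conj_dist_eq[OF g] integral_mu)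
  qed
  ultimately show ?thesis
    using radon_generalized_fourier_transform[where 'm='m] assms(2) by simp
qed

end
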